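(* The functors $F_{\uparrow\downarrow}=F_{\uparrow}\circ F_{\downarrow}$ and $F_{\uparrow\underline{s}\downarrow}=F_{\uparrow}\circ F_{\underline{s}}\circ F_{\downarrow}$ are biadjoint.
   Context: Let $\mathbf{k}$ be a commutative ring and $R=\mathbf{k}\langle x_1,x_2\rangle/(x_1x_2+x_2x_1)$, graded with $\deg x_1=\deg x_2=2$. Let $s$ be the $\mathbf{k}$-algebra automorphism of $R$ with $s(x_1)=-x_2$, $s(x_2)=-x_1$. The odd Demazure operator is the $\mathbf{k}$-linear map $\partial:R\to R$ with $\partial(1)=0$, $\partial(x_1)=\partial(x_2)=1$ and $\partial(fg)=\partial(f)g+s(f)\partial(g)$ for $f,g\in R$. Let $R^s=\ker\partial=\mathrm{im}\,\partial\subset R$; it is a graded subring, stable under $s$, generated by $x_1-x_2$ and $x_1x_2$. Let $\underline{R}^s$ be the graded $R^s$-bimodule that is free of rank one as a left and as a right $R^s$-module on a generator $\underline{1}^s$ of degree $0$, with $f\,\underline{1}^s=\underline{1}^s\,s(f)$ for $f\in R^s$. For a graded ring $A$, $A\text{-gmod}$ denotes the category of graded (left) $A$-modules and degree-zero maps. Functors: $F_{\uparrow}:R^s\text{-gmod}\to R\text{-gmod}$ is the induction functor of tensoring with the graded bimodule ${}_RR_{R^s}$, $F_\uparrow(M)=R\otimes_{R^s}M$; $F_{\downarrow}:R\text{-gmod}\to R^s\text{-gmod}$ is the restriction functor (isomorphic to tensoring with ${}_{R^s}R_R$); $F_{\underline{s}}:R^s\text{-gmod}\to R^s\text{-gmod}$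 is tensoring with $\underline{R}^s$, $F_{\underline{s}}(M)=\underline{R}^s\otimes_{R^s}M$. Two functors are biadjoint if each is both left and right adjoint to the other.
   Formalization: Both functors are normalised by the grading shift ⟨1⟩ (M⟨1⟩_i = M_{i+1}): with degree-zero maps the unshifted functors are not biadjoint for nonzero k, since Hom(F_{↑↓}R, R) has rank 3 over k but Hom(R, F_{↑s↓}R) has rank 1. *)

theory Defs
  imports "HOL-Algebra.QuotRing" "HOL-Algebra.Module"
begin

section \<open>Categories, functors and adjunctions\<close>

text \<open>Hom-sets may overlap (the same set-theoretic map can be a morphism between several pairs of
  objects), so composition and the action of a functor on morphisms take the objects as arguments:
  \<open>Comp C a b c g f\<close> is the composite \<open>a \<rightarrow> b \<rightarrow> c\<close> of \<open>f : a \<rightarrow> b\<close> and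
  \<open>g : b \<rightarrow> c\<close>.\<close>

record ('o, 'm) cat =
  Obj :: "'o set"
  Hom :: "'o \<Rightarrow> 'o \<Rightarrow> 'm set"
  Id :: "'o \<Rightarrow> 'm"
  Comp :: "'o \<Rightarrow> 'o \<Rightarrow> 'o \<Rightarrow> 'm \<Rightarrow> 'm \<Rightarrow> 'm"

locale category =
  fixes C :: "('o, 'm) cat"
  assumes Id_Hom: "a \<in> Obj C \<Longrightarrow> Id C a \<in> Hom C a a"
    and Comp_Hom: "\<lbrakk>a \<in> Obj C; b \<in> Obj C; c \<in> Obj C; f \<in> Hom C a b; g \<in> Hom C b c\<rbrakk>
      \<Longrightarrow> Comp C a b c g f \<in> Hom C a c"
    and Comp_Id_right: "\<lbrakk>a \<in> Obj C; b \<in> Obj C; f \<in> Hom C a b\<rbrakk> \<Longrightarrow> Comp C a a b f (Id C a) = f"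
    and Comp_Id_left: "\<lbrakk>a \<in> Obj C; b \<in> Obj C; f \<in> Hom C a b\<rbrakk> \<Longrightarrow> Comp C a b b (Id C b) f = f"
    and Comp_assoc: "\<lbrakk>a \<in> Obj C; b \<in> Obj C; c \<in> Obj C; d \<in> Obj C;
        f \<in> Hom C a b; g \<in> Hom C b c; h \<in> Hom C c d\<rbrakk>
      \<Longrightarrow> Comp C a c d h (Comp C a b c g f) = Comp C a b d (Comp C b c d h g) f"

record ('o, 'm, 'p, 'n) func =
  omap :: "'o \<Rightarrow> 'p"
  amap :: "'o \<Rightarrow> 'o \<Rightarrow> 'm \<Rightarrow> 'n"

locale is_functor = source: category C + target: category D
  for C :: "('o, 'm) cat" and D :: "('p, 'n) cat" +
  fixes F :: "('o, 'm, 'p, 'n) func"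
  assumes omap_Obj: "a \<in> Obj C \<Longrightarrow> omap F a \<in> Obj D"
    and amap_Hom: "\<lbrakk>a \<in> Obj C; b \<in> Obj C; f \<in> Hom C a b\<rbrakk>
      \<Longrightarrow> amap F a b f \<in> Hom D (omap F a) (omap F b)"
    and amap_Id: "a \<in> Obj C \<Longrightarrow> amap F a a (Id C a) = Id D (omap F a)"
    and amap_Comp: "\<lbrakk>a \<in> Obj C; b \<in> Obj C; c \<in> Obj C; f \<in> Hom C a b; g \<in> Hom C b c\<rbrakk>
      \<Longrightarrow> amap F a c (Comp C a b c g f) =
          Comp D (omap F a) (omap F b) (omap F c) (amap F b c g) (amap F a b f)"

definition comp_func ::
  "('p, 'n, 'q, 'l) func \<Rightarrow> ('o, 'm, 'p, 'n) func \<Rightarrow> ('o, 'm, 'q, 'l) func"  (infixr \<open>\<circ>\<^sub>F\<close> 55)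
  where "G \<circ>\<^sub>F F = \<lparr>omap = \<lambda>a. omap G (omap F a),
                   amap = \<lambda>a b f. amap G (omap F a) (omap F b) (amap F a b f)\<rparr>"

text \<open>\<open>adjoint C D F G\<close>: \<open>F : C \<rightarrow> D\<close> is left adjoint to \<open>G : D \<rightarrow> C\<close>.\<close>

definition adjoint ::
  "('o, 'm) cat \<Rightarrow> ('p, 'n) cat \<Rightarrow> ('o, 'm, 'p, 'n) func \<Rightarrow> ('p, 'n, 'o, 'm) func \<Rightarrow> bool"
  where "adjoint C D F G \<longleftrightarrow> is_functor C D F \<and> is_functor D C G \<and>
    (\<exists>\<Phi> :: 'o \<Rightarrow> 'p \<Rightarrow> 'n \<Rightarrow> 'm.
      (\<forall>a\<in>Obj C. \<forall>b\<in>Obj D. bij_betw (\<Phi> a b) (Hom D (omap F a) b) (Hom C a (omap G b))) \<and>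
      (\<forall>a\<in>Obj C. \<forall>a'\<in>Obj C. \<forall>b\<in>Obj D. \<forall>f\<in>Hom C a' a. \<forall>h\<in>Hom D (omap F a) b.
        \<Phi> a' b (Comp D (omap F a') (omap F a) b h (amap F a' a f)) =
        Comp C a' a (omap G b) (\<Phi> a b h) f) \<and>
      (\<forall>a\<in>Obj C. \<forall>b\<in>Obj D. \<forall>b'\<in>Obj D. \<forall>g\<in>Hom D b b'. \<forall>h\<in>Hom D (omap F a) b.
        \<Phi> a b' (Comp D (omap F a) b b' g h) =
        Comp C a (omap G b) (omap G b') (amap G b b' g) (\<Phi> a b h)))"

definition biadjoint ::
  "('o, 'm) cat \<Rightarrow> ('p, 'n) cat \<Rightarrow> ('o, 'm, 'p, 'n) func \<Rightarrow> ('p, 'n, 'o, 'm) func \<Rightarrow> bool"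
  where "biadjoint C D F G \<longleftrightarrow> adjoint C D F G \<and> adjoint D C G F"


section \<open>Graded rings, graded modules, graded bimodules\<close>

text \<open>\<open>V\<close> is a direct sum decomposition of the abelian group \<open>M\<close>.\<close>

definition graded_by :: "('b, 'z) ring_scheme \<Rightarrow> (int \<Rightarrow> 'b set) \<Rightarrow> bool"
  where "graded_by M V \<longleftrightarrow>
    (\<forall>i. additive_subgroup (V i) M) \<and>
    (\<forall>m\<in>carrier M. \<exists>!c. (\<forall>i. c i \<in> V i) \<and> finite {i. c i \<noteq> \<zero>\<^bsub>M\<^esub>} \<and>
        m = (\<Oplus>\<^bsub>M\<^esub>i\<in>{i. c i \<noteq> \<zero>\<^bsub>M\<^esub>}. c i))"

record 'a gring = "'a ring" +
  rgrade :: "int \<Rightarrow> 'a set"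

locale graded_ring = ring A for A :: "'a gring" (structure) +
  assumes rgrade_sum: "graded_by A (rgrade A)"
    and rgrade_one: "\<one> \<in> rgrade A 0"
    and rgrade_mult: "\<lbrakk>x \<in> rgrade A i; y \<in> rgrade A j\<rbrakk> \<Longrightarrow> x \<otimes> y \<in> rgrade A (i + j)"

text \<open>The library's record \<open>module\<close> (not its locale, which requires a commutative base ring) carries
  the operations of a left module; its fields \<open>mult\<close> and \<open>one\<close> play no role.\<close>

record ('a, 'b) gmodule = "('a, 'b) module" +
  mgrade :: "int \<Rightarrow> 'b set"

locale graded_module = A: graded_ring A + M: abelian_group M
  for A :: "'a gring" (structure) and M :: "('a, 'b) gmodule" +
  assumes smult_closed: "\<lbrakk>a \<in> carrier A; x \<in> carrier M\<rbrakk> \<Longrightarrow> a \<odot>\<^bsub>M\<^esub> x \<in> carrier M"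
    and smult_l_distr: "\<lbrakk>a \<in> carrier A; b \<in> carrier A; x \<in> carrier M\<rbrakk>
      \<Longrightarrow> (a \<oplus> b) \<odot>\<^bsub>M\<^esub> x = a \<odot>\<^bsub>M\<^esub> x \<oplus>\<^bsub>M\<^esub> b \<odot>\<^bsub>M\<^esub> x"
    and smult_r_distr: "\<lbrakk>a \<in> carrier A; x \<in> carrier M; y \<in> carrier M\<rbrakk>
      \<Longrightarrow> a \<odot>\<^bsub>M\<^esub> (x \<oplus>\<^bsub>M\<^esub> y) = a \<odot>\<^bsub>M\<^esub> x \<oplus>\<^bsub>M\<^esub> a \<odot>\<^bsub>M\<^esub> y"
    and smult_assoc: "\<lbrakk>a \<in> carrier A; b \<in> carrier A; x \<in> carrier M\<rbrakk>
      \<Longrightarrow> (a \<otimes> b) \<odot>\<^bsub>M\<^esub> x = a \<odot>\<^bsub>M\<^esub> (b \<odot>\<^bsub>M\<^esub> x)"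
    and smult_one: "x \<in> carrier M \<Longrightarrow> \<one> \<odot>\<^bsub>M\<^esub> x = x"
    and mgrade_sum: "graded_by M (mgrade M)"
    and mgrade_smult: "\<lbrakk>a \<in> rgrade A i; x \<in> mgrade M j\<rbrakk> \<Longrightarrow> a \<odot>\<^bsub>M\<^esub> x \<in> mgrade M (i + j)"

definition gmod_hom :: "'a gring \<Rightarrow> ('a, 'b) gmodule \<Rightarrow> ('a, 'b) gmodule \<Rightarrow> ('b \<Rightarrow> 'b) set"
  where "gmod_hom A M N = {f \<in> carrier M \<rightarrow>\<^sub>E carrier N.
    (\<forall>x\<in>carrier M. \<forall>y\<in>carrier M. f (x \<oplus>\<^bsub>M\<^esub> y) = f x \<oplus>\<^bsub>N\<^esub> f y) \<and>
    (\<forall>a\<in>carrier A. \<forall>x\<in>carrier M. f (a \<odot>\<^bsub>M\<^esub> x) = a \<odot>\<^bsub>N\<^esub> f x) \<and>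
    (\<forall>i. f ` mgrade M i \<subseteq> mgrade N i)}"

definition gmod :: "'a gring \<Rightarrow> (('a, 'b) gmodule, 'b \<Rightarrow> 'b) cat"
  where "gmod A = \<lparr>Obj = {M. graded_module A M}, Hom = gmod_hom A,
    Id = \<lambda>M. \<lambda>x\<in>carrier M. x, Comp = \<lambda>M N P g f. compose (carrier M) g f\<rparr>"

text \<open>The grading shift \<open>M \<mapsto> M\<langle>n\<rangle>\<close> with \<open>M\<langle>n\<rangle>\<^sub>i = M\<^sub>i\<^sub>+\<^sub>n\<close>.\<close>

definition shift_func :: "int \<Rightarrow> (('a, 'b) gmodule, 'b \<Rightarrow> 'b, ('a, 'b) gmodule, 'b \<Rightarrow> 'b) func"
  where "shift_func n = \<lparr>omap = \<lambda>M. M\<lparr>mgrade := \<lambda>i. mgrade M (i + n)\<rparr>, amap = \<lambda>M N f. f\<rparr>"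

text \<open>A bimodule is a left module with an additional right multiplication.\<close>

record ('a, 'c, 'b) gbimodule = "('a, 'b) gmodule" +
  rsmult :: "'b \<Rightarrow> 'c \<Rightarrow> 'b"


section \<open>Tensor products\<close>

text \<open>The elements of the modules are taken from a type that contains an arbitrary type \<open>'a\<close> and is
  closed under forming formal sums \<open>p\<^sub>1 \<otimes> m\<^sub>1 + \<dots> + p\<^sub>n \<otimes> m\<^sub>n\<close>. Tensoring with a bimodule
  with elements in \<open>'e\<close> is then a functor between categories of modules on one and the same
  type \<open>('e, 'a) univ\<close>.\<close>

datatype ('e, 'a) univ = Atom 'a | Formal (summands: "('e \<times> ('e, 'a) univ) list")

text \<open>Equality of formal sums in \<open>P \<otimes>\<^sub>B M\<close>. The relations \<open>zero_left\<close> and \<open>add_left\<close> make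
  \<open>(-p) \<otimes> m\<close> the inverse of \<open>p \<otimes> m\<close>, so formal sums without negative coefficients suffice.\<close>

inductive tensor_eq :: "('b, 'y) ring_scheme \<Rightarrow> ('a, 'b, 'e) gbimodule \<Rightarrow> ('b, 'm) gmodule \<Rightarrow>
    ('e \<times> 'm) list \<Rightarrow> ('e \<times> 'm) list \<Rightarrow> bool"
  for B P M where
  refl: "tensor_eq B P M xs xs"
| sym: "tensor_eq B P M xs ys \<Longrightarrow> tensor_eq B P M ys xs"
| trans: "tensor_eq B P M xs ys \<Longrightarrow> tensor_eq B P M ys zs \<Longrightarrow> tensor_eq B P M xs zs"
| append: "tensor_eq B P M xs xs' \<Longrightarrow> tensor_eq B P M ys ys' \<Longrightarrow>
    tensor_eq B P M (xs @ ys) (xs' @ ys')"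
| comm: "tensor_eq B P M (xs @ ys) (ys @ xs)"
| add_left: "\<lbrakk>p \<in> carrier P; q \<in> carrier P; m \<in> carrier M\<rbrakk> \<Longrightarrow>
    tensor_eq B P M [(p \<oplus>\<^bsub>P\<^esub> q, m)] [(p, m), (q, m)]"
| add_right: "\<lbrakk>p \<in> carrier P; m \<in> carrier M; n \<in> carrier M\<rbrakk> \<Longrightarrow>
    tensor_eq B P M [(p, m \<oplus>\<^bsub>M\<^esub> n)] [(p, m), (p, n)]"
| zero_left: "m \<in> carrier M \<Longrightarrow> tensor_eq B P M [(\<zero>\<^bsub>P\<^esub>, m)] []"
| balance: "\<lbrakk>p \<in> carrier P; b \<in> carrier B; m \<in> carrier M\<rbrakk> \<Longrightarrow>
    tensor_eq B P M [(rsmult P p b, m)] [(p, b \<odot>\<^bsub>M\<^esub> m)]"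

text \<open>The element of \<open>P \<otimes>\<^sub>B M\<close> given by a formal sum: a chosen representative of its class.\<close>

definition tensor_class :: "('b, 'y) ring_scheme \<Rightarrow> ('a, 'b, 'e) gbimodule \<Rightarrow>
    ('b, ('e, 'u) univ) gmodule \<Rightarrow> ('e \<times> ('e, 'u) univ) list \<Rightarrow> ('e, 'u) univ"
  where "tensor_class B P M xs = Formal (SOME ys. tensor_eq B P M xs ys)"

definition tensor :: "('b, 'y) ring_scheme \<Rightarrow> ('a, 'b, 'e) gbimodule \<Rightarrow>
    ('b, ('e, 'u) univ) gmodule \<Rightarrow> ('a, ('e, 'u) univ) gmodule"
  where "tensor B P M =
    \<lparr>carrier = tensor_class B P M ` lists (carrier P \<times> carrier M),
     mult = undefined,
     one = undefined,
     zero = tensor_class B P M [],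
     add = \<lambda>t u. tensor_class B P M (summands t @ summands u),
     smult = \<lambda>a t. tensor_class B P M (map (\<lambda>(p, m). (a \<odot>\<^bsub>P\<^esub> p, m)) (summands t)),
     mgrade = \<lambda>i. tensor_class B P M ` lists (\<Union>j. mgrade P j \<times> mgrade M (i - j))\<rparr>"

definition tensor_func :: "('b, 'y) ring_scheme \<Rightarrow> ('a, 'b, 'e) gbimodule \<Rightarrow>
    (('b, ('e, 'u) univ) gmodule, ('e, 'u) univ \<Rightarrow> ('e, 'u) univ,
     ('a, ('e, 'u) univ) gmodule, ('e, 'u) univ \<Rightarrow> ('e, 'u) univ) func"
  where "tensor_func B P =
    \<lparr>omap = tensor B P,
     amap = \<lambda>M N f. \<lambda>t\<in>carrier (tensor B P M).
       tensor_class B P N (map (\<lambda>(p, m). (p, f m)) (summands t))\<rparr>"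


section \<open>The odd polynomial ring in two variables\<close>

datatype var = X1 | X2

text \<open>The free algebra \<open>k\<langle>x\<^sub>1,x\<^sub>2\<rangle>\<close>: finitely supported functions on words.\<close>

definition free_alg :: "('k, 'z) ring_scheme \<Rightarrow> (var list \<Rightarrow> 'k) ring"
  where "free_alg K =
    \<lparr>carrier = {f. range f \<subseteq> carrier K \<and> finite {w. f w \<noteq> \<zero>\<^bsub>K\<^esub>}},
     mult = \<lambda>f g w. \<Oplus>\<^bsub>K\<^esub>i\<in>{..length w}. f (take i w) \<otimes>\<^bsub>K\<^esub> g (drop i w),
     one = \<lambda>w. if w = [] then \<one>\<^bsub>K\<^esub> else \<zero>\<^bsub>K\<^esub>,
     zero = \<lambda>w. \<zero>\<^bsub>K\<^esub>,
     add = \<lambda>f g w. f w \<oplus>\<^bsub>K\<^esub> g w\<rparr>"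

definition free_var :: "('k, 'z) ring_scheme \<Rightarrow> var \<Rightarrow> var list \<Rightarrow> 'k"
  where "free_var K v = (\<lambda>w. if w = [v] then \<one>\<^bsub>K\<^esub> else \<zero>\<^bsub>K\<^esub>)"

definition free_const :: "('k, 'z) ring_scheme \<Rightarrow> 'k \<Rightarrow> var list \<Rightarrow> 'k"
  where "free_const K c = (\<lambda>w. if w = [] then c else \<zero>\<^bsub>K\<^esub>)"

definition odd_ideal :: "('k, 'z) ring_scheme \<Rightarrow> (var list \<Rightarrow> 'k) set"
  where "odd_ideal K = Idl\<^bsub>free_alg K\<^esub>
    {free_var K X1 \<otimes>\<^bsub>free_alg K\<^esub> free_var K X2 \<oplus>\<^bsub>free_alg K\<^esub>
     free_var K X2 \<otimes>\<^bsub>free_alg K\<^esub> free_var K X1}"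

type_synonym 'k odd_poly = "(var list \<Rightarrow> 'k) set"

definition odd_class :: "('k, 'z) ring_scheme \<Rightarrow> (var list \<Rightarrow> 'k) \<Rightarrow> 'k odd_poly"
  where "odd_class K f = odd_ideal K +>\<^bsub>free_alg K\<^esub> f"

definition odd_ring :: "('k, 'z) ring_scheme \<Rightarrow> 'k odd_poly gring"
  where "odd_ring K = (let Q = free_alg K Quot odd_ideal K in
    \<lparr>carrier = carrier Q, mult = mult Q, one = one Q, zero = zero Q, add = add Q,
     rgrade = \<lambda>d. odd_class K `
       {f \<in> carrier (free_alg K). \<forall>w. f w \<noteq> \<zero>\<^bsub>K\<^esub> \<longrightarrow> d = 2 * int (length w)}\<rparr>)"

abbreviation odd_x :: "('k, 'z) ring_scheme \<Rightarrow> var \<Rightarrow> 'k odd_poly"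
  where "odd_x K v \<equiv> odd_class K (free_var K v)"

definition k_linear :: "('k, 'z) ring_scheme \<Rightarrow> ('k odd_poly \<Rightarrow> 'k odd_poly) \<Rightarrow> bool"
  where "k_linear K h \<longleftrightarrow> (let R = odd_ring K in
    h \<in> carrier R \<rightarrow> carrier R \<and>
    (\<forall>f\<in>carrier R. \<forall>g\<in>carrier R. h (f \<oplus>\<^bsub>R\<^esub> g) = h f \<oplus>\<^bsub>R\<^esub> h g) \<and>
    (\<forall>c\<in>carrier K. \<forall>f\<in>carrier R.
      h (odd_class K (free_const K c) \<otimes>\<^bsub>R\<^esub> f) = odd_class K (free_const K c) \<otimes>\<^bsub>R\<^esub> h f))"

definition is_odd_swap :: "('k, 'z) ring_scheme \<Rightarrow> ('k odd_poly \<Rightarrow> 'k odd_poly) \<Rightarrow> bool"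
  where "is_odd_swap K s \<longleftrightarrow> (let R = odd_ring K in
    s \<in> ring_iso R R \<and> k_linear K s \<and>
    s (odd_x K X1) = \<ominus>\<^bsub>R\<^esub> odd_x K X2 \<and> s (odd_x K X2) = \<ominus>\<^bsub>R\<^esub> odd_x K X1)"

definition is_odd_Demazure ::
  "('k, 'z) ring_scheme \<Rightarrow> ('k odd_poly \<Rightarrow> 'k odd_poly) \<Rightarrow> ('k odd_poly \<Rightarrow> 'k odd_poly) \<Rightarrow> bool"
  where "is_odd_Demazure K s d \<longleftrightarrow> (let R = odd_ring K in
    k_linear K d \<and> d \<one>\<^bsub>R\<^esub> = \<zero>\<^bsub>R\<^esub> \<and>
    d (odd_x K X1) = \<one>\<^bsub>R\<^esub> \<and> d (odd_x K X2) = \<one>\<^bsub>R\<^esub> \<and>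
    (\<forall>f\<in>carrier R. \<forall>g\<in>carrier R. d (f \<otimes>\<^bsub>R\<^esub> g) = d f \<otimes>\<^bsub>R\<^esub> g \<oplus>\<^bsub>R\<^esub> s f \<otimes>\<^bsub>R\<^esub> d g))"

text \<open>\<open>R\<^sup>s = ker \<partial>\<close>, with the operations and the grading of \<open>R\<close>.\<close>

definition odd_sym_ring :: "('k, 'z) ring_scheme \<Rightarrow> ('k odd_poly \<Rightarrow> 'k odd_poly) \<Rightarrow> 'k odd_poly gring"
  where "odd_sym_ring K d = (let R = odd_ring K; ker = {f \<in> carrier R. d f = \<zero>\<^bsub>R\<^esub>} in
    R\<lparr>carrier := ker, rgrade := \<lambda>i. rgrade R i \<inter> ker\<rparr>)"


section \<open>The functors\<close>

type_synonym ('k, 'a) odd_gmodule = "('k odd_poly, ('k odd_poly, 'a) univ) gmodule"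
type_synonym ('k, 'a) odd_map = "('k odd_poly, 'a) univ \<Rightarrow> ('k odd_poly, 'a) univ"
type_synonym ('k, 'a) odd_cat = "(('k, 'a) odd_gmodule, ('k, 'a) odd_map) cat"
type_synonym ('k, 'a) odd_func =
  "(('k, 'a) odd_gmodule, ('k, 'a) odd_map, ('k, 'a) odd_gmodule, ('k, 'a) odd_map) func"

text \<open>\<open>R\<close> as a graded \<open>(R, R\<^sup>s)\<close>-bimodule.\<close>

definition ind_bimodule ::
  "('k, 'z) ring_scheme \<Rightarrow> ('k odd_poly, 'k odd_poly, 'k odd_poly) gbimodule"
  where "ind_bimodule K = (let R = odd_ring K in
    \<lparr>carrier = carrier R, mult = mult R, one = one R, zero = zero R, add = add R,
     smult = mult R, mgrade = rgrade R, rsmult = mult R\<rparr>)"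

text \<open>The twisted \<open>R\<^sup>s\<close>-bimodule: \<open>g \<in> R\<^sup>s\<close> stands for \<open>1\<^sup>s g\<close>, where \<open>1\<^sup>s\<close> is the
  generator of degree 0. Hence the right action is multiplication, and \<open>f (1\<^sup>s g) = 1\<^sup>s (s(f) g)\<close>.\<close>

definition twist_bimodule :: "('k, 'z) ring_scheme \<Rightarrow> ('k odd_poly \<Rightarrow> 'k odd_poly) \<Rightarrow>
    ('k odd_poly \<Rightarrow> 'k odd_poly) \<Rightarrow> ('k odd_poly, 'k odd_poly, 'k odd_poly) gbimodule"
  where "twist_bimodule K s d = (let S = odd_sym_ring K d in
    \<lparr>carrier = carrier S, mult = mult S, one = one S, zero = zero S, add = add S,
     smult = \<lambda>f g. s f \<otimes>\<^bsub>S\<^esub> g, mgrade = rgrade S, rsmult = mult S\<rparr>)"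

definition F_up :: "('k, 'z) ring_scheme \<Rightarrow> ('k odd_poly \<Rightarrow> 'k odd_poly) \<Rightarrow> ('k, 'a) odd_func"
  where "F_up K d = tensor_func (odd_sym_ring K d) (ind_bimodule K)"

text \<open>Restriction changes neither the underlying group nor the action map, only the ring whose
  elements are allowed to act, and this ring is not part of the record.\<close>

definition F_down :: "('k, 'a) odd_func"
  where "F_down = \<lparr>omap = \<lambda>M. M, amap = \<lambda>M N f. f\<rparr>"

definition F_twist :: "('k, 'z) ring_scheme \<Rightarrow> ('k odd_poly \<Rightarrow> 'k odd_poly) \<Rightarrow>
    ('k odd_poly \<Rightarrow> 'k odd_poly) \<Rightarrow> ('k, 'a) odd_func"
  where "F_twist K s d = tensor_func (odd_sym_ring K d) (twist_bimodule K s d)"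

text \<open>These two functors carry no grading shift. Because \<open>\<partial>\<close> has degree \<open>-2\<close>, the adjunctions
  between them have units and counits of nonzero degree. Within degree-zero maps each functor has to
  be normalised by the shift \<open>\<langle>1\<rangle>\<close>, that is, \<open>R \<otimes> R\<close> replaced by \<open>R \<otimes> R\<langle>1\<rangle>\<close> with its generator
  \<open>1 \<otimes> 1\<close> in degree \<open>-1\<close>.\<close>

definition F_up_down ::
  "('k, 'z) ring_scheme \<Rightarrow> ('k odd_poly \<Rightarrow> 'k odd_poly) \<Rightarrow> ('k, 'a) odd_func"
  where "F_up_down K d = F_up K d \<circ>\<^sub>F F_down"

definition F_up_twist_down :: "('k, 'z) ring_scheme \<Rightarrow> ('k odd_poly \<Rightarrow> 'k odd_poly) \<Rightarrow>
    ('k odd_poly \<Rightarrow> 'k odd_poly) \<Rightarrow> ('k, 'a) odd_func"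
  where "F_up_twist_down K s d = F_up K d \<circ>\<^sub>F F_twist K s d \<circ>\<^sub>F F_down"

end

theory Submission
  imports Defs
begin

text \<open>Write \<open>S\<close> for the kernel of \<open>\<partial>\<close> and \<open>x\<close> for \<open>x\<^sub>1\<close>. The reason for the biadjunction is that \<open>R\<close> is a
  Frobenius extension of \<open>S\<close>, twisted by \<open>s\<close>. The identities \<open>\<partial>\<partial> = 0\<close> and \<open>\<partial>s = -s\<partial>\<close> make \<open>S\<close> stable under
  \<open>s\<close> and put the image of \<open>\<partial>\<close> into \<open>S\<close>; the map \<open>\<partial> : R \<rightarrow> S\<close> is linear for right multiplication
  by \<open>S\<close> and \<open>s\<close>-semilinear for left multiplication; and since \<open>\<partial>(x) = 1\<close>, every \<open>f\<close> in \<open>R\<close> is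
  \<open>a + x b\<close> with \<open>b = \<partial>(f)\<close> and \<open>a\<close> in \<open>S\<close>. Hence restriction to \<open>S\<close> has induction as its left adjoint
  and, up to a shift by 2, induction after the twist as its right adjoint. Because \<open>s\<close> is an
  involution, the twist can be moved to the other side.

  Both composites can be treated at once. For \<open>\<sigma> = id\<close> and \<open>\<sigma> = s\<close> respectively, the functor \<open>F\<close> comes
  with the map \<open>u : M \<rightarrow> F M\<close>, \<open>m \<mapsto> 1 \<otimes> m\<close>, which is universal among \<open>\<sigma>\<close>-semilinear maps over
  \<open>S\<close> from \<open>M\<close> to \<open>R\<close>-modules, and with the trace \<open>c : F M \<rightarrow> M\<close>, \<open>r \<otimes> m \<mapsto> \<sigma>(\<partial>(r)) m\<close>. With the
  shift by 1 both have degree \<open>-1\<close>. The locale \<open>twisted_induction\<close> records this. If \<open>F\<close> belongs to \<open>\<sigma>\<close>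
  and \<open>G\<close> to the other twist, then linear maps \<open>F M \<rightarrow> N\<close> and linear maps \<open>M \<rightarrow> G N\<close> both correspond to
  \<open>\<sigma>\<close>-semilinear maps \<open>M \<rightarrow> N\<close> of degree \<open>-1\<close>: the former by composition with \<open>u\<close>, the latter by
  composition with the trace of \<open>G\<close>. The inverse of the second correspondence inserts the Casimir
  element \<open>x \<otimes> 1 - 1 \<otimes> s(x) = x\<^sub>1 \<otimes> 1 + 1 \<otimes> x\<^sub>2\<close>, which is where the structure of \<open>R\<close> enters
  (\<open>casimir_linear\<close>, \<open>coextend_c\<close>). This gives \<open>twisted_induction_adjoint\<close>, to be applied in both
  directions.

  What remains is to show that the concrete functors have these properties. This needs the tensor
  product of a graded bimodule and a graded module with its universal property and its grading
  (\<open>lift\<close>, \<open>tensor_graded_module\<close>), and the identities for \<open>s\<close> and \<open>\<partial>\<close>, which are proved by induction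
  over monomials after the free algebra and its homogeneous quotient have been shown to be graded
  rings (\<open>graded_ring_R\<close>, \<open>odd_ring_Demazure\<close>).\<close>


section \<open>Additive maps and direct sum decompositions\<close>

definition additive_map :: "('a, 'm) ring_scheme \<Rightarrow> ('b, 'n) ring_scheme \<Rightarrow> ('a \<Rightarrow> 'b) \<Rightarrow> bool"
  where "additive_map M N f \<longleftrightarrow> f \<in> carrier M \<rightarrow> carrier N \<and>
    (\<forall>x\<in>carrier M. \<forall>y\<in>carrier M. f (x \<oplus>\<^bsub>M\<^esub> y) = f x \<oplus>\<^bsub>N\<^esub> f y)"

lemma additive_mapI:
  assumes "\<And>x. x \<in> carrier M \<Longrightarrow> f x \<in> carrier N"
    and "\<And>x y. x \<in> carrier M \<Longrightarrow> y \<in> carrier M \<Longrightarrow> f (x \<oplus>\<^bsub>M\<^esub> y) = f x \<oplus>\<^bsub>N\<^esub> f y"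
  shows "additive_map M N f"
  using assms unfolding additive_map_def by auto

lemma additive_map_closed: "additive_map M N f \<Longrightarrow> x \<in> carrier M \<Longrightarrow> f x \<in> carrier N"
  unfolding additive_map_def by auto

lemma additive_map_add:
  "additive_map M N f \<Longrightarrow> x \<in> carrier M \<Longrightarrow> y \<in> carrier M \<Longrightarrow> f (x \<oplus>\<^bsub>M\<^esub> y) = f x \<oplus>\<^bsub>N\<^esub> f y"
  unfolding additive_map_def by auto

lemma additive_map_zero:
  assumes "abelian_group M" "abelian_group N" "additive_map M N f"
  shows "f \<zero>\<^bsub>M\<^esub> = \<zero>\<^bsub>N\<^esub>"
proof -
  interpret M: abelian_group M by fact
  interpret N: abelian_group N by fact
  have c: "f \<zero>\<^bsub>M\<^esub> \<in> carrier N" using additive_map_closed[OF assms(3)] by simp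
  have "f \<zero>\<^bsub>M\<^esub> \<oplus>\<^bsub>N\<^esub> f \<zero>\<^bsub>M\<^esub> = f \<zero>\<^bsub>M\<^esub> \<oplus>\<^bsub>N\<^esub> \<zero>\<^bsub>N\<^esub>"
    using additive_map_add[OF assms(3), of "\<zero>\<^bsub>M\<^esub>" "\<zero>\<^bsub>M\<^esub>"] c by simp
  then show ?thesis using c by (metis N.add.l_cancel_one' N.zero_closed N.r_zero)
qed

lemma additive_map_minus:
  assumes "abelian_group M" "abelian_group N" "additive_map M N f" "x \<in> carrier M"
  shows "f (\<ominus>\<^bsub>M\<^esub> x) = \<ominus>\<^bsub>N\<^esub> f x"
proof -
  interpret M: abelian_group M by fact
  interpret N: abelian_group N by fact
  have "f (\<ominus>\<^bsub>M\<^esub> x) \<oplus>\<^bsub>N\<^esub> f x = \<zero>\<^bsub>N\<^esub>"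
    using additive_map_add[OF assms(3), of "\<ominus>\<^bsub>M\<^esub> x" x] assms(4)
      additive_map_zero[OF assms(1-3)] by (simp add: M.l_neg)
  then show ?thesis using additive_map_closed[OF assms(3)] assms(4)
    by (metis M.a_inv_closed N.minus_equality)
qed

lemma additive_map_diff:
  assumes "abelian_group M" "abelian_group N" "additive_map M N f" "x \<in> carrier M" "y \<in> carrier M"
  shows "f (x \<ominus>\<^bsub>M\<^esub> y) = f x \<ominus>\<^bsub>N\<^esub> f y"
  using assms additive_map_minus[OF assms(1-3)] additive_map_add[OF assms(3)]
  by (simp add: a_minus_def abelian_group.a_inv_closed)

lemma additive_map_finsum:
  assumes "abelian_group M" "abelian_group N" "additive_map M N f"
    and "finite A" "\<And>i. i \<in> A \<Longrightarrow> c i \<in> carrier M"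
  shows "f (\<Oplus>\<^bsub>M\<^esub>i\<in>A. c i) = (\<Oplus>\<^bsub>N\<^esub>i\<in>A. f (c i))"
  using assms(4,5)
proof (induction A rule: finite_induct)
  interpret M: abelian_group M by fact
  interpret N: abelian_group N by fact
  {
    case empty
    then show ?case using additive_map_zero[OF assms(1-3)] by simp
  next
    case (insert i A)
    have cM: "c \<in> A \<rightarrow> carrier M" "c i \<in> carrier M" using insert by auto
    then have cN: "(\<lambda>i. f (c i)) \<in> A \<rightarrow> carrier N" "f (c i) \<in> carrier N"
      using additive_map_closed[OF assms(3)] by (auto simp: Pi_iff)
    have "f (\<Oplus>\<^bsub>M\<^esub>j\<in>insert i A. c j) = f (c i \<oplus>\<^bsub>M\<^esub> (\<Oplus>\<^bsub>M\<^esub>j\<in>A. c j))"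
      using insert(1,2) cM by (simp add: M.finsum_insert)
    also have "\<dots> = f (c i) \<oplus>\<^bsub>N\<^esub> f (\<Oplus>\<^bsub>M\<^esub>j\<in>A. c j)"
      using additive_map_add[OF assms(3)] cM by (simp add: M.finsum_closed)
    finally show ?case using insert cN by (simp add: N.finsum_insert)
  }
qed

locale graded_group = abelian_group M for M (structure) +
  fixes V :: "int \<Rightarrow> 'b set"
  assumes graded: "graded_by M V"
begin

lemma piece_subgroup: "additive_subgroup (V i) M"
  using graded unfolding graded_by_def by blast

lemma piece_carrier: "v \<in> V i \<Longrightarrow> v \<in> carrier M"
  using additive_subgroup.a_subset[OF piece_subgroup] by blast

lemma piece_zero: "\<zero> \<in> V i"
  using additive_subgroup.zero_closed[OF piece_subgroup] .

lemma piece_add: "v \<in> V i \<Longrightarrow> w \<in> V i \<Longrightarrow> v \<oplus> w \<in> V i"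
  using additive_subgroup.a_closed[OF piece_subgroup] .

lemma piece_minus: "v \<in> V i \<Longrightarrow> \<ominus> v \<in> V i"
  using additive_subgroup.a_inv_closed[OF piece_subgroup] .

definition part :: "'b \<Rightarrow> int \<Rightarrow> 'b"
  where "part m = (THE c. (\<forall>i. c i \<in> V i) \<and> finite {i. c i \<noteq> \<zero>} \<and>
    m = (\<Oplus>i\<in>{i. c i \<noteq> \<zero>}. c i))"

lemma part_props:
  assumes "m \<in> carrier M"
  shows "part m i \<in> V i" "finite {i. part m i \<noteq> \<zero>}" "m = (\<Oplus>i\<in>{i. part m i \<noteq> \<zero>}. part m i)"
proof -
  have "\<exists>!c. (\<forall>i. c i \<in> V i) \<and> finite {i. c i \<noteq> \<zero>} \<and> m = (\<Oplus>i\<in>{i. c i \<noteq> \<zero>}. c i)"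
    using graded assms unfolding graded_by_def by blast
  from theI'[OF this] show "part m i \<in> V i" "finite {i. part m i \<noteq> \<zero>}"
    "m = (\<Oplus>i\<in>{i. part m i \<noteq> \<zero>}. part m i)" unfolding part_def by blast+
qed

lemma part_carrier: "m \<in> carrier M \<Longrightarrow> part m i \<in> carrier M"
  using part_props(1) piece_carrier by blast

lemma finsum_support:
  assumes "finite A" "\<And>i. i \<notin> A \<Longrightarrow> c i = \<zero>" "\<And>i. c i \<in> carrier M"
  shows "(\<Oplus>i\<in>{i. c i \<noteq> \<zero>}. c i) = (\<Oplus>i\<in>A. c i)"
  by (rule add.finprod_mono_neutral_cong_left[OF assms(1)]) (use assms in auto)

lemma part_unique:
  assumes "finite A" "\<And>i. i \<notin> A \<Longrightarrow> c i = \<zero>" "\<And>i. c i \<in> V i"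
  shows "part (\<Oplus>i\<in>A. c i) = c"
proof -
  define m where "m = (\<Oplus>i\<in>A. c i)"
  have cc: "\<And>i. c i \<in> carrier M" using assms(3) piece_carrier by blast
  then have m: "m \<in> carrier M" unfolding m_def by (simp add: finsum_closed)
  have ex: "\<exists>!c. (\<forall>i. c i \<in> V i) \<and> finite {i. c i \<noteq> \<zero>} \<and> m = (\<Oplus>i\<in>{i. c i \<noteq> \<zero>}. c i)"
    using graded m unfolding graded_by_def by blast
  have "finite {i. c i \<noteq> \<zero>}" by (rule finite_subset[OF _ assms(1)]) (use assms(2) in auto)
  moreover have "m = (\<Oplus>i\<in>{i. c i \<noteq> \<zero>}. c i)"
    unfolding m_def using finsum_support[OF assms(1,2) cc] by simp
  ultimately show ?thesis using the1_equality[OF ex, of c] assms(3) unfolding part_def m_def by blast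
qed

lemma part_homog:
  assumes "v \<in> V j"
  shows "part v i = (if i = j then v else \<zero>)"
proof -
  have "part (\<Oplus>i\<in>{j}. if i = j then v else \<zero>) = (\<lambda>i. if i = j then v else \<zero>)"
    by (rule part_unique) (use assms piece_zero in auto)
  moreover have "(\<Oplus>i\<in>{j}. if i = j then v else \<zero>) = v"
    using piece_carrier[OF assms] by (simp add: finsum_insert)
  ultimately show ?thesis by simp
qed

lemma part_sum:
  assumes "m \<in> carrier M" "finite A" "{i. part m i \<noteq> \<zero>} \<subseteq> A"
  shows "(\<Oplus>i\<in>A. part m i) = m"
proof -
  have "\<And>i. i \<notin> A \<Longrightarrow> part m i = \<zero>" using assms(3) by blast
  then show ?thesis
    using finsum_support[OF assms(2), of "part m"] part_props(3)[OF assms(1)] part_carrier[OF assms(1)]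
    by simp
qed

lemma part_add:
  assumes "m \<in> carrier M" "n \<in> carrier M"
  shows "part (m \<oplus> n) i = part m i \<oplus> part n i"
proof -
  let ?A = "{i. part m i \<noteq> \<zero>} \<union> {i. part n i \<noteq> \<zero>}"
  have fin: "finite ?A" using part_props(2) assms by simp
  have "(\<Oplus>i\<in>?A. part m i \<oplus> part n i) = (\<Oplus>i\<in>?A. part m i) \<oplus> (\<Oplus>i\<in>?A. part n i)"
    by (rule finsum_addf) (use part_carrier assms in auto)
  also have "\<dots> = m \<oplus> n" using part_sum[OF _ fin] assms by simp
  finally have "part (m \<oplus> n) = (\<lambda>i. part m i \<oplus> part n i)"
    using part_unique[OF fin, of "\<lambda>i. part m i \<oplus> part n i"] part_props(1) piece_add assms by auto
  then show ?thesis by simp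
qed

lemma additive_part: "additive_map M M (\<lambda>m. part m i)"
  by (rule additive_mapI) (use part_carrier part_add in auto)

lemma homogeneous_induct [consumes 1, case_names homogeneous add]:
  assumes "m \<in> carrier M"
    and "\<And>i v. v \<in> V i \<Longrightarrow> Q v"
    and "\<And>v w. v \<in> carrier M \<Longrightarrow> w \<in> carrier M \<Longrightarrow> Q v \<Longrightarrow> Q w \<Longrightarrow> Q (v \<oplus> w)"
  shows "Q m"
proof -
  have "Q (\<Oplus>i\<in>A. part m i)" if "finite A" for A
    using that
  proof (induction A rule: finite_induct)
    case empty
    show ?case using assms(2)[OF piece_zero] by simp
  next
    case (insert i A)
    then have "(\<Oplus>i\<in>insert i A. part m i) = part m i \<oplus> (\<Oplus>i\<in>A. part m i)"
      using part_carrier[OF assms(1)] by (simp add: finsum_insert)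
    moreover have "(\<Oplus>i\<in>A. part m i) \<in> carrier M"
      using part_carrier[OF assms(1)] by (simp add: finsum_closed)
    ultimately show ?case
      using assms(2)[OF part_props(1)[OF assms(1)]] assms(3) insert part_carrier[OF assms(1)] by simp
  qed
  then show ?thesis using part_props(2,3)[OF assms(1)] by metis
qed

text \<open>The universal property of a direct sum: additive maps on the pieces glue.\<close>

lemma glue_pieces:
  assumes "abelian_group G"
    and clos: "\<And>j v. v \<in> V j \<Longrightarrow> f j v \<in> carrier G"
    and add: "\<And>j v w. v \<in> V j \<Longrightarrow> w \<in> V j \<Longrightarrow> f j (v \<oplus> w) = f j v \<oplus>\<^bsub>G\<^esub> f j w"
  defines "F \<equiv> \<lambda>m. \<Oplus>\<^bsub>G\<^esub>j\<in>{j. part m j \<noteq> \<zero>}. f j (part m j)"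
  shows "additive_map M G F" "\<And>j v. v \<in> V j \<Longrightarrow> F v = f j v"
proof -
  interpret G: abelian_group G by fact
  have zero: "f j \<zero> = \<zero>\<^bsub>G\<^esub>" for j
    using add[OF piece_zero piece_zero, of j] clos[OF piece_zero, of j]
    by (metis G.add.l_cancel_one' zero_closed r_zero)
  have F: "F m = (\<Oplus>\<^bsub>G\<^esub>j\<in>A. f j (part m j))"
    if "m \<in> carrier M" "finite A" "{j. part m j \<noteq> \<zero>} \<subseteq> A" for m A
    unfolding F_def
    by (rule G.add.finprod_mono_neutral_cong_left[OF that(2,3)])
      (use that zero clos part_props(1) in auto)
  show "additive_map M G F"
  proof (rule additive_mapI)
    show "F m \<in> carrier G" if "m \<in> carrier M" for m
      unfolding F_def by (rule G.finsum_closed) (use that clos part_props(1) in auto)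
    fix m n assume mn: "m \<in> carrier M" "n \<in> carrier M"
    let ?A = "{i. part m i \<noteq> \<zero>} \<union> {i. part n i \<noteq> \<zero>}"
    have fin: "finite ?A" using part_props(2) mn by simp
    have "F (m \<oplus> n) = (\<Oplus>\<^bsub>G\<^esub>j\<in>?A. f j (part (m \<oplus> n) j))"
      by (rule F[OF _ fin]) (use mn part_add in auto)
    also have "\<dots> = (\<Oplus>\<^bsub>G\<^esub>j\<in>?A. f j (part m j) \<oplus>\<^bsub>G\<^esub> f j (part n j))"
      using mn add part_props(1) clos by (intro G.finsum_cong') (auto simp: part_add)
    also have "\<dots> = F m \<oplus>\<^bsub>G\<^esub> F n"
      using F[OF _ fin] mn clos part_props(1) by (subst G.finsum_addf) auto
    finally show "F (m \<oplus> n) = F m \<oplus>\<^bsub>G\<^esub> F n" .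
  qed
  fix j v assume v: "v \<in> V j"
  have "F v = (\<Oplus>\<^bsub>G\<^esub>i\<in>{j}. f i (part v i))"
    by (rule F) (use piece_carrier[OF v] part_homog[OF v] in auto)
  also have "\<dots> = f j v" using part_homog[OF v] clos[OF v] by (simp add: G.finsum_insert)
  finally show "F v = f j v" .
qed

text \<open>This is how balancedness of the projections of a tensor product and homogeneity of the kernel of
  \<open>\<partial>\<close> are obtained.\<close>

lemma part_commute:
  assumes "graded_group N W" "additive_map M N f" "\<And>i v. v \<in> V i \<Longrightarrow> f v \<in> W (i + k)"
    and "m \<in> carrier M"
  shows "f (part m i) = graded_group.part N W (f m) (i + k)"
proof -
  interpret N: graded_group N W by fact
  show ?thesis using assms(4)
  proof (induction m rule: homogeneous_induct)
    case (homogeneous j v)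
    then show ?case
      using part_homog[OF homogeneous] N.part_homog[OF assms(3)[OF homogeneous]]
        additive_map_zero[OF abelian_group_axioms N.abelian_group_axioms assms(2)] by simp
  next
    case (add v w)
    then show ?case using part_add N.part_add additive_map_add[OF assms(2)] part_carrier
        additive_map_closed[OF assms(2)] by simp
  qed
qed

end

text \<open>A family of projections onto the pieces is the practical way to certify a direct sum: it yields
  the components together with their uniqueness.\<close>

lemma graded_byI:
  assumes "abelian_group M" "\<And>i. additive_subgroup (V i) M"
    and add: "\<And>i. additive_map M M (\<lambda>m. \<pi> m i)"
    and mem: "\<And>m i. m \<in> carrier M \<Longrightarrow> \<pi> m i \<in> V i"
    and proj: "\<And>i j v. v \<in> V j \<Longrightarrow> \<pi> v i = (if i = j then v else \<zero>\<^bsub>M\<^esub>)"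
    and sum: "\<And>m. m \<in> carrier M \<Longrightarrow>
      \<exists>A. finite A \<and> (\<forall>i. i \<notin> A \<longrightarrow> \<pi> m i = \<zero>\<^bsub>M\<^esub>) \<and> m = (\<Oplus>\<^bsub>M\<^esub>i\<in>A. \<pi> m i)"
  shows "graded_by M V"
proof -
  interpret M: abelian_group M by fact
  have sub: "v \<in> carrier M" if "v \<in> V i" for v i
    using additive_subgroup.a_subset[OF assms(2)] that by blast
  have "\<exists>!c. (\<forall>i. c i \<in> V i) \<and> finite {i. c i \<noteq> \<zero>\<^bsub>M\<^esub>} \<and> m = (\<Oplus>\<^bsub>M\<^esub>i\<in>{i. c i \<noteq> \<zero>\<^bsub>M\<^esub>}. c i)"
    if m: "m \<in> carrier M" for m
  proof (rule ex1I[of _ "\<pi> m"])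
    obtain A where A: "finite A" "\<forall>i. i \<notin> A \<longrightarrow> \<pi> m i = \<zero>\<^bsub>M\<^esub>" "m = (\<Oplus>\<^bsub>M\<^esub>i\<in>A. \<pi> m i)"
      using sum[OF m] by blast
    have "finite {i. \<pi> m i \<noteq> \<zero>\<^bsub>M\<^esub>}" by (rule finite_subset[OF _ A(1)]) (use A(2) in auto)
    moreover have "(\<Oplus>\<^bsub>M\<^esub>i\<in>{i. \<pi> m i \<noteq> \<zero>\<^bsub>M\<^esub>}. \<pi> m i) = (\<Oplus>\<^bsub>M\<^esub>i\<in>A. \<pi> m i)"
      by (rule M.add.finprod_mono_neutral_cong_left[OF A(1)]) (use A(2) mem[OF m] sub in auto)
    ultimately show "(\<forall>i. \<pi> m i \<in> V i) \<and> finite {i. \<pi> m i \<noteq> \<zero>\<^bsub>M\<^esub>} \<and>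
        m = (\<Oplus>\<^bsub>M\<^esub>i\<in>{i. \<pi> m i \<noteq> \<zero>\<^bsub>M\<^esub>}. \<pi> m i)"
      using mem[OF m] A(3) by simp
    fix c assume c: "(\<forall>i. c i \<in> V i) \<and> finite {i. c i \<noteq> \<zero>\<^bsub>M\<^esub>} \<and> m = (\<Oplus>\<^bsub>M\<^esub>i\<in>{i. c i \<noteq> \<zero>\<^bsub>M\<^esub>}. c i)"
    let ?C = "{i. c i \<noteq> \<zero>\<^bsub>M\<^esub>}"
    have cc: "\<And>i. c i \<in> carrier M" using c sub by blast
    show "c = \<pi> m"
    proof
      fix i
      have "\<pi> m i = (\<Oplus>\<^bsub>M\<^esub>j\<in>?C. \<pi> (c j) i)"
        using additive_map_finsum[OF assms(1) assms(1) add, of ?C c i] c cc by auto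
      also have "\<dots> = (\<Oplus>\<^bsub>M\<^esub>j\<in>?C. if i = j then c j else \<zero>\<^bsub>M\<^esub>)"
        using c cc by (intro M.finsum_cong') (auto simp: proj)
      also have "\<dots> = c i"
      proof (cases "i \<in> ?C")
        case True
        then show ?thesis using M.finsum_singleton[OF True, of c] c cc by auto
      next
        case False
        then have "(\<Oplus>\<^bsub>M\<^esub>j\<in>?C. if i = j then c j else \<zero>\<^bsub>M\<^esub>) = (\<Oplus>\<^bsub>M\<^esub>j\<in>?C. \<zero>\<^bsub>M\<^esub>)"
          by (intro M.finsum_cong') auto
        then show ?thesis using False by (simp add: M.finsum_zero)
      qed
      finally show "c i = \<pi> m i" by simp
    qed
  qed
  then show ?thesis unfolding graded_by_def using assms(2) by blast
qed

text \<open>The summation condition of \<open>graded_byI\<close> need only be checked on generators.\<close>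

lemma sum_of_parts_homog:
  assumes "abelian_group M" "v \<in> carrier M" "\<And>i. \<pi> v i = (if i = j then v else \<zero>\<^bsub>M\<^esub>)"
  shows "\<exists>A. finite A \<and> (\<forall>i. i \<notin> A \<longrightarrow> \<pi> v i = \<zero>\<^bsub>M\<^esub>) \<and> v = (\<Oplus>\<^bsub>M\<^esub>i\<in>A. \<pi> v i)"
proof -
  interpret M: abelian_group M by fact
  show ?thesis by (rule exI[of _ "{j}"]) (use assms in \<open>auto simp: M.finsum_insert\<close>)
qed

lemma sum_of_parts_add:
  assumes "abelian_group M" and add: "\<And>i. additive_map M M (\<lambda>m. \<pi> m i)"
    and mn: "m \<in> carrier M" "n \<in> carrier M"
    and "\<exists>A. finite A \<and> (\<forall>i. i \<notin> A \<longrightarrow> \<pi> m i = \<zero>\<^bsub>M\<^esub>) \<and> m = (\<Oplus>\<^bsub>M\<^esub>i\<in>A. \<pi> m i)"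
    and "\<exists>A. finite A \<and> (\<forall>i. i \<notin> A \<longrightarrow> \<pi> n i = \<zero>\<^bsub>M\<^esub>) \<and> n = (\<Oplus>\<^bsub>M\<^esub>i\<in>A. \<pi> n i)"
  shows "\<exists>A. finite A \<and> (\<forall>i. i \<notin> A \<longrightarrow> \<pi> (m \<oplus>\<^bsub>M\<^esub> n) i = \<zero>\<^bsub>M\<^esub>) \<and>
    m \<oplus>\<^bsub>M\<^esub> n = (\<Oplus>\<^bsub>M\<^esub>i\<in>A. \<pi> (m \<oplus>\<^bsub>M\<^esub> n) i)"
proof -
  interpret M: abelian_group M by fact
  obtain A where A: "finite A" "\<forall>i. i \<notin> A \<longrightarrow> \<pi> m i = \<zero>\<^bsub>M\<^esub>" "m = (\<Oplus>\<^bsub>M\<^esub>i\<in>A. \<pi> m i)"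
    using assms(5) by blast
  obtain B where B: "finite B" "\<forall>i. i \<notin> B \<longrightarrow> \<pi> n i = \<zero>\<^bsub>M\<^esub>" "n = (\<Oplus>\<^bsub>M\<^esub>i\<in>B. \<pi> n i)"
    using assms(6) by blast
  have c: "\<pi> m i \<in> carrier M" "\<pi> n i \<in> carrier M" for i
    using additive_map_closed[OF add] mn by blast+
  have eq: "\<pi> (m \<oplus>\<^bsub>M\<^esub> n) i = \<pi> m i \<oplus>\<^bsub>M\<^esub> \<pi> n i" for i using additive_map_add[OF add] mn by blast
  have "(\<Oplus>\<^bsub>M\<^esub>i\<in>A \<union> B. \<pi> m i) = m"
    using A by (subst A(3), intro M.add.finprod_mono_neutral_cong_right) (use A(1) B(1) c in auto)
  moreover have "(\<Oplus>\<^bsub>M\<^esub>i\<in>A \<union> B. \<pi> n i) = n"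
    using B by (subst B(3), intro M.add.finprod_mono_neutral_cong_right) (use A(1) B(1) c in auto)
  ultimately have "m \<oplus>\<^bsub>M\<^esub> n = (\<Oplus>\<^bsub>M\<^esub>i\<in>A \<union> B. \<pi> (m \<oplus>\<^bsub>M\<^esub> n) i)"
    using c by (simp add: eq M.finsum_addf)
  then show ?thesis using A B c eq by (intro exI[of _ "A \<union> B"]) auto
qed

lemma (in graded_group) sum_of_parts:
  assumes "m \<in> carrier M"
  shows "\<exists>A. finite A \<and> (\<forall>i. i \<notin> A \<longrightarrow> part m i = \<zero>) \<and> m = (\<Oplus>i\<in>A. part m i)"
  using part_props[OF assms] by (intro exI[of _ "{i. part m i \<noteq> \<zero>}"]) auto

text \<open>A direct sum decomposition depends on the additive structure only. The two records may have
  different types, so finite sums are carried over along the identity, viewed as an additive map.\<close>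

lemma graded_group_cong:
  fixes M :: "('c, 'm) ring_scheme" and N :: "('c, 'n) ring_scheme"
  assumes "graded_group M V" "carrier M = carrier N" "add M = add N" "zero M = zero N"
  shows "graded_group N V"
proof -
  interpret M: graded_group M V by fact
  have grp: "abelian_group N"
  proof (rule abelian_groupI)
    show "\<exists>n\<in>carrier N. n \<oplus>\<^bsub>N\<^esub> m = \<zero>\<^bsub>N\<^esub>" if "m \<in> carrier N" for m
      using that assms(2-4)[symmetric] by (intro bexI[of _ "\<ominus>\<^bsub>M\<^esub> m"]) (auto simp: M.l_neg)
  qed (use M.a_ac assms(2-4)[symmetric] in auto)
  interpret N: abelian_group N by (rule grp)
  have am: "additive_map M N (\<lambda>m. m)" by (rule additive_mapI) (use assms in auto)
  have "graded_by N V"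
  proof (rule graded_byI[OF grp, of _ M.part])
    show "additive_subgroup (V i) N" for i
    proof (rule additive_subgroupI, rule N.add.subgroupI)
      show "V i \<noteq> {}" using M.piece_zero by blast
      show "\<ominus>\<^bsub>N\<^esub> m \<in> V i" if "m \<in> V i" for m
        using additive_map_minus[OF M.abelian_group_axioms grp am M.piece_carrier[OF that]] M.piece_minus[OF that]
        by simp
      show "m \<oplus>\<^bsub>N\<^esub> n \<in> V i" if "m \<in> V i" "n \<in> V i" for m n
        using M.piece_add[OF that] assms(3) by simp
    qed (use M.piece_carrier assms(2) in auto)
    show "additive_map N N (\<lambda>m. M.part m i)" for i
      using M.additive_part assms(2,3) unfolding additive_map_def by simp
    show "\<exists>A. finite A \<and> (\<forall>i. i \<notin> A \<longrightarrow> M.part m i = \<zero>\<^bsub>N\<^esub>) \<and> m = (\<Oplus>\<^bsub>N\<^esub>i\<in>A. M.part m i)"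
      if "m \<in> carrier N" for m
    proof -
      have m: "m \<in> carrier M" using that assms(2) by simp
      obtain A where A: "finite A" "\<forall>i. i \<notin> A \<longrightarrow> M.part m i = \<zero>\<^bsub>M\<^esub>" "m = (\<Oplus>\<^bsub>M\<^esub>i\<in>A. M.part m i)"
        using M.sum_of_parts[OF m] by blast
      then show ?thesis
        using additive_map_finsum[OF M.abelian_group_axioms grp am A(1), of "M.part m"]
          M.part_carrier[OF m] assms(4) by (intro exI[of _ A]) auto
    qed
  qed (use assms(2,4) in \<open>auto simp: M.part_props(1) M.part_homog\<close>)
  then show ?thesis by (intro graded_group.intro graded_group_axioms.intro grp)
qed


section \<open>Graded modules and their tensor products\<close>

lemma (in graded_ring) graded_group_ring: "graded_group A (rgrade A)"
  using rgrade_sum by (simp add: graded_group_def graded_group_axioms_def abelian_group_axioms)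

lemma (in graded_module) graded_group_module: "graded_group M (mgrade M)"
  using mgrade_sum by (simp add: graded_group_def graded_group_axioms_def M.abelian_group_axioms)

locale graded_bimodule = A: graded_ring A + B: graded_ring B + P: graded_group P "mgrade P"
  for A :: "'a gring" and B :: "'b gring" and P :: "('a, 'b, 'e) gbimodule" +
  assumes smult_closed: "\<lbrakk>a \<in> carrier A; p \<in> carrier P\<rbrakk> \<Longrightarrow> a \<odot>\<^bsub>P\<^esub> p \<in> carrier P"
    and smult_l_distr: "\<lbrakk>a \<in> carrier A; a' \<in> carrier A; p \<in> carrier P\<rbrakk>
      \<Longrightarrow> (a \<oplus>\<^bsub>A\<^esub> a') \<odot>\<^bsub>P\<^esub> p = a \<odot>\<^bsub>P\<^esub> p \<oplus>\<^bsub>P\<^esub> a' \<odot>\<^bsub>P\<^esub> p"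
    and smult_r_distr: "\<lbrakk>a \<in> carrier A; p \<in> carrier P; q \<in> carrier P\<rbrakk>
      \<Longrightarrow> a \<odot>\<^bsub>P\<^esub> (p \<oplus>\<^bsub>P\<^esub> q) = a \<odot>\<^bsub>P\<^esub> p \<oplus>\<^bsub>P\<^esub> a \<odot>\<^bsub>P\<^esub> q"
    and smult_assoc: "\<lbrakk>a \<in> carrier A; a' \<in> carrier A; p \<in> carrier P\<rbrakk>
      \<Longrightarrow> (a \<otimes>\<^bsub>A\<^esub> a') \<odot>\<^bsub>P\<^esub> p = a \<odot>\<^bsub>P\<^esub> (a' \<odot>\<^bsub>P\<^esub> p)"
    and smult_one: "p \<in> carrier P \<Longrightarrow> \<one>\<^bsub>A\<^esub> \<odot>\<^bsub>P\<^esub> p = p"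
    and mgrade_smult: "\<lbrakk>a \<in> rgrade A i; p \<in> mgrade P j\<rbrakk> \<Longrightarrow> a \<odot>\<^bsub>P\<^esub> p \<in> mgrade P (i + j)"
    and rsmult_closed: "\<lbrakk>p \<in> carrier P; b \<in> carrier B\<rbrakk> \<Longrightarrow> rsmult P p b \<in> carrier P"
    and rsmult_l_distr: "\<lbrakk>p \<in> carrier P; q \<in> carrier P; b \<in> carrier B\<rbrakk>
      \<Longrightarrow> rsmult P (p \<oplus>\<^bsub>P\<^esub> q) b = rsmult P p b \<oplus>\<^bsub>P\<^esub> rsmult P q b"
    and rsmult_r_distr: "\<lbrakk>p \<in> carrier P; b \<in> carrier B; b' \<in> carrier B\<rbrakk>
      \<Longrightarrow> rsmult P p (b \<oplus>\<^bsub>B\<^esub> b') = rsmult P p b \<oplus>\<^bsub>P\<^esub> rsmult P p b'"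
    and rsmult_assoc: "\<lbrakk>p \<in> carrier P; b \<in> carrier B; b' \<in> carrier B\<rbrakk>
      \<Longrightarrow> rsmult P p (b \<otimes>\<^bsub>B\<^esub> b') = rsmult P (rsmult P p b) b'"
    and rsmult_one: "p \<in> carrier P \<Longrightarrow> rsmult P p \<one>\<^bsub>B\<^esub> = p"
    and mgrade_rsmult: "\<lbrakk>p \<in> mgrade P i; b \<in> rgrade B j\<rbrakk> \<Longrightarrow> rsmult P p b \<in> mgrade P (i + j)"
    and smult_rsmult: "\<lbrakk>a \<in> carrier A; p \<in> carrier P; b \<in> carrier B\<rbrakk>
      \<Longrightarrow> rsmult P (a \<odot>\<^bsub>P\<^esub> p) b = a \<odot>\<^bsub>P\<^esub> rsmult P p b"

lemma tensor_class_eq_iff: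
  "tensor_class B P M xs = tensor_class B P M ys \<longleftrightarrow> tensor_eq B P M xs ys"
proof
  have self: "tensor_eq B P M zs (SOME ys. tensor_eq B P M zs ys)" for zs
    by (rule someI[of _ zs]) (rule tensor_eq.refl)
  show "tensor_eq B P M xs ys" if "tensor_class B P M xs = tensor_class B P M ys"
    using that self[of xs] tensor_eq.sym[OF self[of ys]] unfolding tensor_class_def
    by (auto intro: tensor_eq.trans)
  assume e: "tensor_eq B P M xs ys"
  have "tensor_eq B P M xs = tensor_eq B P M ys"
    using e tensor_eq.sym[OF e] by (blast intro: tensor_eq.trans)
  then show "tensor_class B P M xs = tensor_class B P M ys" unfolding tensor_class_def by simp
qed

lemma tensor_class_summands: "tensor_class B P M (summands (tensor_class B P M xs)) = tensor_class B P M xs"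
proof -
  have "tensor_eq B P M xs (SOME ys. tensor_eq B P M xs ys)"
    by (rule someI[of _ xs]) (rule tensor_eq.refl)
  then have "tensor_eq B P M xs (summands (tensor_class B P M xs))" by (simp add: tensor_class_def)
  then show ?thesis using tensor_class_eq_iff tensor_eq.sym by blast
qed

abbreviation pure_tensor where "pure_tensor B P M p m \<equiv> tensor_class B P M [(p, m)]"

lemma tensor_add: "tensor_class B P M xs \<oplus>\<^bsub>tensor B P M\<^esub> tensor_class B P M ys = tensor_class B P M (xs @ ys)"
proof -
  have "tensor_eq B P M (summands (tensor_class B P M xs)) xs" for xs
    using tensor_class_summands tensor_class_eq_iff by blast
  then show ?thesis by (simp add: tensor_def tensor_class_eq_iff tensor_eq.append)
qed

lemma tensor_zero: "\<zero>\<^bsub>tensor B P M\<^esub> = tensor_class B P M []"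
  by (simp add: tensor_def)

lemma tensor_carrier: "carrier (tensor B P M) = tensor_class B P M ` lists (carrier P \<times> carrier M)"
  by (simp add: tensor_def)

lemma tensor_mgrade: "mgrade (tensor B P M) i =
    tensor_class B P M ` lists (\<Union>j. mgrade P j \<times> mgrade M (i - j))"
  by (simp add: tensor_def)

text \<open>Both the whole tensor product and its homogeneous pieces consist of the classes of the formal sums
  over a fixed set of pairs, which accounts for the set \<open>X\<close>.\<close>

lemma lists_tensor_induct:
  assumes "t \<in> tensor_class B P M ` lists X"
    and "Q \<zero>\<^bsub>tensor B P M\<^esub>"
    and "\<And>p m. (p, m) \<in> X \<Longrightarrow> Q (pure_tensor B P M p m)"
    and "\<And>u v. \<lbrakk>u \<in> tensor_class B P M ` lists X; v \<in> tensor_class B P M ` lists X; Q u; Q v\<rbrakk>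
      \<Longrightarrow> Q (u \<oplus>\<^bsub>tensor B P M\<^esub> v)"
  shows "Q t"
proof -
  obtain xs where xs: "xs \<in> lists X" "t = tensor_class B P M xs" using assms(1) by auto
  have "Q (tensor_class B P M xs)" using xs(1)
  proof (induction xs)
    case Nil
    then show ?case using assms(2) by (simp add: tensor_zero)
  next
    case (Cons x xs)
    obtain p m where x: "x = (p, m)" by (cases x)
    have "tensor_class B P M (x # xs) = pure_tensor B P M p m \<oplus>\<^bsub>tensor B P M\<^esub> tensor_class B P M xs"
      by (simp add: tensor_add x)
    moreover have "Q (pure_tensor B P M p m)" using Cons assms(3) x by simp
    moreover have "pure_tensor B P M p m \<in> tensor_class B P M ` lists X"
      "tensor_class B P M xs \<in> tensor_class B P M ` lists X"
      using Cons x by (auto intro!: imageI)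
    ultimately show ?case using assms(4)[of "pure_tensor B P M p m" "tensor_class B P M xs"] Cons by simp
  qed
  then show ?thesis using xs(2) by simp
qed

lemma tensor_induct [consumes 1, case_names zero pure add]:
  assumes "t \<in> carrier (tensor B P M)"
    and "Q \<zero>\<^bsub>tensor B P M\<^esub>"
    and "\<And>p m. \<lbrakk>p \<in> carrier P; m \<in> carrier M\<rbrakk> \<Longrightarrow> Q (pure_tensor B P M p m)"
    and "\<And>u v. \<lbrakk>u \<in> carrier (tensor B P M); v \<in> carrier (tensor B P M); Q u; Q v\<rbrakk>
      \<Longrightarrow> Q (u \<oplus>\<^bsub>tensor B P M\<^esub> v)"
  shows "Q t"
  by (rule lists_tensor_induct[where Q = Q, OF assms(1)[unfolded tensor_carrier] assms(2)])
    (use assms(3,4) in \<open>auto simp del: in_lists_conv_set simp: tensor_carrier\<close>)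

lemma tensor_mgrade_induct [consumes 1, case_names zero pure add]:
  assumes "t \<in> mgrade (tensor B P M) i"
    and "Q \<zero>\<^bsub>tensor B P M\<^esub>"
    and "\<And>j p m. \<lbrakk>p \<in> mgrade P j; m \<in> mgrade M (i - j)\<rbrakk> \<Longrightarrow> Q (pure_tensor B P M p m)"
    and "\<And>u v. \<lbrakk>u \<in> mgrade (tensor B P M) i; v \<in> mgrade (tensor B P M) i; Q u; Q v\<rbrakk>
      \<Longrightarrow> Q (u \<oplus>\<^bsub>tensor B P M\<^esub> v)"
  shows "Q t"
  by (rule lists_tensor_induct[where Q = Q, OF assms(1)[unfolded tensor_mgrade] assms(2)])
    (use assms(3,4) in \<open>auto simp del: in_lists_conv_set simp: tensor_mgrade\<close>)

lemma tensor_class_append: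
  assumes "t \<in> tensor_class B P M ` lists X" "u \<in> tensor_class B P M ` lists X"
  shows "t \<oplus>\<^bsub>tensor B P M\<^esub> u \<in> tensor_class B P M ` lists X"
proof -
  obtain xs ys where "t = tensor_class B P M xs" "u = tensor_class B P M ys" "xs @ ys \<in> lists X"
    using assms by auto
  then show ?thesis using tensor_add by (metis imageI)
qed

locale graded_tensor = graded_bimodule A B P + M: graded_module B M
  for A :: "'a gring" and B :: "'b gring" and P :: "('a, 'b, 'e) gbimodule"
    and M :: "('b, ('e, 'u) univ) gmodule"
begin

abbreviation T where "T \<equiv> tensor B P M"
abbreviation pure where "pure \<equiv> pure_tensor B P M"

lemma gradedM: "graded_group M (mgrade M)"
  by (rule M.graded_group_module)

lemma pure_closed: "p \<in> carrier P \<Longrightarrow> m \<in> carrier M \<Longrightarrow> pure p m \<in> carrier T"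
  by (auto simp: tensor_carrier)

lemma pure_add_left:
  "\<lbrakk>p \<in> carrier P; q \<in> carrier P; m \<in> carrier M\<rbrakk> \<Longrightarrow> pure (p \<oplus>\<^bsub>P\<^esub> q) m = pure p m \<oplus>\<^bsub>T\<^esub> pure q m"
  by (simp add: tensor_add tensor_class_eq_iff tensor_eq.add_left)

lemma pure_add_right:
  "\<lbrakk>p \<in> carrier P; m \<in> carrier M; n \<in> carrier M\<rbrakk> \<Longrightarrow> pure p (m \<oplus>\<^bsub>M\<^esub> n) = pure p m \<oplus>\<^bsub>T\<^esub> pure p n"
  by (simp add: tensor_add tensor_class_eq_iff tensor_eq.add_right)

lemma pure_zero_left: "m \<in> carrier M \<Longrightarrow> pure \<zero>\<^bsub>P\<^esub> m = \<zero>\<^bsub>T\<^esub>"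
  by (simp add: tensor_zero tensor_class_eq_iff tensor_eq.zero_left)

lemma pure_balance:
  "\<lbrakk>p \<in> carrier P; b \<in> carrier B; m \<in> carrier M\<rbrakk> \<Longrightarrow> pure (rsmult P p b) m = pure p (b \<odot>\<^bsub>M\<^esub> m)"
  by (simp add: tensor_class_eq_iff tensor_eq.balance)

lemma tensor_abelian_group: "abelian_group T"
proof (rule abelian_groupI)
  have closed: "x \<oplus>\<^bsub>T\<^esub> y \<in> carrier T" if "x \<in> carrier T" "y \<in> carrier T" for x y
    using that unfolding tensor_carrier by (rule tensor_class_append)
  then show "\<And>x y. \<lbrakk>x \<in> carrier T; y \<in> carrier T\<rbrakk> \<Longrightarrow> x \<oplus>\<^bsub>T\<^esub> y \<in> carrier T" .
  show z: "\<zero>\<^bsub>T\<^esub> \<in> carrier T" by (auto simp: tensor_zero tensor_carrier)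
  have assoc: "(x \<oplus>\<^bsub>T\<^esub> y) \<oplus>\<^bsub>T\<^esub> z = x \<oplus>\<^bsub>T\<^esub> (y \<oplus>\<^bsub>T\<^esub> z)"
    if "x \<in> carrier T" "y \<in> carrier T" "z \<in> carrier T" for x y z
    using that by (auto simp: tensor_carrier tensor_add)
  then show "\<And>x y z. \<lbrakk>x \<in> carrier T; y \<in> carrier T; z \<in> carrier T\<rbrakk> \<Longrightarrow>
    (x \<oplus>\<^bsub>T\<^esub> y) \<oplus>\<^bsub>T\<^esub> z = x \<oplus>\<^bsub>T\<^esub> (y \<oplus>\<^bsub>T\<^esub> z)" .
  have comm: "x \<oplus>\<^bsub>T\<^esub> y = y \<oplus>\<^bsub>T\<^esub> x" if "x \<in> carrier T" "y \<in> carrier T" for x y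
    using that by (auto simp: tensor_carrier tensor_add tensor_class_eq_iff tensor_eq.comm)
  then show "\<And>x y. \<lbrakk>x \<in> carrier T; y \<in> carrier T\<rbrakk> \<Longrightarrow> x \<oplus>\<^bsub>T\<^esub> y = y \<oplus>\<^bsub>T\<^esub> x" .
  have l_zero: "\<zero>\<^bsub>T\<^esub> \<oplus>\<^bsub>T\<^esub> x = x" if "x \<in> carrier T" for x
    using that by (auto simp: tensor_carrier tensor_add tensor_zero)
  then show "\<And>x. x \<in> carrier T \<Longrightarrow> \<zero>\<^bsub>T\<^esub> \<oplus>\<^bsub>T\<^esub> x = x" .
  fix x assume "x \<in> carrier T"
  then show "\<exists>y\<in>carrier T. y \<oplus>\<^bsub>T\<^esub> x = \<zero>\<^bsub>T\<^esub>"
  proof (induction x rule: tensor_induct)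
    case zero
    show ?case using z l_zero[OF z] by blast
  next
    case (pure p m)
    then have pm: "p \<in> carrier P" "m \<in> carrier M" by auto
    then have "pure (\<ominus>\<^bsub>P\<^esub> p) m \<oplus>\<^bsub>T\<^esub> pure p m = \<zero>\<^bsub>T\<^esub>"
      using pure_add_left[of "\<ominus>\<^bsub>P\<^esub> p" p m] pure_zero_left by (simp add: P.l_neg)
    then show ?case using pure_closed[of "\<ominus>\<^bsub>P\<^esub> p" m] pm by auto
  next
    case (add u v)
    then obtain u' v' where uv: "u' \<in> carrier T" "u' \<oplus>\<^bsub>T\<^esub> u = \<zero>\<^bsub>T\<^esub>"
      "v' \<in> carrier T" "v' \<oplus>\<^bsub>T\<^esub> v = \<zero>\<^bsub>T\<^esub>" by blast
    have "(u' \<oplus>\<^bsub>T\<^esub> v') \<oplus>\<^bsub>T\<^esub> (u \<oplus>\<^bsub>T\<^esub> v) = (u' \<oplus>\<^bsub>T\<^esub> u) \<oplus>\<^bsub>T\<^esub> (v' \<oplus>\<^bsub>T\<^esub> v)"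
    proof -
      have "v' \<oplus>\<^bsub>T\<^esub> (u \<oplus>\<^bsub>T\<^esub> v) = u \<oplus>\<^bsub>T\<^esub> (v' \<oplus>\<^bsub>T\<^esub> v)"
        using assoc[of v' u v] assoc[of u v' v] comm[of v' u] add(1,2) uv(3) by simp
      then show ?thesis
        using assoc[of u' v' "u \<oplus>\<^bsub>T\<^esub> v"] assoc[of u' u "v' \<oplus>\<^bsub>T\<^esub> v"] closed add(1,2) uv(1,3) by simp
    qed
    also have "\<dots> = \<zero>\<^bsub>T\<^esub>" using uv l_zero[OF z] by simp
    finally show ?case using closed uv by blast
  qed
qed

lemma pure_zero_right: assumes "p \<in> carrier P" shows "pure p \<zero>\<^bsub>M\<^esub> = \<zero>\<^bsub>T\<^esub>"
proof -
  have "additive_map M T (pure p)"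
    by (rule additive_mapI) (use assms pure_closed pure_add_right in auto)
  then show ?thesis using additive_map_zero[OF M.M.abelian_group_axioms tensor_abelian_group] by blast
qed

lemma pure_mgrade: "p \<in> mgrade P i \<Longrightarrow> m \<in> mgrade M j \<Longrightarrow> pure p m \<in> mgrade T (i + j)"
  by (auto simp: tensor_mgrade intro!: image_eqI[where x = "[(p, m)]"] exI[of _ i])

lemma mgrade_carrier: "mgrade T i \<subseteq> carrier T"
proof -
  have "(\<Union>j. mgrade P j \<times> mgrade M (i - j)) \<subseteq> carrier P \<times> carrier M"
    using P.piece_carrier graded_group.piece_carrier[OF gradedM] by auto
  then have "lists (\<Union>j. mgrade P j \<times> mgrade M (i - j)) \<subseteq> lists (carrier P \<times> carrier M)"
    by (rule lists_mono)
  then show ?thesis unfolding tensor_mgrade tensor_carrier by blast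
qed

lemma mgrade_add: "t \<in> mgrade T i \<Longrightarrow> u \<in> mgrade T i \<Longrightarrow> t \<oplus>\<^bsub>T\<^esub> u \<in> mgrade T i"
  unfolding tensor_mgrade by (rule tensor_class_append)

text \<open>The value is computed on the representative that \<open>tensor_class\<close> has chosen; for balanced \<open>g\<close> it
  is the same on every other representative, by rule induction over \<open>tensor_eq\<close>.\<close>

definition lift :: "('x, 'y) ring_scheme \<Rightarrow> ('e \<Rightarrow> ('e, 'u) univ \<Rightarrow> 'x) \<Rightarrow> ('e, 'u) univ \<Rightarrow> 'x"
  where "lift G g t = foldr (\<lambda>(p, m) z. g p m \<oplus>\<^bsub>G\<^esub> z) (summands t) \<zero>\<^bsub>G\<^esub>"

definition balanced :: "('x, 'y) ring_scheme \<Rightarrow> ('e \<Rightarrow> ('e, 'u) univ \<Rightarrow> 'x) \<Rightarrow> bool"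
  where "balanced G g \<longleftrightarrow>
    (\<forall>p\<in>carrier P. additive_map M G (g p)) \<and>
    (\<forall>m\<in>carrier M. additive_map P G (\<lambda>p. g p m)) \<and>
    (\<forall>p\<in>carrier P. \<forall>b\<in>carrier B. \<forall>m\<in>carrier M. g (rsmult P p b) m = g p (b \<odot>\<^bsub>M\<^esub> m))"

text \<open>The universal property of the tensor product. The degree projections below, the linear maps out of
  an induced module and the traces are all instances.\<close>

lemma lift:
  assumes "abelian_group G" "balanced G g"
  shows lift_additive: "additive_map T G (lift G g)"
    and lift_pure: "\<And>p m. p \<in> carrier P \<Longrightarrow> m \<in> carrier M \<Longrightarrow> lift G g (pure p m) = g p m"
proof -
  interpret G: abelian_group G by fact
  define L where "L xs = foldr (\<lambda>(p, m) z. g p m \<oplus>\<^bsub>G\<^esub> z) xs \<zero>\<^bsub>G\<^esub>" for xs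
  let ?C = "carrier P \<times> carrier M"
  have g1: "additive_map M G (g p)" if "p \<in> carrier P" for p using assms(2) that unfolding balanced_def by blast
  have g2: "additive_map P G (\<lambda>p. g p m)" if "m \<in> carrier M" for m
    using assms(2) that unfolding balanced_def by blast
  have g3: "g (rsmult P p b) m = g p (b \<odot>\<^bsub>M\<^esub> m)" if "p \<in> carrier P" "b \<in> carrier B" "m \<in> carrier M" for p b m
    using assms(2) that unfolding balanced_def by blast
  have gc: "g p m \<in> carrier G" if "p \<in> carrier P" "m \<in> carrier M" for p m
    using additive_map_closed[OF g1] that by blast
  have Lc: "L xs \<in> carrier G" if "set xs \<subseteq> ?C" for xs
    using that by (induction xs) (auto simp: L_def gc)
  have La: "L (xs @ ys) = L xs \<oplus>\<^bsub>G\<^esub> L ys" if "set xs \<subseteq> ?C" "set ys \<subseteq> ?C" for xs ys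
    using that
  proof (induction xs)
    case Nil
    then show ?case using Lc by (simp add: L_def)
  next
    case (Cons x xs)
    obtain p m where x: "x = (p, m)" by (cases x)
    have Lx: "L (x # zs) = g p m \<oplus>\<^bsub>G\<^esub> L zs" for zs by (simp add: L_def x)
    have "L ((x # xs) @ ys) = g p m \<oplus>\<^bsub>G\<^esub> (L xs \<oplus>\<^bsub>G\<^esub> L ys)" using Lx Cons by simp
    also have "\<dots> = L (x # xs) \<oplus>\<^bsub>G\<^esub> L ys" using Cons.prems Lc gc Lx by (simp add: G.a_assoc x)
    finally show ?case .
  qed
  have inv: "(set xs \<subseteq> ?C \<longleftrightarrow> set ys \<subseteq> ?C) \<and> (set xs \<subseteq> ?C \<longrightarrow> L xs = L ys)"
    if "tensor_eq B P M xs ys" for xs ys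
    using that
  proof (induction rule: tensor_eq.induct)
    case (append xs xs' ys ys')
    then show ?case by (auto simp: La)
  next
    case (comm xs ys)
    show ?case by (auto simp: La Lc G.a_comm)
  next
    case (add_left p q m)
    then show ?case using additive_map_add[OF g2] by (auto simp: L_def gc)
  next
    case (add_right p m n)
    then show ?case using additive_map_add[OF g1] by (auto simp: L_def gc)
  next
    case (zero_left m)
    then show ?case
      using additive_map_zero[OF P.abelian_group_axioms G.abelian_group_axioms g2] by (auto simp: L_def)
  next
    case (balance p b m)
    then show ?case using rsmult_closed g3 M.smult_closed by (auto simp: L_def)
  qed auto
  have LT: "lift G g (tensor_class B P M xs) = L xs" if "set xs \<subseteq> ?C" for xs
  proof -
    have "tensor_eq B P M xs (summands (tensor_class B P M xs))"
      using tensor_class_summands tensor_class_eq_iff by metis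
    then show ?thesis using inv that unfolding lift_def L_def by metis
  qed
  show "additive_map T G (lift G g)"
  proof (rule additive_mapI)
    show "lift G g t \<in> carrier G" if "t \<in> carrier T" for t
    proof -
      obtain xs where "t = tensor_class B P M xs" "set xs \<subseteq> ?C"
        using \<open>t \<in> carrier T\<close> unfolding tensor_carrier by blast
      then show ?thesis by (simp add: LT Lc)
    qed
    show "lift G g (t \<oplus>\<^bsub>T\<^esub> u) = lift G g t \<oplus>\<^bsub>G\<^esub> lift G g u" if tu: "t \<in> carrier T" "u \<in> carrier T" for t u
    proof -
      obtain xs ys where "t = tensor_class B P M xs" "set xs \<subseteq> ?C" "u = tensor_class B P M ys" "set ys \<subseteq> ?C"
        using tu unfolding tensor_carrier by blast
      then show ?thesis by (simp add: tensor_add LT La)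
    qed
  qed
  show "lift G g (pure p m) = g p m" if "p \<in> carrier P" "m \<in> carrier M" for p m
    using that LT[of "[(p, m)]"] gc by (simp add: L_def)
qed

lemma additive_map_eq_on_pure:
  assumes "abelian_group G" "additive_map T G f" "additive_map T G f'"
    and "\<And>p m. p \<in> carrier P \<Longrightarrow> m \<in> carrier M \<Longrightarrow> f (pure p m) = f' (pure p m)" "t \<in> carrier T"
  shows "f t = f' t"
  using assms(5)
proof (induction t rule: tensor_induct)
  case zero
  show ?case using additive_map_zero[OF tensor_abelian_group assms(1) assms(2)]
      additive_map_zero[OF tensor_abelian_group assms(1) assms(3)] by simp
next
  case (add u v)
  then show ?case using additive_map_add[OF assms(2)] additive_map_add[OF assms(3)] by simp
qed (use assms(4) in auto)

lemma lift_mgrade: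
  assumes "graded_group G W" "balanced G g"
    and "\<And>i j p m. p \<in> mgrade P i \<Longrightarrow> m \<in> mgrade M j \<Longrightarrow> g p m \<in> W (i + j + k)"
    and "t \<in> mgrade T i"
  shows "lift G g t \<in> W (i + k)"
proof -
  interpret G: graded_group G W by fact
  note lift = lift[OF G.abelian_group_axioms assms(2)]
  show ?thesis using assms(4)
  proof (induction t rule: tensor_mgrade_induct)
    case zero
    show ?case
      using additive_map_zero[OF tensor_abelian_group G.abelian_group_axioms lift(1)] G.piece_zero by simp
  next
    case (pure j p m)
    then show ?case
      using assms(3)[of p j m "i - j"] lift(2) P.piece_carrier graded_group.piece_carrier[OF gradedM] by simp
  next
    case (add u v)
    then have "u \<in> carrier T" "v \<in> carrier T" using mgrade_carrier by auto
    then show ?case using additive_map_add[OF lift(1)] G.piece_add add by simp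
  qed
qed

lemma tensor_smult_class:
  assumes "a \<in> carrier A"
  shows "a \<odot>\<^bsub>T\<^esub> tensor_class B P M xs = tensor_class B P M (map (\<lambda>(p, m). (a \<odot>\<^bsub>P\<^esub> p, m)) xs)"
proof -
  let ?f = "map (\<lambda>(p, m). (a \<odot>\<^bsub>P\<^esub> p, m))"
  have zero: "a \<odot>\<^bsub>P\<^esub> \<zero>\<^bsub>P\<^esub> = \<zero>\<^bsub>P\<^esub>"
    by (rule additive_map_zero[OF P.abelian_group_axioms P.abelian_group_axioms additive_mapI])
      (use assms smult_closed smult_r_distr in auto)
  have "tensor_eq B P M (?f xs) (?f ys)" if "tensor_eq B P M xs ys" for xs ys
    using that
  proof (induction rule: tensor_eq.induct)
    case (trans xs ys zs)
    then show ?case using tensor_eq.trans by blast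
  next
    case (add_left p q m)
    then show ?case using assms tensor_eq.add_left[of "a \<odot>\<^bsub>P\<^esub> p" P "a \<odot>\<^bsub>P\<^esub> q" m M B]
      by (simp add: smult_closed smult_r_distr)
  next
    case (add_right p m n)
    then show ?case using assms tensor_eq.add_right[of "a \<odot>\<^bsub>P\<^esub> p" P m M n B]
      by (simp add: smult_closed)
  next
    case (balance p b m)
    then show ?case using assms tensor_eq.balance[of "a \<odot>\<^bsub>P\<^esub> p" P b B m M]
      by (simp add: smult_closed smult_rsmult)
  qed (auto simp: zero intro: tensor_eq.intros)
  then have "tensor_class B P M (?f (summands (tensor_class B P M xs))) = tensor_class B P M (?f xs)"
    using tensor_class_summands tensor_class_eq_iff by blast
  then show ?thesis by (simp add: tensor_def)
qed

lemma smult_pure: "a \<in> carrier A \<Longrightarrow> a \<odot>\<^bsub>T\<^esub> pure p m = pure (a \<odot>\<^bsub>P\<^esub> p) m"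
  by (simp add: tensor_smult_class)

lemma smult_tensor_add:
  assumes "a \<in> carrier A" "t \<in> carrier T" "u \<in> carrier T"
  shows "a \<odot>\<^bsub>T\<^esub> (t \<oplus>\<^bsub>T\<^esub> u) = a \<odot>\<^bsub>T\<^esub> t \<oplus>\<^bsub>T\<^esub> a \<odot>\<^bsub>T\<^esub> u"
  using assms by (auto simp: tensor_carrier tensor_add tensor_smult_class)

lemma smult_tensor_closed:
  assumes "a \<in> carrier A" "t \<in> carrier T"
  shows "a \<odot>\<^bsub>T\<^esub> t \<in> carrier T"
  using assms smult_closed
  by (auto simp: tensor_carrier tensor_smult_class lists_eq_set intro!: imageI; blast)

lemma smult_tensor_zero: "a \<in> carrier A \<Longrightarrow> a \<odot>\<^bsub>T\<^esub> \<zero>\<^bsub>T\<^esub> = \<zero>\<^bsub>T\<^esub>"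
  by (simp add: tensor_zero tensor_smult_class)

text \<open>The projection of \<open>P \<otimes> M\<close> to degree \<open>i\<close> sends \<open>p \<otimes> m\<close> to \<open>\<Sum>\<^sub>j p\<^sub>j \<otimes> m\<^sub>i\<^sub>-\<^sub>j\<close>. Since
  \<open>p\<close>, \<open>m\<close> and \<open>b \<in> B\<close> are sums of homogeneous elements, biadditivity and balancedness of this
  expression need only be verified on homogeneous arguments.\<close>

definition proj_pure :: "int \<Rightarrow> 'e \<Rightarrow> ('e, 'u) univ \<Rightarrow> ('e, 'u) univ"
  where "proj_pure i p m = (\<Oplus>\<^bsub>T\<^esub>j\<in>{j. P.part p j \<noteq> \<zero>\<^bsub>P\<^esub>}.
    pure (P.part p j) (graded_group.part M (mgrade M) m (i - j)))"

lemma proj_pure: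
  assumes m: "m \<in> carrier M"
  shows "additive_map P T (\<lambda>p. proj_pure i p m)"
    and "\<And>j p. p \<in> mgrade P j \<Longrightarrow> proj_pure i p m = pure p (graded_group.part M (mgrade M) m (i - j))"
proof -
  interpret GM: graded_group M "mgrade M" by (rule gradedM)
  note glue = P.glue_pieces[OF tensor_abelian_group,
      of "\<lambda>j v. pure v (graded_group.part M (mgrade M) m (i - j))", folded proj_pure_def]
  show "additive_map P T (\<lambda>p. proj_pure i p m)"
    by (rule glue(1)) (use m P.piece_carrier GM.part_carrier pure_closed pure_add_left in auto)
  show "\<And>j p. p \<in> mgrade P j \<Longrightarrow> proj_pure i p m = pure p (graded_group.part M (mgrade M) m (i - j))"
    by (rule glue(2)) (use m P.piece_carrier GM.part_carrier pure_closed pure_add_left in auto)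
qed

lemma proj_pure_balanced: "balanced T (proj_pure i)"
proof -
  interpret GM: graded_group M "mgrade M" by (rule gradedM)
  interpret GB: graded_group B "rgrade B" by (rule B.graded_group_ring)
  interpret T: abelian_group T by (rule tensor_abelian_group)
  have closed: "proj_pure i p m \<in> carrier T" if "p \<in> carrier P" "m \<in> carrier M" for p m
    using additive_map_closed[OF proj_pure(1)] that by blast
  have addl: "proj_pure i (p \<oplus>\<^bsub>P\<^esub> q) m = proj_pure i p m \<oplus>\<^bsub>T\<^esub> proj_pure i q m"
    if "p \<in> carrier P" "q \<in> carrier P" "m \<in> carrier M" for p q m
    using additive_map_add[OF proj_pure(1)] that by blast
  have addr: "proj_pure i p (m \<oplus>\<^bsub>M\<^esub> n) = proj_pure i p m \<oplus>\<^bsub>T\<^esub> proj_pure i p n"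
    if "p \<in> carrier P" and mn: "m \<in> carrier M" "n \<in> carrier M" for p m n
    using that(1)
  proof (induction p rule: P.homogeneous_induct)
    case (homogeneous j p)
    then show ?case using mn P.piece_carrier
      by (simp add: proj_pure(2) GM.part_add GM.part_carrier pure_add_right)
  next
    case (add p q)
    then show ?case using mn closed
      by (simp add: addl T.a_ac T.a_closed)
  qed
  have bal: "proj_pure i (rsmult P p b) m = proj_pure i p (b \<odot>\<^bsub>M\<^esub> m)"
    if "p \<in> carrier P" "b \<in> carrier B" "m \<in> carrier M" for p b m
    using that(1)
  proof (induction p rule: P.homogeneous_induct)
    case (homogeneous j p)
    have p: "p \<in> carrier P" using P.piece_carrier homogeneous .
    show ?case using that(2)
    proof (induction b rule: GB.homogeneous_induct)
      case (homogeneous k b)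
      have b: "b \<in> carrier B" using GB.piece_carrier homogeneous .
      have pb: "rsmult P p b \<in> mgrade P (j + k)" using mgrade_rsmult \<open>p \<in> mgrade P j\<close> homogeneous by blast
      have am: "additive_map M M (\<lambda>m. b \<odot>\<^bsub>M\<^esub> m)"
        by (rule additive_mapI) (use M.smult_closed M.smult_r_distr b in auto)
      have "b \<odot>\<^bsub>M\<^esub> GM.part m (i - (j + k)) = GM.part (b \<odot>\<^bsub>M\<^esub> m) (i - (j + k) + k)"
      proof (rule GM.part_commute[OF GM.graded_group_axioms am _ that(3)])
        show "b \<odot>\<^bsub>M\<^esub> v \<in> mgrade M (l + k)" if "v \<in> mgrade M l" for l v
          using M.mgrade_smult[OF homogeneous that] by (simp add: add.commute)
      qed
      then have "b \<odot>\<^bsub>M\<^esub> GM.part m (i - (j + k)) = GM.part (b \<odot>\<^bsub>M\<^esub> m) (i - j)" by simp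
      then show ?case
        using proj_pure(2)[OF that(3) pb] proj_pure(2)[OF M.smult_closed[OF b that(3)] \<open>p \<in> mgrade P j\<close>]
          pure_balance[OF p b GM.part_carrier[OF that(3)]] by simp
    next
      case (add b c)
      then show ?case using p that(3) addr M.smult_closed
        by (simp add: rsmult_r_distr M.smult_l_distr addl rsmult_closed)
    qed
  next
    case (add p q)
    then show ?case using that by (simp add: rsmult_l_distr rsmult_closed addl M.smult_closed)
  qed
  show ?thesis unfolding balanced_def
    using proj_pure(1) addr bal closed by (auto intro: additive_mapI)
qed

lemma tensor_graded: "graded_by T (mgrade T)"
proof -
  interpret GM: graded_group M "mgrade M" by (rule gradedM)
  interpret T: abelian_group T by (rule tensor_abelian_group)
  define \<pi> where "\<pi> t i = lift T (proj_pure i) t" for t i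
  note L = lift[OF tensor_abelian_group proj_pure_balanced]
  have \<pi>add: "additive_map T T (\<lambda>t. \<pi> t i)" for i using L(1) unfolding \<pi>_def .
  have pure: "\<pi> (pure p m) i = proj_pure i p m" if "p \<in> carrier P" "m \<in> carrier M" for p m i
    using L(2) that unfolding \<pi>_def by simp
  have hom: "\<pi> (pure p m) i = (if i = j + k then pure p m else \<zero>\<^bsub>T\<^esub>)"
    if pm: "p \<in> mgrade P j" "m \<in> mgrade M k" for p m i j k
    using pm P.piece_carrier GM.piece_carrier
    by (auto simp: pure proj_pure(2) GM.part_homog pure_zero_right)
  have \<pi>zero: "\<pi> \<zero>\<^bsub>T\<^esub> i = \<zero>\<^bsub>T\<^esub>" for i
    using additive_map_zero[OF tensor_abelian_group tensor_abelian_group \<pi>add] .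
  have sub: "additive_subgroup (mgrade T i) T" for i
  proof (rule additive_subgroupI, rule T.add.subgroupI)
    show "mgrade T i \<subseteq> carrier T" by (rule mgrade_carrier)
    show "mgrade T i \<noteq> {}" unfolding tensor_mgrade by auto
    show "\<And>t u. t \<in> mgrade T i \<Longrightarrow> u \<in> mgrade T i \<Longrightarrow> t \<oplus>\<^bsub>T\<^esub> u \<in> mgrade T i"
      by (rule mgrade_add)
    show "\<ominus>\<^bsub>T\<^esub> t \<in> mgrade T i" if "t \<in> mgrade T i" for t
      using that
    proof (induction t rule: tensor_mgrade_induct)
      case zero
      have "\<zero>\<^bsub>T\<^esub> \<in> mgrade T i" by (auto simp: tensor_zero tensor_mgrade)
      moreover have "\<ominus>\<^bsub>T\<^esub> \<zero>\<^bsub>T\<^esub> = \<zero>\<^bsub>T\<^esub>" by (rule T.minus_equality) auto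
      ultimately show ?case by (simp only:)
    next
      case pm: (pure j p m)
      then have c: "p \<in> carrier P" "m \<in> carrier M" using P.piece_carrier GM.piece_carrier by auto
      have "pure (\<ominus>\<^bsub>P\<^esub> p) m \<oplus>\<^bsub>T\<^esub> pure p m = \<zero>\<^bsub>T\<^esub>"
        using c pure_add_left[of "\<ominus>\<^bsub>P\<^esub> p" p m] pure_zero_left by (simp add: P.l_neg)
      then have "\<ominus>\<^bsub>T\<^esub> pure p m = pure (\<ominus>\<^bsub>P\<^esub> p) m"
        using c pure_closed by (intro T.minus_equality) auto
      then show ?case using pure_mgrade[OF P.piece_minus[OF pm(1)] pm(2)] by simp
    next
      case (add u v)
      then have "\<ominus>\<^bsub>T\<^esub> (u \<oplus>\<^bsub>T\<^esub> v) = \<ominus>\<^bsub>T\<^esub> u \<oplus>\<^bsub>T\<^esub> \<ominus>\<^bsub>T\<^esub> v"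
        using mgrade_carrier by (intro T.minus_add) auto
      then show ?case using mgrade_add add by simp
    qed
  qed
  show ?thesis
  proof (rule graded_byI[OF tensor_abelian_group sub \<pi>add])
    show "\<pi> t i \<in> mgrade T i" if "t \<in> carrier T" for t i
      using that
    proof (induction t rule: tensor_induct)
      case zero
      show ?case using \<pi>zero[of i] additive_subgroup.zero_closed[OF sub[of i]] by simp
    next
      case (pure p m)
      then have m: "m \<in> carrier M" and "p \<in> carrier P" by auto
      from this(2) have "proj_pure i p m \<in> mgrade T i"
      proof (induction p rule: P.homogeneous_induct)
        case (homogeneous j p)
        then show ?case
          using pure_mgrade[OF homogeneous GM.part_props(1)[OF m, of "i - j"]] by (simp add: proj_pure(2) m)
      next
        case (add p q)
        then show ?case using additive_map_add[OF proj_pure(1)[OF m] add(1,2)] mgrade_add by simp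
      qed
      then show ?case using \<pi>_def L(2) pure by simp
    next
      case (add u v)
      then show ?case using additive_map_add[OF \<pi>add add(1,2)] mgrade_add by simp
    qed
    show "\<pi> t i = (if i = j then t else \<zero>\<^bsub>T\<^esub>)" if "t \<in> mgrade T j" for i j t
      using that
    proof (induction t rule: tensor_mgrade_induct)
      case zero
      show ?case using \<pi>zero by simp
    next
      case (pure k p m)
      then show ?case using hom[of p k m "j - k" i] by simp
    next
      case (add u v)
      have "u \<in> carrier T" "v \<in> carrier T" using add mgrade_carrier by auto
      then show ?case using additive_map_add[OF \<pi>add[of i], of u v] add(3,4) by auto
    qed
    show "\<exists>A. finite A \<and> (\<forall>i. i \<notin> A \<longrightarrow> \<pi> t i = \<zero>\<^bsub>T\<^esub>) \<and> t = (\<Oplus>\<^bsub>T\<^esub>i\<in>A. \<pi> t i)"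
      (is "?S t") if "t \<in> carrier T" for t
      using that
    proof (induction t rule: tensor_induct)
      case zero
      show ?case using \<pi>zero by (intro exI[of _ "{}"]) auto
    next
      case (pure p m)
      then have m: "m \<in> carrier M" and p: "p \<in> carrier P" by auto
      from p show ?case
      proof (induction p rule: P.homogeneous_induct)
        case (homogeneous j p)
        then have p: "p \<in> carrier P" by (rule P.piece_carrier)
        from m show ?case
        proof (induction m rule: GM.homogeneous_induct)
          case (homogeneous k m)
          show ?case
            by (rule sum_of_parts_homog[where \<pi> = \<pi> and j = "j + k", OF tensor_abelian_group])
              (use pure_closed p GM.piece_carrier[OF homogeneous]
                hom[OF \<open>p \<in> mgrade P j\<close> homogeneous] in auto)
        next
          case (add m n)
          then show ?case
            using sum_of_parts_add[where \<pi> = \<pi>, OF tensor_abelian_group \<pi>add, of "pure p m" "pure p n"]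
              pure_closed p by (simp add: pure_add_right)
        qed
      next
        case (add p q)
        then show ?case
          using sum_of_parts_add[where \<pi> = \<pi>, OF tensor_abelian_group \<pi>add, of "pure p m" "pure q m"]
            pure_closed m by (simp add: pure_add_left)
      qed
    next
      case (add u v)
      show ?case by (rule sum_of_parts_add[where \<pi> = \<pi>, OF tensor_abelian_group \<pi>add add])
    qed
  qed
qed

lemma tensor_graded_module: "graded_module A T"
proof -
  interpret T: abelian_group T by (rule tensor_abelian_group)
  have addmap: "additive_map T T (\<lambda>t. a \<odot>\<^bsub>T\<^esub> t)" if "a \<in> carrier A" for a
    by (rule additive_mapI) (use smult_tensor_closed smult_tensor_add that in auto)
  show ?thesis
  proof (unfold_locales)
    show "a \<odot>\<^bsub>T\<^esub> t \<in> carrier T" if "a \<in> carrier A" "t \<in> carrier T" for a t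
      using smult_tensor_closed that .
    show "a \<odot>\<^bsub>T\<^esub> (t \<oplus>\<^bsub>T\<^esub> u) = a \<odot>\<^bsub>T\<^esub> t \<oplus>\<^bsub>T\<^esub> a \<odot>\<^bsub>T\<^esub> u"
      if "a \<in> carrier A" "t \<in> carrier T" "u \<in> carrier T" for a t u
      using smult_tensor_add that .
    show "graded_by T (mgrade T)" by (rule tensor_graded)
    show "\<one>\<^bsub>A\<^esub> \<odot>\<^bsub>T\<^esub> t = t" if "t \<in> carrier T" for t
    proof (rule additive_map_eq_on_pure[OF tensor_abelian_group addmap _ _ that])
      show "additive_map T T (\<lambda>t. t)" by (rule additive_mapI) auto
    qed (auto simp: smult_pure smult_one)
    show "(a \<oplus>\<^bsub>A\<^esub> b) \<odot>\<^bsub>T\<^esub> t = a \<odot>\<^bsub>T\<^esub> t \<oplus>\<^bsub>T\<^esub> b \<odot>\<^bsub>T\<^esub> t"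
      if ab: "a \<in> carrier A" "b \<in> carrier A" and "t \<in> carrier T" for a b t
    proof (rule additive_map_eq_on_pure[OF tensor_abelian_group addmap _ _ that(3)])
      show "additive_map T T (\<lambda>t. a \<odot>\<^bsub>T\<^esub> t \<oplus>\<^bsub>T\<^esub> b \<odot>\<^bsub>T\<^esub> t)"
        by (rule additive_mapI)
          (use ab in \<open>auto simp: smult_tensor_add smult_tensor_closed T.a_ac\<close>)
    qed (use ab in \<open>auto simp: smult_pure smult_l_distr pure_add_left smult_closed\<close>)
    show "(a \<otimes>\<^bsub>A\<^esub> b) \<odot>\<^bsub>T\<^esub> t = a \<odot>\<^bsub>T\<^esub> (b \<odot>\<^bsub>T\<^esub> t)"
      if ab: "a \<in> carrier A" "b \<in> carrier A" and "t \<in> carrier T" for a b t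
    proof (rule additive_map_eq_on_pure[OF tensor_abelian_group addmap _ _ that(3)])
      show "additive_map T T (\<lambda>t. a \<odot>\<^bsub>T\<^esub> (b \<odot>\<^bsub>T\<^esub> t))"
        by (rule additive_mapI) (use ab in \<open>auto simp: smult_tensor_add smult_tensor_closed\<close>)
    qed (use ab in \<open>auto simp: smult_pure smult_assoc\<close>)
    show "a \<odot>\<^bsub>T\<^esub> t \<in> mgrade T (i + j)" if a: "a \<in> rgrade A i" and "t \<in> mgrade T j" for a t i j
      using that(2)
    proof (induction t rule: tensor_mgrade_induct)
      have aA: "a \<in> carrier A" using graded_group.piece_carrier[OF A.graded_group_ring a] .
      {
        case zero
        have "\<zero>\<^bsub>T\<^esub> \<in> mgrade T (i + j)" by (auto simp: tensor_zero tensor_mgrade)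
        then show ?case using smult_tensor_zero[OF aA] by simp
      next
        case (pure k p m)
        then have "pure (a \<odot>\<^bsub>P\<^esub> p) m \<in> mgrade T (i + k + (j - k))"
          using pure_mgrade mgrade_smult a by blast
        then show ?case by (simp add: smult_pure[OF aA])
      next
        case (add u v)
        then have "u \<in> carrier T" "v \<in> carrier T" using mgrade_carrier by auto
        then show ?case using smult_tensor_add[OF aA] mgrade_add add by simp
      }
    qed
  qed
qed

end


section \<open>Functors between categories of graded modules\<close>

lemma Obj_gmod: "M \<in> Obj (gmod A) \<longleftrightarrow> graded_module A M"
  by (simp add: gmod_def)

lemma Hom_gmod: "Hom (gmod A) M N = gmod_hom A M N"
  by (simp add: gmod_def)

lemma Comp_gmod: "Comp (gmod A) L M N g f = compose (carrier L) g f"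
  by (simp add: gmod_def)

lemma Id_gmod: "Id (gmod A) M = (\<lambda>x\<in>carrier M. x)"
  by (simp add: gmod_def)

lemma gmod_hom_additive: "f \<in> gmod_hom A M N \<Longrightarrow> additive_map M N f"
  by (auto simp: gmod_hom_def intro: additive_mapI)

lemma gmod_hom_smult:
  "f \<in> gmod_hom A M N \<Longrightarrow> a \<in> carrier A \<Longrightarrow> x \<in> carrier M \<Longrightarrow> f (a \<odot>\<^bsub>M\<^esub> x) = a \<odot>\<^bsub>N\<^esub> f x"
  by (simp add: gmod_hom_def)

lemma gmod_hom_mgrade: "f \<in> gmod_hom A M N \<Longrightarrow> x \<in> mgrade M i \<Longrightarrow> f x \<in> mgrade N i"
  unfolding gmod_hom_def by blast

lemma gmod_hom_extensional: "f \<in> gmod_hom A M N \<Longrightarrow> f \<in> extensional (carrier M)"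
  by (auto simp: gmod_hom_def PiE_iff)

lemma gmod_homI:
  assumes "additive_map M N f" "f \<in> extensional (carrier M)"
    and "\<And>a x. a \<in> carrier A \<Longrightarrow> x \<in> carrier M \<Longrightarrow> f (a \<odot>\<^bsub>M\<^esub> x) = a \<odot>\<^bsub>N\<^esub> f x"
    and "\<And>i x. x \<in> mgrade M i \<Longrightarrow> f x \<in> mgrade N i"
  shows "f \<in> gmod_hom A M N"
  using assms unfolding gmod_hom_def additive_map_def by (auto simp: PiE_iff)

lemma gmod_hom_eqI:
  assumes "f \<in> gmod_hom A M N" "g \<in> gmod_hom A M N" "\<And>x. x \<in> carrier M \<Longrightarrow> f x = g x"
  shows "f = g"
  using assms by (intro extensionalityI[where A = "carrier M"]) (auto intro: gmod_hom_extensional)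

lemma (in graded_module) mgrade_carrier: "x \<in> mgrade M i \<Longrightarrow> x \<in> carrier M"
  using graded_group.piece_carrier[OF graded_group_module] .

lemma gmod_hom_compose:
  assumes "graded_module A L" "graded_module A M" "f \<in> gmod_hom A L M" "g \<in> gmod_hom A M N"
  shows "compose (carrier L) g f \<in> gmod_hom A L N"
proof -
  interpret L: graded_module A L by fact
  note f = gmod_hom_additive[OF assms(3)] gmod_hom_smult[OF assms(3)] gmod_hom_mgrade[OF assms(3)]
  note g = gmod_hom_additive[OF assms(4)] gmod_hom_smult[OF assms(4)] gmod_hom_mgrade[OF assms(4)]
  show ?thesis
    by (rule gmod_homI, rule additive_mapI)
      (use additive_map_closed[OF f(1)] additive_map_closed[OF g(1)] additive_map_add[OF f(1)]
         additive_map_add[OF g(1)] f(2,3) g(2,3) L.smult_closed L.mgrade_carrier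
        in \<open>auto simp: compose_eq compose_extensional\<close>)
qed

lemma category_gmod: "category (gmod A)"
proof (unfold_locales, unfold Obj_gmod Hom_gmod Comp_gmod Id_gmod)
  show "(\<lambda>x\<in>carrier M. x) \<in> gmod_hom A M M" if "graded_module A M" for M
  proof -
    interpret graded_module A M by fact
    show ?thesis
      by (rule gmod_homI, rule additive_mapI) (auto simp: smult_closed intro: mgrade_carrier)
  qed
  show "compose (carrier M) g f \<in> gmod_hom A M P"
    if "graded_module A M" "graded_module A N" "graded_module A P"
      "f \<in> gmod_hom A M N" "g \<in> gmod_hom A N P" for M N P f g
    using gmod_hom_compose that by blast
  show "compose (carrier M) f (\<lambda>x\<in>carrier M. x) = f" if "f \<in> gmod_hom A M N" for M N f
    using gmod_hom_extensional[OF that] by (auto simp: compose_def extensional_def fun_eq_iff)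
  show "compose (carrier M) (\<lambda>x\<in>carrier N. x) f = f" if "f \<in> gmod_hom A M N" for M N f
    using gmod_hom_extensional[OF that] additive_map_closed[OF gmod_hom_additive[OF that]]
    by (auto simp: compose_def extensional_def fun_eq_iff)
  show "compose (carrier M) h (compose (carrier M) g f) = compose (carrier M) (compose (carrier N) h g) f"
    if "f \<in> gmod_hom A M N" for M N f g h
    using additive_map_closed[OF gmod_hom_additive[OF that]] by (auto simp: compose_def fun_eq_iff)
qed

lemma is_functorI:
  assumes "\<And>M. graded_module A M \<Longrightarrow> graded_module B (omap F M)"
    and "\<And>M N f. \<lbrakk>graded_module A M; graded_module A N; f \<in> gmod_hom A M N\<rbrakk>
      \<Longrightarrow> amap F M N f \<in> gmod_hom B (omap F M) (omap F N)"
    and "\<And>M. graded_module A M \<Longrightarrow> amap F M M (\<lambda>x\<in>carrier M. x) = (\<lambda>x\<in>carrier (omap F M). x)"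
    and "\<And>L M N f g. \<lbrakk>graded_module A L; graded_module A M; graded_module A N;
        f \<in> gmod_hom A L M; g \<in> gmod_hom A M N\<rbrakk>
      \<Longrightarrow> amap F L N (compose (carrier L) g f) =
        compose (carrier (omap F L)) (amap F M N g) (amap F L M f)"
  shows "is_functor (gmod A) (gmod B) F"
  by (rule is_functor.intro[OF category_gmod category_gmod], unfold_locales)
    (use assms in \<open>auto simp: Obj_gmod Hom_gmod Comp_gmod Id_gmod\<close>)

lemma is_functor_comp:
  assumes "is_functor C D F" "is_functor D E G"
  shows "is_functor C E (G \<circ>\<^sub>F F)"
proof -
  interpret F: is_functor C D F by fact
  interpret G: is_functor D E G by fact
  show ?thesis
    by unfold_locales
      (auto simp: comp_func_def F.omap_Obj G.omap_Obj F.amap_Hom G.amap_Hom F.amap_Id G.amap_Id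
         F.amap_Comp G.amap_Comp)
qed

lemma graded_module_shift:
  assumes "graded_module A M"
  shows "graded_module A (M\<lparr>mgrade := \<lambda>i. mgrade M (i + n)\<rparr>)" (is "graded_module A ?N")
proof -
  interpret M: graded_module A M by fact
  interpret GM: graded_group M "mgrade M" by (rule M.graded_group_module)
  \<comment> \<open>Additive subgroups and finite sums are defined in terms of \<open>add_monoid\<close>, which the shift preserves.\<close>
  have am: "add_monoid ?N = add_monoid M" by simp
  have grp: "abelian_group ?N"
    using M.M.abelian_group_axioms
    unfolding abelian_group_def abelian_monoid_def abelian_group_axioms_def am .
  have fs: "finsum ?N = finsum M" unfolding finsum_def am ..
  have "graded_by ?N (\<lambda>i. mgrade M (i + n))"
  proof (rule graded_byI[OF grp, of _ "\<lambda>m i. GM.part m (i + n)"])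
    show "additive_subgroup (mgrade M (i + n)) ?N" for i
      using GM.piece_subgroup unfolding additive_subgroup_def am .
    show "additive_map ?N ?N (\<lambda>m. GM.part m (i + n))" for i
      using GM.additive_part unfolding additive_map_def by simp
    show "\<exists>A. finite A \<and> (\<forall>i. i \<notin> A \<longrightarrow> GM.part m (i + n) = \<zero>\<^bsub>?N\<^esub>) \<and>
        m = (\<Oplus>\<^bsub>?N\<^esub>i\<in>A. GM.part m (i + n))" if "m \<in> carrier ?N" for m
    proof -
      have m: "m \<in> carrier M" using that by simp
      obtain A where A: "finite A" "\<forall>i. i \<notin> A \<longrightarrow> GM.part m i = \<zero>\<^bsub>M\<^esub>" "m = (\<Oplus>\<^bsub>M\<^esub>i\<in>A. GM.part m i)"
        using GM.sum_of_parts[OF m] by blast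
      let ?B = "(\<lambda>i. i - n) ` A"
      have "A = (\<lambda>i. i + n) ` ?B" by (auto simp: image_image)
      then have "m = (\<Oplus>\<^bsub>M\<^esub>i\<in>(\<lambda>i. i + n) ` ?B. GM.part m i)" using A(3) by simp
      also have "\<dots> = (\<Oplus>\<^bsub>M\<^esub>i\<in>?B. GM.part m (i + n))"
        by (rule M.M.finsum_reindex) (use m GM.part_carrier in \<open>auto simp: inj_on_def\<close>)
      finally have "m = (\<Oplus>\<^bsub>M\<^esub>i\<in>?B. GM.part m (i + n))" .
      moreover have "i + n \<notin> A" if "i \<notin> ?B" for i
        using that by (metis add_diff_cancel_right' image_eqI)
      ultimately show ?thesis using A(1,2) unfolding fs by (intro exI[of _ ?B]) auto
    qed
  qed (auto simp: GM.part_props(1) GM.part_homog)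
  then have gr: "graded_by ?N (mgrade ?N)" by simp
  interpret N: abelian_group ?N by (rule grp)
  show ?thesis
  proof (unfold_locales)
    show "a \<odot>\<^bsub>?N\<^esub> x \<in> mgrade ?N (i + j)" if "a \<in> rgrade A i" "x \<in> mgrade ?N j" for a x i j
      using M.mgrade_smult[OF that(1), of x "j + n"] that(2) by (simp add: add.assoc)
  qed (use gr M.smult_closed M.smult_l_distr M.smult_r_distr M.smult_assoc M.smult_one in auto)
qed

lemma is_functor_shift: "is_functor (gmod A) (gmod A) (shift_func n)"
  by (rule is_functorI)
    (auto simp: shift_func_def gmod_hom_def graded_module_shift)

context graded_bimodule
begin

lemma amap_tensor_func:
  assumes "graded_module B M" "graded_module B N" "f \<in> gmod_hom B M N"
  shows amap_tensor_hom: "amap (tensor_func B P) M N f \<in> gmod_hom A (tensor B P M) (tensor B P N)"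
    and amap_tensor_pure: "\<And>p m. p \<in> carrier P \<Longrightarrow> m \<in> carrier M \<Longrightarrow>
      amap (tensor_func B P) M N f (pure_tensor B P M p m) = pure_tensor B P N p (f m)"
proof -
  interpret M: graded_tensor A B P M
    by (intro graded_tensor.intro graded_bimodule_axioms assms(1))
  interpret N: graded_tensor A B P N
    by (intro graded_tensor.intro graded_bimodule_axioms assms(2))
  let ?F = "amap (tensor_func B P) M N f"
  note fa = gmod_hom_additive[OF assms(3)]
  have resp: "tensor_eq B P N (map (\<lambda>(p, m). (p, f m)) xs) (map (\<lambda>(p, m). (p, f m)) ys)"
    if "tensor_eq B P M xs ys" for xs ys
    using that
  proof (induction rule: tensor_eq.induct)
    case (trans xs ys zs)
    then show ?case using tensor_eq.trans by blast
  next
    case (balance p b m)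
    then show ?case
      using tensor_eq.balance[of p P b B "f m" N] additive_map_closed[OF fa] gmod_hom_smult[OF assms(3)]
      by simp
  qed (use additive_map_closed[OF fa] additive_map_add[OF fa] in \<open>auto intro: tensor_eq.intros\<close>)
  have cls: "?F (tensor_class B P M xs) = tensor_class B P N (map (\<lambda>(p, m). (p, f m)) xs)"
    if "xs \<in> lists (carrier P \<times> carrier M)" for xs
  proof -
    have "tensor_class B P M xs \<in> carrier M.T" using that unfolding tensor_carrier by blast
    moreover have "tensor_eq B P M (summands (tensor_class B P M xs)) xs"
      using tensor_class_summands tensor_class_eq_iff by metis
    ultimately show ?thesis using resp by (simp add: tensor_func_def tensor_class_eq_iff)
  qed
  show pure: "?F (pure_tensor B P M p m) = pure_tensor B P N p (f m)"
    if "p \<in> carrier P" "m \<in> carrier M" for p m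
    using cls[of "[(p, m)]"] that by simp
  have additive: "additive_map M.T N.T ?F"
  proof (rule additive_mapI)
    show "?F t \<in> carrier N.T" if t: "t \<in> carrier M.T" for t
    proof -
      obtain xs where xs: "t = tensor_class B P M xs" "xs \<in> lists (carrier P \<times> carrier M)"
        using t unfolding tensor_carrier by blast
      then have "map (\<lambda>(p, m). (p, f m)) xs \<in> lists (carrier P \<times> carrier N)"
        using additive_map_closed[OF fa] by (auto simp: in_lists_conv_set)
      then show ?thesis using cls[OF xs(2)] unfolding xs(1) tensor_carrier by simp
    qed
    show "?F (t \<oplus>\<^bsub>M.T\<^esub> u) = ?F t \<oplus>\<^bsub>N.T\<^esub> ?F u" if tu: "t \<in> carrier M.T" "u \<in> carrier M.T" for t u
    proof -
      obtain xs ys where "t = tensor_class B P M xs" "xs \<in> lists (carrier P \<times> carrier M)"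
        "u = tensor_class B P M ys" "ys \<in> lists (carrier P \<times> carrier M)"
        using tu unfolding tensor_carrier by blast
      then show ?thesis using cls[of "xs @ ys"] by (simp add: cls tensor_add)
    qed
  qed
  show "?F \<in> gmod_hom A M.T N.T"
  proof (rule gmod_homI[OF additive])
    show "?F \<in> extensional (carrier M.T)" by (simp add: tensor_func_def)
    show "?F (a \<odot>\<^bsub>M.T\<^esub> t) = a \<odot>\<^bsub>N.T\<^esub> ?F t" if a: "a \<in> carrier A" and "t \<in> carrier M.T" for a t
    proof (rule M.additive_map_eq_on_pure[OF N.tensor_abelian_group _ _ _ that(2)])
      show "additive_map M.T N.T (\<lambda>t. ?F (a \<odot>\<^bsub>M.T\<^esub> t))"
        by (rule additive_mapI)
          (use a additive in \<open>auto simp: additive_map_closed additive_map_add M.smult_tensor_closed M.smult_tensor_add\<close>)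
      show "additive_map M.T N.T (\<lambda>t. a \<odot>\<^bsub>N.T\<^esub> ?F t)"
        by (rule additive_mapI)
          (use a additive in \<open>auto simp: additive_map_closed additive_map_add N.smult_tensor_closed N.smult_tensor_add\<close>)
    qed (use a in \<open>auto simp: M.smult_pure N.smult_pure pure smult_closed\<close>)
    show "?F t \<in> mgrade N.T i" if "t \<in> mgrade M.T i" for t i
      using that
    proof (induction t rule: tensor_mgrade_induct)
      case zero
      have "\<zero>\<^bsub>N.T\<^esub> \<in> mgrade N.T i" by (auto simp: tensor_zero tensor_mgrade)
      then show ?case
        using additive_map_zero[OF M.tensor_abelian_group N.tensor_abelian_group additive] by simp
    next
      case (pure j p m)
      then show ?case
        using \<open>\<And>p m. p \<in> carrier P \<Longrightarrow> m \<in> carrier M \<Longrightarrow> ?F (pure_tensor B P M p m) = pure_tensor B P N p (f m)\<close>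
          N.pure_mgrade[OF pure(1) gmod_hom_mgrade[OF assms(3) pure(2)]]
          P.piece_carrier[OF pure(1)] M.M.mgrade_carrier[OF pure(2)] by simp
    next
      case (add u v)
      then have "u \<in> carrier M.T" "v \<in> carrier M.T" using M.mgrade_carrier by auto
      then show ?case using additive_map_add[OF additive] N.mgrade_add add by simp
    qed
  qed
qed

lemma is_functor_tensor: "is_functor (gmod B) (gmod A) (tensor_func B P)"
proof (rule is_functorI)
  fix M :: "('b, ('e, 'u) univ) gmodule" assume M: "graded_module B M"
  then interpret M: graded_tensor A B P M
    by (intro graded_tensor.intro graded_bimodule_axioms)
  show T: "graded_module A (omap (tensor_func B P) M)"
    using M.tensor_graded_module by (simp add: tensor_func_def)
  have id: "(\<lambda>x\<in>carrier M. x) \<in> gmod_hom B M M"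
    using category.Id_Hom[OF category_gmod, of M B] M by (simp add: Obj_gmod Hom_gmod Id_gmod)
  let ?F = "amap (tensor_func B P) M M (\<lambda>x\<in>carrier M. x)"
  have "?F t = t" if "t \<in> carrier M.T" for t
  proof (rule M.additive_map_eq_on_pure[OF M.tensor_abelian_group _ _ _ that])
    show "additive_map M.T M.T ?F" using gmod_hom_additive[OF amap_tensor_hom[OF M M id]] .
    show "additive_map M.T M.T (\<lambda>t. t)" by (rule additive_mapI) auto
  qed (simp add: amap_tensor_pure[OF M M id, unfolded restrict_def] restrict_def)
  moreover have "?F \<in> extensional (carrier M.T)"
    using gmod_hom_extensional[OF amap_tensor_hom[OF M M id]] .
  ultimately show "?F = (\<lambda>x\<in>carrier (omap (tensor_func B P) M). x)"
    by (auto simp: tensor_func_def fun_eq_iff extensional_def)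
next
  fix M N :: "('b, ('e, 'u) univ) gmodule" and f
  assume "graded_module B M" "graded_module B N" "f \<in> gmod_hom B M N"
  then show "amap (tensor_func B P) M N f
    \<in> gmod_hom A (omap (tensor_func B P) M) (omap (tensor_func B P) N)"
    using amap_tensor_hom by (simp add: tensor_func_def)
next
  fix L M N :: "('b, ('e, 'u) univ) gmodule" and f g
  assume L: "graded_module B L" and M: "graded_module B M" and N: "graded_module B N"
    and f: "f \<in> gmod_hom B L M" and g: "g \<in> gmod_hom B M N"
  interpret L: graded_tensor A B P L by (intro graded_tensor.intro graded_bimodule_axioms L)
  interpret M: graded_tensor A B P M by (intro graded_tensor.intro graded_bimodule_axioms M)
  interpret N: graded_tensor A B P N by (intro graded_tensor.intro graded_bimodule_axioms N)
  note gf = gmod_hom_compose[OF L M f g]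
  note Ff = amap_tensor_func[OF L M f] and Fg = amap_tensor_func[OF M N g]
    and Fgf = amap_tensor_func[OF L N gf]
  have comp: "compose (carrier L.T) (amap (tensor_func B P) M N g) (amap (tensor_func B P) L M f)
    \<in> gmod_hom A L.T N.T"
    by (rule gmod_hom_compose[OF L.tensor_graded_module M.tensor_graded_module Ff(1) Fg(1)])
  show "amap (tensor_func B P) L N (compose (carrier L) g f) =
    compose (carrier (omap (tensor_func B P) L)) (amap (tensor_func B P) M N g) (amap (tensor_func B P) L M f)"
    unfolding tensor_func_def[THEN arg_cong[where f = omap], simplified]
  proof (rule gmod_hom_eqI[OF Fgf(1) comp])
    fix t assume "t \<in> carrier L.T"
    then show "amap (tensor_func B P) L N (compose (carrier L) g f) t =
      compose (carrier L.T) (amap (tensor_func B P) M N g) (amap (tensor_func B P) L M f) t"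
    proof (rule L.additive_map_eq_on_pure[OF N.tensor_abelian_group gmod_hom_additive[OF Fgf(1)]
          gmod_hom_additive[OF comp], rotated])
      fix p m assume pm: "p \<in> carrier P" "m \<in> carrier L"
      moreover have "f m \<in> carrier M" using additive_map_closed[OF gmod_hom_additive[OF f] pm(2)] .
      ultimately show "amap (tensor_func B P) L N (compose (carrier L) g f) (L.pure p m) =
        compose (carrier L.T) (amap (tensor_func B P) M N g) (amap (tensor_func B P) L M f) (L.pure p m)"
        using Fgf(2)[OF pm] Ff(2)[OF pm] Fg(2)[of p "f m"] L.pure_closed[OF pm] by (simp add: compose_eq)
    qed
  qed
qed

end


section \<open>Adjunctions from an abstract odd Demazure operator\<close>

lemma (in abelian_group) diff_eq_diff_iff:
  assumes "a \<in> carrier G" "b \<in> carrier G" "c \<in> carrier G" "e \<in> carrier G"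
    and "a \<oplus> e = c \<oplus> b"
  shows "a \<ominus> b = c \<ominus> e"
proof -
  have "a \<ominus> b = (a \<oplus> e) \<oplus> (\<ominus> e \<oplus> \<ominus> b)"
    using assms(1-4) by (simp add: a_minus_def a_assoc r_neg2)
  also have "\<dots> = (c \<oplus> b) \<oplus> (\<ominus> b \<oplus> \<ominus> e)"
    using assms by (simp add: a_comm[of "\<ominus> e"])
  also have "\<dots> = c \<ominus> e"
    using assms(1-4) by (simp add: a_minus_def a_assoc r_neg2)
  finally show ?thesis .
qed

text \<open>The abstract setting, with \<open>x\<close> in the role of \<open>x\<^sub>1\<close>. The two identities for \<open>\<partial>\<partial>\<close> and \<open>\<partial>s\<close> ensure that
  the kernel of \<open>\<partial>\<close> contains its image and is stable under \<open>s\<close>.\<close>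

locale odd_Demazure_ring = graded_ring R for R :: "'a gring" (structure) +
  fixes s d :: "'a \<Rightarrow> 'a" and x :: 'a
  assumes s_additive: "additive_map R R s"
    and s_mult: "\<lbrakk>f \<in> carrier R; g \<in> carrier R\<rbrakk> \<Longrightarrow> s (f \<otimes> g) = s f \<otimes> s g"
    and s_one: "s \<one> = \<one>"
    and s_s: "f \<in> carrier R \<Longrightarrow> s (s f) = f"
    and s_rgrade: "f \<in> rgrade R i \<Longrightarrow> s f \<in> rgrade R i"
    and d_additive: "additive_map R R d"
    and d_mult: "\<lbrakk>f \<in> carrier R; g \<in> carrier R\<rbrakk> \<Longrightarrow> d (f \<otimes> g) = d f \<otimes> g \<oplus> s f \<otimes> d g"
    and d_d: "f \<in> carrier R \<Longrightarrow> d (d f) = \<zero>"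
    and d_s: "f \<in> carrier R \<Longrightarrow> d (s f) = \<ominus> s (d f)"
    and d_rgrade: "f \<in> rgrade R i \<Longrightarrow> d f \<in> rgrade R (i - 2)"
    and x_rgrade: "x \<in> rgrade R 2"
    and d_x: "d x = \<one>"
begin

sublocale gr: graded_group R "rgrade R" by (rule graded_group_ring)

lemma s_closed [simp]: "f \<in> carrier R \<Longrightarrow> s f \<in> carrier R"
  using additive_map_closed[OF s_additive] .

lemma d_closed [simp]: "f \<in> carrier R \<Longrightarrow> d f \<in> carrier R"
  using additive_map_closed[OF d_additive] .

lemma x_closed [simp]: "x \<in> carrier R"
  using gr.piece_carrier[OF x_rgrade] .

lemmas s_add = additive_map_add[OF s_additive]
lemmas d_add = additive_map_add[OF d_additive]
lemmas s_zero = additive_map_zero[OF abelian_group_axioms abelian_group_axioms s_additive]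
lemmas d_zero = additive_map_zero[OF abelian_group_axioms abelian_group_axioms d_additive]
lemmas s_diff = additive_map_diff[OF abelian_group_axioms abelian_group_axioms s_additive]
lemmas d_diff = additive_map_diff[OF abelian_group_axioms abelian_group_axioms d_additive]

lemma d_one: "d \<one> = \<zero>"
proof -
  have "d \<one> \<otimes> \<one> \<oplus> s \<one> \<otimes> d \<one> = d (\<one> \<otimes> \<one>)" using d_mult[of \<one> \<one>] by (simp only: one_closed)
  then have "d \<one> \<oplus> d \<one> = d \<one>" by (simp only: s_one l_one r_one d_closed one_closed)
  then show ?thesis using add.l_cancel_one[of "d \<one>" "d \<one>"] by simp
qed

definition kern where "kern = {f \<in> carrier R. d f = \<zero>}"

definition S :: "'a gring" where "S = R\<lparr>carrier := kern, rgrade := \<lambda>i. rgrade R i \<inter> kern\<rparr>"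

lemma kern_carrier: "f \<in> kern \<Longrightarrow> f \<in> carrier R"
  by (simp add: kern_def)

lemma kern_s: "f \<in> kern \<Longrightarrow> s f \<in> kern"
  by (simp add: kern_def d_s s_zero)

lemma kern_d: "f \<in> carrier R \<Longrightarrow> d f \<in> kern"
  by (simp add: kern_def d_d)

lemma kern_closed:
  shows "\<zero> \<in> kern" "\<one> \<in> kern"
    and "f \<in> kern \<Longrightarrow> g \<in> kern \<Longrightarrow> f \<oplus> g \<in> kern"
    and "f \<in> kern \<Longrightarrow> \<ominus> f \<in> kern"
    and "f \<in> kern \<Longrightarrow> g \<in> kern \<Longrightarrow> f \<otimes> g \<in> kern"
  using additive_map_minus[OF abelian_group_axioms abelian_group_axioms d_additive, of f]
  by (auto simp: kern_def d_zero d_one d_add d_mult)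

lemma d_kern_left: "f \<in> kern \<Longrightarrow> g \<in> carrier R \<Longrightarrow> d (f \<otimes> g) = s f \<otimes> d g"
  by (simp add: kern_def d_mult)

lemma d_kern_right: "f \<in> carrier R \<Longrightarrow> g \<in> kern \<Longrightarrow> d (f \<otimes> g) = d f \<otimes> g"
  by (simp add: kern_def d_mult)

declare kern_carrier [simp]

text \<open>Since \<open>\<partial>\<close> is linear for right multiplication by its kernel and \<open>\<partial>(x) = 1\<close>, the map
  \<open>f \<mapsto> f - x \<partial>(f)\<close> takes values in the kernel: \<open>R\<close> is generated by 1 and \<open>x\<close> as a right module.\<close>

lemma x_expansion:
  assumes "f \<in> carrier R"
  shows "f \<ominus> x \<otimes> d f \<in> kern" "f = (f \<ominus> x \<otimes> d f) \<oplus> x \<otimes> d f"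
proof -
  have "d (f \<ominus> x \<otimes> d f) = d f \<ominus> d (x \<otimes> d f)" using assms by (simp add: d_diff)
  also have "d (x \<otimes> d f) = d f" using assms by (simp add: d_kern_right kern_d d_x)
  finally show "f \<ominus> x \<otimes> d f \<in> kern" using assms by (simp add: kern_def r_neg a_minus_def del: kern_carrier)
  show "f = (f \<ominus> x \<otimes> d f) \<oplus> x \<otimes> d f" using assms by (simp add: a_minus_def a_assoc l_neg)
qed

lemma d_s_x: "d (s x) = \<ominus> \<one>"
  by (simp add: d_s d_x s_one)

text \<open>The next three elements of the kernel make the Casimir element below central.\<close>

lemma kern_trace: "x \<oplus> s x \<in> kern"
  by (simp add: kern_def d_add d_x d_s_x r_neg del: kern_carrier)

lemma kern_norm: "s x \<otimes> x \<in> kern"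
  by (simp add: kern_def d_mult d_x d_s_x s_s l_minus l_neg del: kern_carrier)

lemma kern_commutator: "a \<in> kern \<Longrightarrow> s a \<otimes> s x \<ominus> s x \<otimes> a \<in> kern"
proof -
  assume a: "a \<in> kern"
  have "d (s a \<otimes> s x) = \<ominus> a" using a by (simp add: d_kern_left kern_s d_s_x s_s r_minus)
  moreover have "d (s x \<otimes> a) = \<ominus> a" using a by (simp add: d_kern_right d_s_x l_minus)
  ultimately have "d (s a \<otimes> s x \<ominus> s x \<otimes> a) = \<ominus> a \<ominus> \<ominus> a"
    using a by (simp add: d_diff)
  also have "\<dots> = \<zero>" using a by (simp add: a_minus_def l_neg)
  finally have "d (s a \<otimes> s x \<ominus> s x \<otimes> a) = \<zero>" .
  moreover have "s a \<otimes> s x \<ominus> s x \<otimes> a \<in> carrier R" using a by simp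
  ultimately show ?thesis unfolding kern_def by simp
qed

definition semilinear where
  "semilinear \<sigma> k M N \<phi> \<longleftrightarrow> additive_map M N \<phi> \<and>
    (\<forall>f\<in>kern. \<forall>m\<in>carrier M. \<phi> (f \<odot>\<^bsub>M\<^esub> m) = \<sigma> f \<odot>\<^bsub>N\<^esub> \<phi> m) \<and>
    (\<forall>i. \<forall>m\<in>mgrade M i. \<phi> m \<in> mgrade N (i + k))"

lemma semilinearD:
  assumes "semilinear \<sigma> k M N \<phi>"
  shows "additive_map M N \<phi>"
    and "\<And>f m. f \<in> kern \<Longrightarrow> m \<in> carrier M \<Longrightarrow> \<phi> (f \<odot>\<^bsub>M\<^esub> m) = \<sigma> f \<odot>\<^bsub>N\<^esub> \<phi> m"
    and "\<And>i m. m \<in> mgrade M i \<Longrightarrow> \<phi> m \<in> mgrade N (i + k)"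
  using assms unfolding semilinear_def by auto

text \<open>The Casimir element \<open>x \<otimes> 1 - 1 \<otimes> s(x)\<close> turns \<open>s\<close>-semilinear maps into linear ones.
  As \<open>R\<close> is generated by \<open>x\<close> over the kernel, linearity has to be checked for \<open>x\<close> and for
  elements of the kernel only, and there it is semilinearity at the three elements above.\<close>

lemma casimir_linear:
  assumes "graded_module R M" "graded_module R N" and add: "additive_map M N \<omega>"
    and semi: "\<And>f m. f \<in> kern \<Longrightarrow> m \<in> carrier M \<Longrightarrow> \<omega> (f \<odot>\<^bsub>M\<^esub> m) = s f \<odot>\<^bsub>N\<^esub> \<omega> m"
  defines "q \<equiv> \<lambda>m. x \<odot>\<^bsub>N\<^esub> \<omega> m \<ominus>\<^bsub>N\<^esub> \<omega> (s x \<odot>\<^bsub>M\<^esub> m)"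
  shows "additive_map M N q"
    and "\<And>r m. r \<in> carrier R \<Longrightarrow> m \<in> carrier M \<Longrightarrow> q (r \<odot>\<^bsub>M\<^esub> m) = r \<odot>\<^bsub>N\<^esub> q m"
proof -
  interpret M: graded_module R M by fact
  interpret N: graded_module R N by fact
  note [simp] = M.smult_closed N.smult_closed
  have \<omega>c [simp]: "\<omega> m \<in> carrier N" if "m \<in> carrier M" for m using additive_map_closed[OF add that] .
  have \<omega>a: "\<omega> (m \<oplus>\<^bsub>M\<^esub> n) = \<omega> m \<oplus>\<^bsub>N\<^esub> \<omega> n" if "m \<in> carrier M" "n \<in> carrier M" for m n
    using additive_map_add[OF add that] .
  have qc [simp]: "q m \<in> carrier N" if "m \<in> carrier M" for m using that by (simp add: q_def)
  show qadd: "additive_map M N q"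
  proof (rule additive_mapI[OF qc])
    fix m n assume mn: "m \<in> carrier M" "n \<in> carrier M"
    show "q (m \<oplus>\<^bsub>M\<^esub> n) = q m \<oplus>\<^bsub>N\<^esub> q n"
      using mn by (simp add: q_def \<omega>a M.smult_r_distr N.smult_r_distr a_minus_def N.M.minus_add N.M.a_ac)
  qed
  have smul_diff: "r \<odot>\<^bsub>N\<^esub> (m \<ominus>\<^bsub>N\<^esub> n) = r \<odot>\<^bsub>N\<^esub> m \<ominus>\<^bsub>N\<^esub> r \<odot>\<^bsub>N\<^esub> n"
    if "r \<in> carrier R" "m \<in> carrier N" "n \<in> carrier N" for r m n
    by (rule additive_map_diff[OF N.M.abelian_group_axioms N.M.abelian_group_axioms additive_mapI])
      (use that N.smult_r_distr in auto)
  have qx: "q (x \<odot>\<^bsub>M\<^esub> m) = x \<odot>\<^bsub>N\<^esub> q m" if m: "m \<in> carrier M" for m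
  proof -
    have "\<omega> (x \<odot>\<^bsub>M\<^esub> m) \<oplus>\<^bsub>N\<^esub> \<omega> (s x \<odot>\<^bsub>M\<^esub> m) = \<omega> ((x \<oplus> s x) \<odot>\<^bsub>M\<^esub> m)"
      using m by (simp add: \<omega>a M.smult_l_distr)
    also have "\<dots> = x \<odot>\<^bsub>N\<^esub> \<omega> m \<oplus>\<^bsub>N\<^esub> s x \<odot>\<^bsub>N\<^esub> \<omega> m"
      using m by (simp add: semi[OF kern_trace] s_add s_s N.smult_l_distr N.M.a_comm)
    finally have "x \<odot>\<^bsub>N\<^esub> \<omega> (x \<odot>\<^bsub>M\<^esub> m) \<oplus>\<^bsub>N\<^esub> x \<odot>\<^bsub>N\<^esub> \<omega> (s x \<odot>\<^bsub>M\<^esub> m)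
        = x \<odot>\<^bsub>N\<^esub> (x \<odot>\<^bsub>N\<^esub> \<omega> m) \<oplus>\<^bsub>N\<^esub> x \<odot>\<^bsub>N\<^esub> (s x \<odot>\<^bsub>N\<^esub> \<omega> m)"
      using m by (simp add: N.smult_r_distr[symmetric])
    moreover have "\<omega> (s x \<odot>\<^bsub>M\<^esub> (x \<odot>\<^bsub>M\<^esub> m)) = x \<odot>\<^bsub>N\<^esub> (s x \<odot>\<^bsub>N\<^esub> \<omega> m)"
      using m semi[OF kern_norm, of m] by (simp add: M.smult_assoc N.smult_assoc s_mult s_s)
    ultimately show ?thesis using m
      unfolding q_def by (subst smul_diff) (auto intro!: N.M.diff_eq_diff_iff)
  qed
  have qa: "q (a \<odot>\<^bsub>M\<^esub> m) = a \<odot>\<^bsub>N\<^esub> q m" if a: "a \<in> kern" and m: "m \<in> carrier M" for a m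
  proof -
    let ?g = "s a \<otimes> s x \<ominus> s x \<otimes> a"
    have g: "s ?g = a \<otimes> x \<ominus> x \<otimes> s a" using a by (simp add: s_diff s_mult s_s)
    have "\<omega> (s a \<odot>\<^bsub>M\<^esub> (s x \<odot>\<^bsub>M\<^esub> m)) = \<omega> ((?g \<oplus> s x \<otimes> a) \<odot>\<^bsub>M\<^esub> m)"
      using a m by (simp add: M.smult_assoc a_minus_def a_assoc l_neg)
    also have "\<dots> = (a \<otimes> x \<ominus> x \<otimes> s a) \<odot>\<^bsub>N\<^esub> \<omega> m \<oplus>\<^bsub>N\<^esub> \<omega> (s x \<odot>\<^bsub>M\<^esub> (a \<odot>\<^bsub>M\<^esub> m))"
      using a m by (simp add: M.smult_l_distr \<omega>a semi[OF kern_commutator] g M.smult_assoc)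
    finally have "x \<odot>\<^bsub>N\<^esub> (s a \<odot>\<^bsub>N\<^esub> \<omega> m) \<oplus>\<^bsub>N\<^esub> \<omega> (s a \<odot>\<^bsub>M\<^esub> (s x \<odot>\<^bsub>M\<^esub> m))
        = (x \<otimes> s a \<oplus> (a \<otimes> x \<ominus> x \<otimes> s a)) \<odot>\<^bsub>N\<^esub> \<omega> m \<oplus>\<^bsub>N\<^esub> \<omega> (s x \<odot>\<^bsub>M\<^esub> (a \<odot>\<^bsub>M\<^esub> m))"
      using a m by (simp add: N.smult_l_distr N.smult_assoc N.M.a_assoc)
    also have "x \<otimes> s a \<oplus> (a \<otimes> x \<ominus> x \<otimes> s a) = a \<otimes> x"
      using a by (simp add: a_minus_def a_ac r_neg)
    finally have "x \<odot>\<^bsub>N\<^esub> (s a \<odot>\<^bsub>N\<^esub> \<omega> m) \<oplus>\<^bsub>N\<^esub> a \<odot>\<^bsub>N\<^esub> \<omega> (s x \<odot>\<^bsub>M\<^esub> m)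
        = a \<odot>\<^bsub>N\<^esub> (x \<odot>\<^bsub>N\<^esub> \<omega> m) \<oplus>\<^bsub>N\<^esub> \<omega> (s x \<odot>\<^bsub>M\<^esub> (a \<odot>\<^bsub>M\<^esub> m))"
      using a m semi[OF kern_s[OF a], of "s x \<odot>\<^bsub>M\<^esub> m"] by (simp add: s_s N.smult_assoc)
    then show ?thesis using a m
      unfolding q_def by (subst smul_diff) (auto simp: semi[OF a m] intro!: N.M.diff_eq_diff_iff)
  qed
  fix r m assume r: "r \<in> carrier R" and m: "m \<in> carrier M"
  define a b where "a = r \<ominus> x \<otimes> d r" and "b = d r"
  have ab: "a \<in> kern" "b \<in> kern" "r = a \<oplus> x \<otimes> b"
    using x_expansion[OF r] kern_d[OF r] by (auto simp: a_def b_def)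
  show "q (r \<odot>\<^bsub>M\<^esub> m) = r \<odot>\<^bsub>N\<^esub> q m"
    using ab m additive_map_add[OF qadd]
    by (simp add: M.smult_l_distr N.smult_l_distr M.smult_assoc N.smult_assoc qa qx)
qed

end

text \<open>What the adjunctions use about a functor of the form \<open>M \<mapsto> R \<otimes> M\<close> or
  \<open>M \<mapsto> R \<otimes> 1\<^sup>s \<otimes> M\<close>: \<open>u\<close> is the map \<open>m \<mapsto> 1 \<otimes> m\<close>, universal among \<open>\<sigma>\<close>-semilinear maps
  to graded \<open>R\<close>-modules, and \<open>c\<close> is the trace \<open>r \<otimes> m \<mapsto> \<partial>(r) m\<close>, twisted by \<open>\<sigma>\<close>.\<close>

locale twisted_induction = odd_Demazure_ring R s d x
  for R :: "'a gring" (structure) and s d :: "'a \<Rightarrow> 'a" and x :: 'a +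
  fixes \<sigma> :: "'a \<Rightarrow> 'a"
    and F :: "(('a, 'b) gmodule, 'b \<Rightarrow> 'b, ('a, 'b) gmodule, 'b \<Rightarrow> 'b) func"
    and u c :: "('a, 'b) gmodule \<Rightarrow> 'b \<Rightarrow> 'b"
  assumes F_functor: "is_functor (gmod R) (gmod R) F"
    and u_semilinear: "graded_module R M \<Longrightarrow> semilinear \<sigma> (- 1) M (omap F M) (u M)"
    and u_natural: "\<lbrakk>graded_module R M; graded_module R N; f \<in> gmod_hom R M N; m \<in> carrier M\<rbrakk>
      \<Longrightarrow> amap F M N f (u M m) = u N (f m)"
    and u_generates: "\<lbrakk>graded_module R M; t \<in> carrier (omap F M); Q \<zero>\<^bsub>omap F M\<^esub>;
        \<And>r m. \<lbrakk>r \<in> carrier R; m \<in> carrier M\<rbrakk> \<Longrightarrow> Q (r \<odot>\<^bsub>omap F M\<^esub> u M m);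
        \<And>t t'. \<lbrakk>t \<in> carrier (omap F M); t' \<in> carrier (omap F M); Q t; Q t'\<rbrakk> \<Longrightarrow> Q (t \<oplus>\<^bsub>omap F M\<^esub> t')\<rbrakk>
      \<Longrightarrow> Q t"
    and u_universal: "\<lbrakk>graded_module R M; graded_module R N; semilinear \<sigma> (- 1) M N \<phi>\<rbrakk>
      \<Longrightarrow> \<exists>h\<in>gmod_hom R (omap F M) N. \<forall>m\<in>carrier M. h (u M m) = \<phi> m"
    and c_additive: "graded_module R M \<Longrightarrow> additive_map (omap F M) M (c M)"
    and c_mgrade: "\<lbrakk>graded_module R M; t \<in> mgrade (omap F M) i\<rbrakk> \<Longrightarrow> c M t \<in> mgrade M (i - 1)"
    and c_u: "\<lbrakk>graded_module R M; r \<in> carrier R; m \<in> carrier M\<rbrakk>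
      \<Longrightarrow> c M (r \<odot>\<^bsub>omap F M\<^esub> u M m) = \<sigma> (d r) \<odot>\<^bsub>M\<^esub> m"
begin

lemma F_module: "graded_module R M \<Longrightarrow> graded_module R (omap F M)"
  using is_functor.omap_Obj[OF F_functor] by (simp add: Obj_gmod)

lemma u_closed: "graded_module R M \<Longrightarrow> m \<in> carrier M \<Longrightarrow> u M m \<in> carrier (omap F M)"
  using additive_map_closed[OF semilinearD(1)[OF u_semilinear]] .

lemma additive_map_eq_on_generators:
  assumes "graded_module R M" "abelian_group G" "additive_map (omap F M) G f" "additive_map (omap F M) G g"
    and "\<And>r m. \<lbrakk>r \<in> carrier R; m \<in> carrier M\<rbrakk>
      \<Longrightarrow> f (r \<odot>\<^bsub>omap F M\<^esub> u M m) = g (r \<odot>\<^bsub>omap F M\<^esub> u M m)"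
    and "t \<in> carrier (omap F M)"
  shows "f t = g t"
proof -
  interpret FM: graded_module R "omap F M" using F_module assms(1) .
  note zero = additive_map_zero[OF FM.M.abelian_group_axioms assms(2)]
  show ?thesis
    by (rule u_generates[OF assms(1,6), of "\<lambda>t. f t = g t"])
      (use assms(5) zero[OF assms(3)] zero[OF assms(4)] additive_map_add[OF assms(3)]
        additive_map_add[OF assms(4)] in auto)
qed

lemma hom_eq_on_u:
  assumes "graded_module R M" "graded_module R N" "f \<in> gmod_hom R (omap F M) N" "g \<in> gmod_hom R (omap F M) N"
    and "\<And>m. m \<in> carrier M \<Longrightarrow> f (u M m) = g (u M m)"
  shows "f = g"
proof -
  interpret N: graded_module R N by fact
  show ?thesis
    by (rule gmod_hom_eqI[OF assms(3,4)], rule additive_map_eq_on_generators[OF assms(1)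
          N.M.abelian_group_axioms gmod_hom_additive[OF assms(3)] gmod_hom_additive[OF assms(4)]])
      (use assms(5) u_closed[OF assms(1)] gmod_hom_smult[OF assms(3)] gmod_hom_smult[OF assms(4)] in auto)
qed

lemma semilinear_hom_u:
  assumes "graded_module R M" "graded_module R N" "h \<in> gmod_hom R (omap F M) N"
    and \<sigma>: "\<And>f. f \<in> kern \<Longrightarrow> \<sigma> f \<in> kern"
  shows "semilinear \<sigma> (- 1) M N (\<lambda>m. h (u M m))"
  unfolding semilinear_def
proof (intro conjI allI ballI)
  note us = semilinearD[OF u_semilinear[OF assms(1)]] and ha = gmod_hom_additive[OF assms(3)]
  show "additive_map M N (\<lambda>m. h (u M m))"
    by (rule additive_mapI)
      (use additive_map_closed[OF ha] additive_map_add[OF ha] additive_map_closed[OF us(1)]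
        additive_map_add[OF us(1)] in auto)
  show "h (u M (f \<odot>\<^bsub>M\<^esub> m)) = \<sigma> f \<odot>\<^bsub>N\<^esub> h (u M m)" if "f \<in> kern" "m \<in> carrier M" for f m
    using us(2)[OF that] gmod_hom_smult[OF assms(3) kern_carrier[OF \<sigma>[OF that(1)]]] u_closed[OF assms(1) that(2)]
    by simp
  show "h (u M m) \<in> mgrade N (i + - 1)" if "m \<in> mgrade M i" for m i
    using gmod_hom_mgrade[OF assms(3) us(3)[OF that]] .
qed

end

text \<open>The pairs of twists for which \<open>casimir_linear\<close> applies: a \<open>\<sigma>\<close>-semilinear map followed by a
  \<open>\<tau>\<close>-semilinear one has to be \<open>s\<close>-semilinear.\<close>

definition (in odd_Demazure_ring) complementary where
  "complementary \<sigma> \<tau> \<longleftrightarrow> \<sigma> = id \<and> \<tau> = s \<or> \<sigma> = s \<and> \<tau> = id"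

lemma (in odd_Demazure_ring) complementaryD:
  assumes "complementary \<sigma> \<tau>" "f \<in> kern"
  shows "\<sigma> f \<in> kern" "\<tau> f \<in> kern" "\<sigma> (\<tau> f) = s f" "\<tau> (s f) = \<sigma> f" "\<tau> (\<tau> f) = f"
  using assms kern_s s_s by (auto simp: complementary_def)

context twisted_induction
begin

text \<open>The functor \<open>F\<close> also represents semilinear maps in the second argument: \<open>\<phi> : M \<rightarrow> N\<close>
  corresponds to the linear map \<open>m \<mapsto> x \<otimes> \<phi>(m) - 1 \<otimes> \<phi>(s(x) m)\<close> to \<open>F(N)\<close>, and is recovered
  from it by the trace.\<close>

definition coextend where
  "coextend M N \<phi> = (\<lambda>m\<in>carrier M.
    x \<odot>\<^bsub>omap F N\<^esub> u N (\<phi> m) \<ominus>\<^bsub>omap F N\<^esub> u N (\<phi> (s x \<odot>\<^bsub>M\<^esub> m)))"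

context
  fixes M N :: "('a, 'b) gmodule" and \<rho> :: "'a \<Rightarrow> 'a"
  assumes M: "graded_module R M" and N: "graded_module R N" and \<rho>: "complementary \<rho> \<sigma>"
begin

interpretation M: graded_module R M by (rule M)
interpretation N: graded_module R N by (rule N)
interpretation FN: graded_module R "omap F N" by (rule F_module[OF N])

lemma smult_u: "f \<in> kern \<Longrightarrow> n \<in> carrier N \<Longrightarrow> f \<odot>\<^bsub>omap F N\<^esub> u N n = u N (\<sigma> f \<odot>\<^bsub>N\<^esub> n)"
  using semilinearD(2)[OF u_semilinear[OF N], of "\<sigma> f" n] complementaryD[OF \<rho>, of f] by simp

lemma coextend_hom:
  assumes \<phi>: "semilinear \<rho> (- 1) M N \<phi>"
  shows "coextend M N \<phi> \<in> gmod_hom R M (omap F N)"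
proof -
  note p = semilinearD[OF \<phi>] and us = semilinearD[OF u_semilinear[OF N]]
  let ?\<omega> = "\<lambda>m. u N (\<phi> m)"
  have add: "additive_map M (omap F N) ?\<omega>"
    by (rule additive_mapI)
      (use additive_map_closed[OF p(1)] additive_map_add[OF p(1)] additive_map_closed[OF us(1)]
        additive_map_add[OF us(1)] in auto)
  have semi: "?\<omega> (f \<odot>\<^bsub>M\<^esub> m) = s f \<odot>\<^bsub>omap F N\<^esub> ?\<omega> m" if f: "f \<in> kern" and m: "m \<in> carrier M" for f m
    using p(2)[OF f m] smult_u[OF kern_s[OF f] additive_map_closed[OF p(1) m]] complementaryD(4)[OF \<rho> f]
    by simp
  let ?q = "\<lambda>m. x \<odot>\<^bsub>omap F N\<^esub> ?\<omega> m \<ominus>\<^bsub>omap F N\<^esub> ?\<omega> (s x \<odot>\<^bsub>M\<^esub> m)"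
  have lin: "additive_map M (omap F N) ?q"
    "\<And>r m. r \<in> carrier R \<Longrightarrow> m \<in> carrier M \<Longrightarrow> ?q (r \<odot>\<^bsub>M\<^esub> m) = r \<odot>\<^bsub>omap F N\<^esub> ?q m"
    using casimir_linear[OF M F_module[OF N] add] semi by blast+
  show ?thesis
  proof (rule gmod_homI)
    show "additive_map M (omap F N) (coextend M N \<phi>)"
      using lin(1) unfolding additive_map_def coextend_def by (auto simp: M.smult_closed)
    show "coextend M N \<phi> \<in> extensional (carrier M)" by (simp add: coextend_def)
    show "coextend M N \<phi> (r \<odot>\<^bsub>M\<^esub> m) = r \<odot>\<^bsub>omap F N\<^esub> coextend M N \<phi> m"
      if "r \<in> carrier R" "m \<in> carrier M" for r m
      using lin(2)[OF that] that by (simp add: coextend_def M.smult_closed)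
    interpret G: graded_group "omap F N" "mgrade (omap F N)" by (rule FN.graded_group_module)
    show "coextend M N \<phi> m \<in> mgrade (omap F N) i" if m: "m \<in> mgrade M i" for m i
    proof -
      have "x \<odot>\<^bsub>omap F N\<^esub> ?\<omega> m \<in> mgrade (omap F N) (2 + (i + - 1 + - 1))"
        by (rule FN.mgrade_smult[OF x_rgrade us(3)[OF p(3)[OF m]]])
      moreover have "?\<omega> (s x \<odot>\<^bsub>M\<^esub> m) \<in> mgrade (omap F N) (2 + i + - 1 + - 1)"
        by (rule us(3)[OF p(3)[OF M.mgrade_smult[OF s_rgrade[OF x_rgrade] m]]])
      ultimately show ?thesis
        using M.mgrade_carrier[OF m] G.piece_add G.piece_minus by (simp add: coextend_def a_minus_def)
    qed
  qed
qed

lemma c_coextend: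
  assumes \<phi>: "semilinear \<rho> (- 1) M N \<phi>" and m: "m \<in> carrier M"
  shows "c N (coextend M N \<phi> m) = \<phi> m"
proof -
  note p = additive_map_closed[OF semilinearD(1)[OF \<phi>]]
  have \<sigma>: "\<sigma> \<one> = \<one>" "\<sigma> \<zero> = \<zero>" using \<rho> s_one s_zero by (auto simp: complementary_def)
  have n: "\<phi> m \<in> carrier N" "\<phi> (s x \<odot>\<^bsub>M\<^esub> m) \<in> carrier N" using p m M.smult_closed by auto
  have "u N (\<phi> (s x \<odot>\<^bsub>M\<^esub> m)) = \<one> \<odot>\<^bsub>omap F N\<^esub> u N (\<phi> (s x \<odot>\<^bsub>M\<^esub> m))"
    using u_closed[OF N n(2)] FN.smult_one by simp
  then have 2: "c N (u N (\<phi> (s x \<odot>\<^bsub>M\<^esub> m))) = \<zero> \<odot>\<^bsub>N\<^esub> \<phi> (s x \<odot>\<^bsub>M\<^esub> m)"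
    using c_u[OF N one_closed n(2)] by (simp add: d_one \<sigma>)
  have 1: "c N (x \<odot>\<^bsub>omap F N\<^esub> u N (\<phi> m)) = \<phi> m"
    using c_u[OF N x_closed n(1)] n by (simp add: d_x \<sigma> N.smult_one)
  have "\<zero> \<odot>\<^bsub>N\<^esub> y = \<zero>\<^bsub>N\<^esub>" if "y \<in> carrier N" for y
    by (rule additive_map_zero[OF abelian_group_axioms N.M.abelian_group_axioms additive_mapI[of R]])
      (use that N.smult_closed N.smult_l_distr in auto)
  then show ?thesis
    using m n 1 2 additive_map_diff[OF FN.M.abelian_group_axioms N.M.abelian_group_axioms c_additive[OF N]]
      u_closed[OF N] FN.smult_closed
    by (simp add: coextend_def a_minus_def)
qed

lemma semilinear_c_hom:
  assumes k: "k \<in> gmod_hom R M (omap F N)"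
  shows "semilinear \<rho> (- 1) M N (\<lambda>m. c N (k m))"
  unfolding semilinear_def
proof (intro conjI allI ballI)
  note ka = gmod_hom_additive[OF k] and ca = c_additive[OF N]
  show "additive_map M N (\<lambda>m. c N (k m))"
    by (rule additive_mapI)
      (use additive_map_closed[OF ka] additive_map_add[OF ka] additive_map_closed[OF ca]
        additive_map_add[OF ca] in auto)
  show "c N (k m) \<in> mgrade N (i + - 1)" if "m \<in> mgrade M i" for m i
    using c_mgrade[OF N gmod_hom_mgrade[OF k that]] by simp
  fix f m assume f: "f \<in> kern" and m: "m \<in> carrier M"
  have "c N (f \<odot>\<^bsub>omap F N\<^esub> t) = \<rho> f \<odot>\<^bsub>N\<^esub> c N t" if t: "t \<in> carrier (omap F N)" for t
  proof (rule additive_map_eq_on_generators[OF N N.M.abelian_group_axioms _ _ _ t])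
    show "additive_map (omap F N) N (\<lambda>t. c N (f \<odot>\<^bsub>omap F N\<^esub> t))"
      by (rule additive_mapI)
        (use f additive_map_closed[OF ca] additive_map_add[OF ca] FN.smult_closed FN.smult_r_distr in auto)
    show "additive_map (omap F N) N (\<lambda>t. \<rho> f \<odot>\<^bsub>N\<^esub> c N t)"
      by (rule additive_mapI)
        (use f complementaryD(1)[OF \<rho> f] additive_map_closed[OF ca] additive_map_add[OF ca]
          N.smult_closed N.smult_r_distr in auto)
    fix r n assume r: "r \<in> carrier R" and n: "n \<in> carrier N"
    have dr: "d r \<in> kern" using kern_d r .
    have "c N (f \<odot>\<^bsub>omap F N\<^esub> (r \<odot>\<^bsub>omap F N\<^esub> u N n)) = c N ((f \<otimes> r) \<odot>\<^bsub>omap F N\<^esub> u N n)"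
      using f r FN.smult_assoc u_closed[OF N n] by simp
    also have "\<dots> = \<sigma> (s f \<otimes> d r) \<odot>\<^bsub>N\<^esub> n" using c_u[OF N _ n] f r by (simp add: d_kern_left)
    also have "\<sigma> (s f \<otimes> d r) = \<rho> f \<otimes> \<sigma> (d r)"
      using \<rho> f r by (auto simp: complementary_def s_mult s_s)
    also have "(\<rho> f \<otimes> \<sigma> (d r)) \<odot>\<^bsub>N\<^esub> n = \<rho> f \<odot>\<^bsub>N\<^esub> c N (r \<odot>\<^bsub>omap F N\<^esub> u N n)"
      using c_u[OF N r n] complementaryD(1)[OF \<rho> f] complementaryD(2)[OF \<rho> dr] n N.smult_assoc by simp
    finally show "c N (f \<odot>\<^bsub>omap F N\<^esub> (r \<odot>\<^bsub>omap F N\<^esub> u N n)) = \<rho> f \<odot>\<^bsub>N\<^esub> c N (r \<odot>\<^bsub>omap F N\<^esub> u N n)" .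
  qed
  then show "c N (k (f \<odot>\<^bsub>M\<^esub> m)) = \<rho> f \<odot>\<^bsub>N\<^esub> c N (k m)"
    using gmod_hom_smult[OF k kern_carrier[OF f] m] additive_map_closed[OF ka m] by simp
qed

lemma coextend_c:
  assumes k: "k \<in> gmod_hom R M (omap F N)"
  shows "coextend M N (\<lambda>m. c N (k m)) = k"
proof (rule gmod_hom_eqI[OF coextend_hom[OF semilinear_c_hom[OF k]] k])
  note ca = c_additive[OF N] and ua = semilinearD(1)[OF u_semilinear[OF N]]
  have u: "u N (c N t) \<in> carrier (omap F N)" if "t \<in> carrier (omap F N)" for t
    using u_closed[OF N additive_map_closed[OF ca that]] .
  have u_add: "u N (c N (t \<oplus>\<^bsub>omap F N\<^esub> t')) = u N (c N t) \<oplus>\<^bsub>omap F N\<^esub> u N (c N t')"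
    if "t \<in> carrier (omap F N)" "t' \<in> carrier (omap F N)" for t t'
    using that additive_map_add[OF ca] additive_map_add[OF ua] additive_map_closed[OF ca] by simp
  have key: "x \<odot>\<^bsub>omap F N\<^esub> u N (c N t) \<ominus>\<^bsub>omap F N\<^esub> u N (c N (s x \<odot>\<^bsub>omap F N\<^esub> t)) = t"
    if t: "t \<in> carrier (omap F N)" for t
  proof (rule additive_map_eq_on_generators[OF N FN.M.abelian_group_axioms _ _ _ t])
    show "additive_map (omap F N) (omap F N)
      (\<lambda>t. x \<odot>\<^bsub>omap F N\<^esub> u N (c N t) \<ominus>\<^bsub>omap F N\<^esub> u N (c N (s x \<odot>\<^bsub>omap F N\<^esub> t)))"
      by (rule additive_mapI)
        (use u in \<open>auto simp: u_add FN.smult_closed FN.smult_r_distr a_minus_def FN.M.minus_add FN.M.a_ac\<close>)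
    show "additive_map (omap F N) (omap F N) (\<lambda>t. t)" by (rule additive_mapI) auto
    fix r n assume r: "r \<in> carrier R" and n: "n \<in> carrier N"
    let ?w = "u N n" and ?t = "r \<odot>\<^bsub>omap F N\<^esub> u N n"
    have w: "?w \<in> carrier (omap F N)" using u_closed[OF N n] .
    have uc: "u N (c N (g \<odot>\<^bsub>omap F N\<^esub> ?w)) = d g \<odot>\<^bsub>omap F N\<^esub> ?w" if "g \<in> carrier R" for g
      using c_u[OF N that n] smult_u[OF kern_d[OF that] n] by simp
    \<comment> \<open>On the generator \<open>r u(n)\<close> the claim is the expansion \<open>r = x \<partial>(r) - \<partial>(s(x) r)\<close>.\<close>
    have "d (s x \<otimes> r) = x \<otimes> d r \<ominus> r"
      using r by (simp add: d_mult d_s_x s_s l_minus a_minus_def a_comm)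
    then have 1: "u N (c N (s x \<odot>\<^bsub>omap F N\<^esub> ?t)) = (x \<otimes> d r \<ominus> r) \<odot>\<^bsub>omap F N\<^esub> ?w"
      using uc[of "s x \<otimes> r"] r w FN.smult_assoc by simp
    have 2: "x \<odot>\<^bsub>omap F N\<^esub> u N (c N ?t) = (x \<otimes> d r \<ominus> r \<oplus> r) \<odot>\<^bsub>omap F N\<^esub> ?w"
      using uc[OF r] r w by (simp add: FN.smult_assoc a_minus_def a_assoc l_neg)
    show "x \<odot>\<^bsub>omap F N\<^esub> u N (c N ?t) \<ominus>\<^bsub>omap F N\<^esub> u N (c N (s x \<odot>\<^bsub>omap F N\<^esub> ?t)) = ?t"
      unfolding 1 2 using r w FN.smult_closed
      by (subst FN.smult_l_distr) (auto simp: a_minus_def[of "omap F N"] FN.M.a_ac FN.M.r_neg)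
  qed
  fix m assume m: "m \<in> carrier M"
  show "coextend M N (\<lambda>m. c N (k m)) m = k m"
    using key[OF additive_map_closed[OF gmod_hom_additive[OF k] m]] gmod_hom_smult[OF k _ m] m
    by (simp add: coextend_def)
qed

end

end

text \<open>Both sides of the adjunction are identified with the \<open>\<sigma>\<close>-semilinear maps \<open>M \<rightarrow> N\<close> of degree \<open>-1\<close>:
  a linear map \<open>h\<close> on \<open>F(M)\<close> with its restriction along \<open>u\<close>, a linear map \<open>k\<close> to \<open>G(N)\<close> with its
  composite with the trace.\<close>

theorem (in odd_Demazure_ring) twisted_induction_adjoint:
  fixes F G :: "(('a, 'b) gmodule, 'b \<Rightarrow> 'b, ('a, 'b) gmodule, 'b \<Rightarrow> 'b) func"
  assumes "twisted_induction R s d x \<sigma> F u c" "twisted_induction R s d x \<tau> G v e" "complementary \<sigma> \<tau>"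
  shows "adjoint (gmod R) (gmod R) F G"
proof -
  interpret F: twisted_induction R s d x \<sigma> F u c by fact
  interpret G: twisted_induction R s d x \<tau> G v e by fact
  let ?\<Phi> = "\<lambda>M N h. G.coextend M N (\<lambda>m. h (u M m))"
  note \<sigma> = complementaryD(1)[OF assms(3)]
  have sl: "semilinear \<sigma> (- 1) M N (\<lambda>m. h (u M m))"
    if "graded_module R M" "graded_module R N" "h \<in> gmod_hom R (omap F M) N" for M N h
    using F.semilinear_hom_u[OF that] \<sigma> by blast
  have Fmap: "amap F M' M f \<in> gmod_hom R (omap F M') (omap F M)"
    if "graded_module R M'" "graded_module R M" "f \<in> gmod_hom R M' M" for M' M :: "('a, 'b) gmodule" and f
    using is_functor.amap_Hom[OF F.F_functor, of M' M f] that by (simp add: Obj_gmod Hom_gmod)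
  have Gmap: "amap G M' M f \<in> gmod_hom R (omap G M') (omap G M)"
    if "graded_module R M'" "graded_module R M" "f \<in> gmod_hom R M' M" for M' M :: "('a, 'b) gmodule" and f
    using is_functor.amap_Hom[OF G.F_functor, of M' M f] that by (simp add: Obj_gmod Hom_gmod)
  show ?thesis
    unfolding adjoint_def
  proof (intro conjI F.F_functor G.F_functor exI[of _ ?\<Phi>] ballI, unfold Obj_gmod Hom_gmod Comp_gmod)
    fix M N :: "('a, 'b) gmodule" assume M: "graded_module R M" and N: "graded_module R N"
    show "bij_betw (?\<Phi> M N) (gmod_hom R (omap F M) N) (gmod_hom R M (omap G N))"
      unfolding bij_betw_def
    proof (intro conjI inj_onI equalityI subsetI)
      fix h h' assume h: "h \<in> gmod_hom R (omap F M) N" and h': "h' \<in> gmod_hom R (omap F M) N"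
        and eq: "?\<Phi> M N h = ?\<Phi> M N h'"
      show "h = h'"
        by (rule F.hom_eq_on_u[OF M N h h'])
          (metis G.c_coextend[OF M N assms(3) sl[OF M N h]] G.c_coextend[OF M N assms(3) sl[OF M N h']] eq)
    next
      fix k assume "k \<in> ?\<Phi> M N ` gmod_hom R (omap F M) N"
      then show "k \<in> gmod_hom R M (omap G N)"
        using G.coextend_hom[OF M N assms(3) sl[OF M N]] by blast
    next
      fix k assume k: "k \<in> gmod_hom R M (omap G N)"
      obtain h where h: "h \<in> gmod_hom R (omap F M) N" "\<forall>m\<in>carrier M. h (u M m) = e N (k m)"
        using F.u_universal[OF M N G.semilinear_c_hom[OF M N assms(3) k]] by blast
      have "?\<Phi> M N h = G.coextend M N (\<lambda>m. e N (k m))"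
        unfolding G.coextend_def using h(2) graded_module.smult_closed[OF M s_closed[OF x_closed]]
        by (intro restrict_ext) simp
      also have "\<dots> = k" by (rule G.coextend_c[OF M N assms(3) k])
      finally show "k \<in> ?\<Phi> M N ` gmod_hom R (omap F M) N" using h(1) by blast
    qed
  next
    fix M M' N :: "('a, 'b) gmodule" and f h
    assume M: "graded_module R M" and M': "graded_module R M'" and N: "graded_module R N"
    assume f: "f \<in> gmod_hom R M' M" and h: "h \<in> gmod_hom R (omap F M) N"
    have "compose (carrier (omap F M')) h (amap F M' M f) (u M' m) = h (u M (f m))"
      if "m \<in> carrier M'" for m
      using that F.u_natural[OF M' M f that] F.u_closed[OF M' that] by (simp add: compose_eq)
    then show "?\<Phi> M' N (compose (carrier (omap F M')) h (amap F M' M f)) = compose (carrier M') (?\<Phi> M N h) f"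
      unfolding G.coextend_def compose_def
      using graded_module.smult_closed[OF M' s_closed[OF x_closed]] gmod_hom_smult[OF f s_closed[OF x_closed]]
        additive_map_closed[OF gmod_hom_additive[OF f]]
      by (intro restrict_ext) simp
  next
    fix M N N' :: "('a, 'b) gmodule" and g h
    assume M: "graded_module R M" and N: "graded_module R N" and N': "graded_module R N'"
    assume g: "g \<in> gmod_hom R N N'" and h: "h \<in> gmod_hom R (omap F M) N"
    note gm = Gmap[OF N N' g]
    interpret GN: graded_module R "omap G N" by (rule G.F_module[OF N])
    interpret GN': graded_module R "omap G N'" by (rule G.F_module[OF N'])
    note p = additive_map_closed[OF semilinearD(1)[OF sl[OF M N h]]]
    have u: "compose (carrier (omap F M)) g h (u M m) = g (h (u M m))" if "m \<in> carrier M" for m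
      using F.u_closed[OF M that] by (simp add: compose_eq)
    show "?\<Phi> M N' (compose (carrier (omap F M)) g h) = compose (carrier M) (amap G N N' g) (?\<Phi> M N h)"
      unfolding G.coextend_def compose_def[of "carrier M"]
    proof (intro restrict_ext)
      fix m assume m: "m \<in> carrier M"
      have sm: "s x \<odot>\<^bsub>M\<^esub> m \<in> carrier M" using graded_module.smult_closed[OF M _ m] by simp
      show "x \<odot>\<^bsub>omap G N'\<^esub> v N' (compose (carrier (omap F M)) g h (u M m)) \<ominus>\<^bsub>omap G N'\<^esub>
          v N' (compose (carrier (omap F M)) g h (u M (s x \<odot>\<^bsub>M\<^esub> m))) =
        amap G N N' g ((\<lambda>m\<in>carrier M. x \<odot>\<^bsub>omap G N\<^esub> v N (h (u M m)) \<ominus>\<^bsub>omap G N\<^esub>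
          v N (h (u M (s x \<odot>\<^bsub>M\<^esub> m)))) m)"
        using m sm u[OF m] u[OF sm] G.u_natural[OF N N' g p[OF m]] G.u_natural[OF N N' g p[OF sm]]
          G.u_closed[OF N p[OF m]] G.u_closed[OF N p[OF sm]] gmod_hom_smult[OF gm x_closed]
          additive_map_diff[OF GN.M.abelian_group_axioms GN'.M.abelian_group_axioms gmod_hom_additive[OF gm]]
        by (simp add: GN.smult_closed)
    qed
  qed
qed


section \<open>The free algebra\<close>

locale free_algebra = cring K for K :: "('k, 'z) ring_scheme" (structure)
begin

abbreviation A where "A \<equiv> free_alg K"

abbreviation conv where "conv f g w \<equiv> \<Oplus>i\<in>{..length w}. f (take i w) \<otimes> g (drop i w)"

text \<open>The value of a convolution at a word is a finite sum, so its algebraic laws hold for all functions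
  with values in the base ring, and can be proved before finite supports are considered.\<close>

definition vals where "vals = {f :: var list \<Rightarrow> 'k. \<forall>w. f w \<in> carrier K}"

lemma valsI: "(\<And>w. f w \<in> carrier K) \<Longrightarrow> f \<in> vals"
  by (simp add: vals_def)

lemma valsD [simp]: "f \<in> vals \<Longrightarrow> f w \<in> carrier K"
  by (simp add: vals_def)

lemma vals_Cons: "f \<in> vals \<Longrightarrow> (\<lambda>w. f (v # w)) \<in> vals"
  by (auto intro!: valsI)

lemma conv_closed [simp]: "f \<in> vals \<Longrightarrow> g \<in> vals \<Longrightarrow> conv f g w \<in> carrier K"
  by (intro finsum_closed) auto

lemma conv_vals: "f \<in> vals \<Longrightarrow> g \<in> vals \<Longrightarrow> conv f g \<in> vals"
  by (rule valsI) simp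

lemma conv_Nil: "f \<in> vals \<Longrightarrow> g \<in> vals \<Longrightarrow> conv f g [] = f [] \<otimes> g []"
  by simp

text \<open>Splitting off the first letter reduces identities between convolutions to induction on the
  word at which they are evaluated.\<close>

lemma conv_Cons:
  assumes "f \<in> vals" "g \<in> vals"
  shows "conv f g (v # w) = f [] \<otimes> g (v # w) \<oplus> conv (\<lambda>u. f (v # u)) g w"
proof -
  have "conv f g (v # w) = (\<Oplus>i\<in>{..Suc (length w)}. f (take i (v # w)) \<otimes> g (drop i (v # w)))"
    by simp
  also have "\<dots> = conv (\<lambda>u. f (v # u)) g w \<oplus> f [] \<otimes> g (v # w)"
    using assms by (subst finsum_Suc2) auto
  finally show ?thesis using assms vals_Cons by (simp add: a_comm)
qed

lemma conv_add_left:
  assumes "f \<in> vals" "f' \<in> vals" "g \<in> vals"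
  shows "conv (\<lambda>u. f u \<oplus> f' u) g w = conv f g w \<oplus> conv f' g w"
  using assms by (subst finsum_addf[symmetric]) (auto intro!: finsum_cong' simp: l_distr)

lemma conv_add_right:
  assumes "f \<in> vals" "g \<in> vals" "g' \<in> vals"
  shows "conv f (\<lambda>u. g u \<oplus> g' u) w = conv f g w \<oplus> conv f g' w"
  using assms by (subst finsum_addf[symmetric]) (auto intro!: finsum_cong' simp: r_distr)

lemma conv_scale_left:
  assumes "c \<in> carrier K" "f \<in> vals" "g \<in> vals"
  shows "conv (\<lambda>u. c \<otimes> f u) g w = c \<otimes> conv f g w"
  using assms by (subst finsum_rdistr) (auto intro!: finsum_cong' simp: m_assoc)

lemma conv_assoc:
  assumes "f \<in> vals" "g \<in> vals" "h \<in> vals"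
  shows "conv (conv f g) h w = conv f (conv g h) w"
  using assms
proof (induction w arbitrary: f g)
  case Nil
  then show ?case by (simp add: m_assoc)
next
  case (Cons v w)
  let ?f = "\<lambda>u. f (v # u)" and ?g = "\<lambda>u. g (v # u)"
  note vals = Cons.prems vals_Cons[OF Cons.prems(1), of v] vals_Cons[OF Cons.prems(2), of v]
  have scale: "(\<lambda>u. f [] \<otimes> ?g u) \<in> vals" using vals by (auto intro!: valsI)
  have "conv (conv f g) h (v # w) = f [] \<otimes> g [] \<otimes> h (v # w) \<oplus> conv (\<lambda>u. conv f g (v # u)) h w"
    using conv_Cons[OF conv_vals[OF vals(1,2)] vals(3)] conv_Nil[OF vals(1,2)] by simp
  also have "(\<lambda>u. conv f g (v # u)) = (\<lambda>u. f [] \<otimes> ?g u \<oplus> conv ?f g u)"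
    using conv_Cons[OF vals(1,2)] by simp
  also have "conv (\<lambda>u. f [] \<otimes> ?g u \<oplus> conv ?f g u) h w = f [] \<otimes> conv ?g h w \<oplus> conv ?f (conv g h) w"
    using conv_add_left[OF scale conv_vals[OF vals(4,2)] vals(3)] conv_scale_left[OF _ vals(5,3)] vals(1)
      Cons.IH[OF vals(4,2,3)] by simp
  also have "f [] \<otimes> g [] \<otimes> h (v # w) \<oplus> (f [] \<otimes> conv ?g h w \<oplus> conv ?f (conv g h) w) =
    f [] \<otimes> (g [] \<otimes> h (v # w) \<oplus> conv ?g h w) \<oplus> conv ?f (conv g h) w"
    using vals conv_closed[OF vals(5,3)] conv_closed[OF vals(4) conv_vals[OF vals(2,3)]]
    by (simp add: r_distr m_assoc a_assoc)
  also have "\<dots> = conv f (conv g h) (v # w)"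
    using conv_Cons[OF vals(1) conv_vals[OF vals(2,3)]] conv_Cons[OF vals(2,3)] by simp
  finally show ?case .
qed

lemma conv_nonzero:
  assumes "f \<in> vals" "g \<in> vals" "conv f g w \<noteq> \<zero>"
  shows "\<exists>i\<le>length w. f (take i w) \<noteq> \<zero> \<and> g (drop i w) \<noteq> \<zero>"
proof (rule ccontr)
  assume "\<not> ?thesis"
  then have "conv f g w = (\<Oplus>i\<in>{..length w}. \<zero>)" using assms(1,2) by (intro finsum_cong') auto
  then show False using assms(3) by (simp add: finsum_zero)
qed

lemma carrier_A: "f \<in> carrier A \<longleftrightarrow> f \<in> vals \<and> finite {w. f w \<noteq> \<zero>}"
  by (auto simp: free_alg_def vals_def simp del: valsD)

lemma A_simps:
  "f \<oplus>\<^bsub>A\<^esub> g = (\<lambda>w. f w \<oplus> g w)" "f \<otimes>\<^bsub>A\<^esub> g = conv f g" "\<zero>\<^bsub>A\<^esub> = (\<lambda>w. \<zero>)"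
  "\<one>\<^bsub>A\<^esub> = (\<lambda>w. if w = [] then \<one> else \<zero>)"
  by (simp_all add: free_alg_def)

lemma A_add_closed:
  assumes "f \<in> carrier A" "g \<in> carrier A"
  shows "f \<oplus>\<^bsub>A\<^esub> g \<in> carrier A"
proof -
  have "{w. f w \<oplus> g w \<noteq> \<zero>} \<subseteq> {w. f w \<noteq> \<zero>} \<union> {w. g w \<noteq> \<zero>}" by auto
  then show ?thesis using assms finite_subset by (auto simp: carrier_A A_simps intro!: valsI)
qed

lemma A_mult_closed:
  assumes "f \<in> carrier A" "g \<in> carrier A"
  shows "f \<otimes>\<^bsub>A\<^esub> g \<in> carrier A"
proof -
  have "{w. conv f g w \<noteq> \<zero>} \<subseteq> (\<lambda>(u, v). u @ v) ` ({w. f w \<noteq> \<zero>} \<times> {w. g w \<noteq> \<zero>})"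
  proof
    fix w assume "w \<in> {w. conv f g w \<noteq> \<zero>}"
    then obtain i where "f (take i w) \<noteq> \<zero>" "g (drop i w) \<noteq> \<zero>"
      using conv_nonzero[of f g w] assms unfolding carrier_A by blast
    then show "w \<in> (\<lambda>(u, v). u @ v) ` ({w. f w \<noteq> \<zero>} \<times> {w. g w \<noteq> \<zero>})"
      by (intro image_eqI[of _ _ "(take i w, drop i w)"]) auto
  qed
  then show ?thesis
    using assms conv_vals by (auto simp: carrier_A A_simps intro: finite_subset)
qed

lemma one_vals: "(\<lambda>w. if w = [] then \<one> else \<zero>) \<in> vals"
  by (auto intro!: valsI)

lemma conv_one_left: "f \<in> vals \<Longrightarrow> conv (\<lambda>w. if w = [] then \<one> else \<zero>) f w = f w"
proof (cases w)
  case (Cons v u)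
  assume f: "f \<in> vals"
  have "conv (\<lambda>w. \<zero>) f u = \<zero>" using f by (simp add: finsum_zero)
  then show ?thesis using conv_Cons[OF one_vals f, of v u] f Cons by simp
qed simp

lemma conv_one_right: "f \<in> vals \<Longrightarrow> conv f (\<lambda>w. if w = [] then \<one> else \<zero>) w = f w"
proof (induction w arbitrary: f)
  case (Cons v w)
  then show ?case using conv_Cons[OF Cons.prems one_vals, of v w] Cons.IH[OF vals_Cons[OF Cons.prems]] by simp
qed simp

lemma ring_A: "ring A"
proof (rule ringI)
  show "abelian_group A"
  proof (rule abelian_groupI)
    show "\<exists>g\<in>carrier A. g \<oplus>\<^bsub>A\<^esub> f = \<zero>\<^bsub>A\<^esub>" if f: "f \<in> carrier A" for f
    proof (rule bexI[of _ "\<lambda>w. \<ominus> f w"])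
      have "{w. \<ominus> f w \<noteq> \<zero>} \<subseteq> {w. f w \<noteq> \<zero>}" by auto
      then show "(\<lambda>w. \<ominus> f w) \<in> carrier A" using f finite_subset by (auto simp: carrier_A intro!: valsI)
    qed (use f in \<open>auto simp: A_simps carrier_A l_neg\<close>)
  qed (auto simp: A_add_closed, auto simp: A_simps carrier_A a_ac intro!: valsI)
  show "monoid A"
  proof (rule monoidI)
    show "\<one>\<^bsub>A\<^esub> \<in> carrier A" by (auto simp: carrier_A A_simps intro!: valsI)
    show "f \<otimes>\<^bsub>A\<^esub> g \<otimes>\<^bsub>A\<^esub> h = f \<otimes>\<^bsub>A\<^esub> (g \<otimes>\<^bsub>A\<^esub> h)"
      if "f \<in> carrier A" "g \<in> carrier A" "h \<in> carrier A" for f g h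
      unfolding A_simps using conv_assoc[of f g h] that by (intro ext) (auto simp only: carrier_A)
    show "\<one>\<^bsub>A\<^esub> \<otimes>\<^bsub>A\<^esub> f = f" "f \<otimes>\<^bsub>A\<^esub> \<one>\<^bsub>A\<^esub> = f" if "f \<in> carrier A" for f
      unfolding A_simps using conv_one_left[of f] conv_one_right[of f] that
      by (intro ext; simp only: carrier_A)+
  qed (rule A_mult_closed)
qed (auto simp: A_simps carrier_A conv_add_left conv_add_right)

sublocale A: ring A by (rule ring_A)

definition monomial :: "'k \<Rightarrow> var list \<Rightarrow> var list \<Rightarrow> 'k"
  where "monomial c w = (\<lambda>u. if u = w then c else \<zero>)"

lemma monomial_closed: "c \<in> carrier K \<Longrightarrow> monomial c w \<in> carrier A"
  by (auto simp: carrier_A monomial_def intro!: valsI)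

lemma monomial_Nil: "monomial c [] = free_const K c"
  by (simp add: monomial_def free_const_def)

lemma free_var_monomial: "free_var K v = monomial \<one> [v]"
  by (simp add: monomial_def free_var_def)

lemma monomial_Cons:
  assumes "c \<in> carrier K"
  shows "free_var K v \<otimes>\<^bsub>A\<^esub> monomial c w = monomial c (v # w)"
proof -
  have vals: "monomial c w \<in> vals" "free_var K v \<in> vals" "(\<lambda>w. \<zero>) \<in> vals"
    using assms by (auto simp: monomial_def free_var_def intro!: valsI)
  have "conv (free_var K v) (monomial c w) u = monomial c (v # w) u" for u
  proof (cases u)
    case Nil
    then show ?thesis using assms by (simp add: monomial_def free_var_def)
  next
    case (Cons v' u')
    have "conv (\<lambda>u. free_var K v (v' # u)) (monomial c w) u' = monomial c (v # w) u"
    proof (cases "v' = v")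
      case True
      have "conv (\<lambda>u. free_var K v (v' # u)) (monomial c w) u' =
          conv (\<lambda>w. if w = [] then \<one> else \<zero>) (monomial c w) u'"
        using vals True by (intro finsum_cong') (auto simp: free_var_def)
      also have "\<dots> = monomial c w u'" by (rule conv_one_left[OF vals(1)])
      finally show ?thesis using True Cons by (simp add: monomial_def)
    next
      case False
      have "conv (\<lambda>u. free_var K v (v' # u)) (monomial c w) u' = (\<Oplus>i\<in>{..length u'}. \<zero>)"
        using vals False by (intro finsum_cong') (auto simp: free_var_def)
      then show ?thesis using False Cons by (simp add: monomial_def finsum_zero)
    qed
    then show ?thesis using conv_Cons[OF vals(2,1), of v' u'] vals Cons assms
      by (simp add: free_var_def[of _ v] monomial_def)
  qed
  then show ?thesis by (auto simp: A_simps)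
qed

text \<open>The set \<open>X\<close> restricts the supports, so that the same induction serves for the homogeneous elements
  of a given degree.\<close>

lemma free_alg_support_induct [consumes 2, case_names zero monomial add]:
  assumes "f \<in> carrier A" "\<And>w. f w \<noteq> \<zero> \<Longrightarrow> w \<in> X"
    and "Q \<zero>\<^bsub>A\<^esub>" "\<And>c w. c \<in> carrier K \<Longrightarrow> w \<in> X \<Longrightarrow> Q (monomial c w)"
    and "\<And>f g. \<lbrakk>f \<in> carrier A; g \<in> carrier A; Q f; Q g\<rbrakk> \<Longrightarrow> Q (f \<oplus>\<^bsub>A\<^esub> g)"
  shows "Q f"
proof -
  have "Q f" if "finite U" "U \<subseteq> X" "f \<in> carrier A" "{w. f w \<noteq> \<zero>} \<subseteq> U" for U f
    using that
  proof (induction U arbitrary: f rule: finite_induct)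
    case empty
    then have "f = \<zero>\<^bsub>A\<^esub>" by (auto simp: A_simps)
    then show ?case using assms(3) by simp
  next
    case (insert w U)
    let ?g = "f(w := \<zero>)"
    have c: "f w \<in> carrier K" using insert.prems by (simp add: carrier_A)
    have "finite {u. ?g u \<noteq> \<zero>}"
      by (rule finite_subset[of _ "{u. f u \<noteq> \<zero>}"]) (use insert.prems in \<open>auto simp: carrier_A\<close>)
    then have g: "?g \<in> carrier A"
      using insert.prems unfolding carrier_A by (auto intro!: valsI)
    have "Q ?g" by (rule insert.IH[OF _ g]) (use insert.prems in auto)
    then have "Q (monomial (f w) w \<oplus>\<^bsub>A\<^esub> ?g)"
      by (intro assms(5) monomial_closed c g assms(4)) (use insert.prems(1) in auto)
    moreover have "f = monomial (f w) w \<oplus>\<^bsub>A\<^esub> ?g"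
      using insert.prems by (auto simp: A_simps monomial_def carrier_A)
    ultimately show ?case by metis
  qed
  then show ?thesis using assms(1)[unfolded carrier_A] assms(1,2) by auto
qed

lemmas free_alg_induct [consumes 1, case_names zero monomial add] =
  free_alg_support_induct[where X = UNIV, OF _ UNIV_I]

text \<open>The grading, with the letters in degree 2.\<close>

definition homog :: "int \<Rightarrow> (var list \<Rightarrow> 'k) set"
  where "homog i = {f \<in> carrier A. \<forall>w. f w \<noteq> \<zero> \<longrightarrow> i = 2 * int (length w)}"

definition component :: "int \<Rightarrow> (var list \<Rightarrow> 'k) \<Rightarrow> var list \<Rightarrow> 'k"
  where "component i f = (\<lambda>w. if i = 2 * int (length w) then f w else \<zero>)"

lemma homog_carrier: "f \<in> homog i \<Longrightarrow> f \<in> carrier A"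
  by (simp add: homog_def)

lemma comp_homog: "f \<in> carrier A \<Longrightarrow> component i f \<in> homog i"
  by (auto simp: homog_def component_def carrier_A intro!: valsI elim: rev_finite_subset)

lemma comp_closed: "f \<in> carrier A \<Longrightarrow> component i f \<in> carrier A"
  using comp_homog homog_carrier by blast

lemma comp_of_homog: "f \<in> homog j \<Longrightarrow> component i f = (if i = j then f else \<zero>\<^bsub>A\<^esub>)"
  by (force simp: homog_def component_def A_simps fun_eq_iff)

lemma comp_add: "f \<in> carrier A \<Longrightarrow> g \<in> carrier A \<Longrightarrow> component i (f \<oplus>\<^bsub>A\<^esub> g) = component i f \<oplus>\<^bsub>A\<^esub> component i g"
  by (auto simp: component_def A_simps carrier_A)

lemma comp_zero: "component i \<zero>\<^bsub>A\<^esub> = \<zero>\<^bsub>A\<^esub>"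
  by (simp add: component_def A_simps)

lemma comp_minus: "f \<in> carrier A \<Longrightarrow> component i (\<ominus>\<^bsub>A\<^esub> f) = \<ominus>\<^bsub>A\<^esub> component i f"
  by (rule additive_map_minus[OF A.abelian_group_axioms A.abelian_group_axioms additive_mapI])
    (auto simp: comp_closed comp_add)

lemma monomial_homog: "c \<in> carrier K \<Longrightarrow> monomial c w \<in> homog (2 * int (length w))"
  using monomial_closed by (auto simp: homog_def monomial_def)

lemma homog_mult: "f \<in> homog i \<Longrightarrow> g \<in> homog j \<Longrightarrow> f \<otimes>\<^bsub>A\<^esub> g \<in> homog (i + j)"
proof -
  assume fg: "f \<in> homog i" "g \<in> homog j"
  have "i + j = 2 * int (length w)" if nz: "conv f g w \<noteq> \<zero>" for w
  proof -
    obtain k where "k \<le> length w" "f (take k w) \<noteq> \<zero>" "g (drop k w) \<noteq> \<zero>"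
      using conv_nonzero[OF _ _ nz] fg by (auto simp: homog_def carrier_A)
    then have "i = 2 * int (length (take k w))" "j = 2 * int (length (drop k w))"
      using fg by (auto simp: homog_def)
    moreover have "length (take k w) + length (drop k w) = length w"
      by (metis append_take_drop_id length_append)
    ultimately show ?thesis by (simp only: flip: of_nat_add distrib_left)
  qed
  then show ?thesis using fg A_mult_closed by (auto simp: homog_def A_simps)
qed

lemma comp_mult_left:
  assumes "f \<in> homog i" "g \<in> carrier A"
  shows "component j (f \<otimes>\<^bsub>A\<^esub> g) = f \<otimes>\<^bsub>A\<^esub> component (j - i) g"
proof -
  have v: "f \<in> vals" "g \<in> vals" "component (j - i) g \<in> vals"
    using assms comp_closed[OF assms(2)] by (auto simp: homog_def carrier_A)
  have "(if j = 2 * int (length w) then conv f g w else \<zero>) = conv f (component (j - i) g) w" for w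
  proof -
    have t: "f (take k w) \<otimes> component (j - i) g (drop k w) =
        (if j = 2 * int (length w) then f (take k w) \<otimes> g (drop k w) else \<zero>)"
      if "k \<le> length w" for k
    proof (cases "f (take k w) = \<zero>")
      case False
      then have "i = 2 * int k" using assms(1) that by (auto simp: homog_def)
      then show ?thesis using v that by (auto simp: component_def)
    qed (use v in auto)
    have "conv f (component (j - i) g) w =
        (\<Oplus>k\<in>{..length w}. if j = 2 * int (length w) then f (take k w) \<otimes> g (drop k w) else \<zero>)"
      by (rule finsum_cong') (use v t in auto)
    then show ?thesis by (auto simp: finsum_zero)
  qed
  then show ?thesis by (auto simp: A_simps component_def[of j])
qed

lemma comp_mult_right:
  assumes "f \<in> carrier A" "g \<in> homog i"
  shows "component j (f \<otimes>\<^bsub>A\<^esub> g) = component (j - i) f \<otimes>\<^bsub>A\<^esub> g"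
proof -
  have v: "f \<in> vals" "g \<in> vals" "component (j - i) f \<in> vals"
    using assms comp_closed[OF assms(1)] by (auto simp: homog_def carrier_A)
  have "(if j = 2 * int (length w) then conv f g w else \<zero>) = conv (component (j - i) f) g w" for w
  proof -
    have t: "component (j - i) f (take k w) \<otimes> g (drop k w) =
        (if j = 2 * int (length w) then f (take k w) \<otimes> g (drop k w) else \<zero>)"
      if "k \<le> length w" for k
    proof (cases "g (drop k w) = \<zero>")
      case False
      then have "i = 2 * int (length w - k)" using assms(2) by (auto simp: homog_def)
      then show ?thesis using v that by (auto simp: component_def of_nat_diff)
    qed (use v in auto)
    have "conv (component (j - i) f) g w =
        (\<Oplus>k\<in>{..length w}. if j = 2 * int (length w) then f (take k w) \<otimes> g (drop k w) else \<zero>)"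
      by (rule finsum_cong') (use v t in auto)
    then show ?thesis by (auto simp: finsum_zero)
  qed
  then show ?thesis by (auto simp: A_simps component_def[of j])
qed


section \<open>The odd polynomial ring\<close>

abbreviation I where "I \<equiv> odd_ideal K"
abbreviation R where "R \<equiv> odd_ring K"

definition odd_relator where
  "odd_relator = free_var K X1 \<otimes>\<^bsub>A\<^esub> free_var K X2 \<oplus>\<^bsub>A\<^esub> free_var K X2 \<otimes>\<^bsub>A\<^esub> free_var K X1"

lemma free_var_homog: "free_var K v \<in> homog 2"
  using monomial_homog[OF one_closed, of "[v]"] by (simp add: free_var_monomial)

lemma free_var_closed: "free_var K v \<in> carrier A"
  using free_var_homog homog_carrier by blast

lemma homog_add: "f \<in> homog i \<Longrightarrow> g \<in> homog i \<Longrightarrow> f \<oplus>\<^bsub>A\<^esub> g \<in> homog i"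
  using A_add_closed by (auto simp: homog_def A_simps) (metis l_zero zero_closed)

lemma odd_relator_homog: "odd_relator \<in> homog 4"
  using homog_add[OF homog_mult[OF free_var_homog free_var_homog] homog_mult[OF free_var_homog free_var_homog]]
  by (simp add: odd_relator_def)

lemma odd_ideal_eq: "I = Idl\<^bsub>A\<^esub> {odd_relator}"
  by (simp add: odd_ideal_def odd_relator_def)

sublocale I: ideal "odd_ideal K" A
  unfolding odd_ideal_eq using A.genideal_ideal homog_carrier[OF odd_relator_homog] by simp

text \<open>The components of elements of the ideal lie in the ideal, since it has a homogeneous generator:
  the elements with this property form an ideal.\<close>

lemma comp_odd_ideal:
  assumes "f \<in> I"
  shows "component i f \<in> I"
proof -
  let ?J = "{f \<in> carrier A. \<forall>i. component i f \<in> I}"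
  have "ideal ?J A"
  proof (rule idealI[OF A.ring_axioms])
    show "subgroup ?J (add_monoid A)"
    proof (rule A.add.subgroupI)
      show "?J \<noteq> {}"
        using I.zero_closed comp_of_homog[of "\<zero>\<^bsub>A\<^esub>" 0] A.zero_closed
        by (auto simp: component_def A_simps intro!: exI[of _ "\<lambda>w. \<zero>"])
      show "\<ominus>\<^bsub>A\<^esub> f \<in> ?J" if "f \<in> ?J" for f
        using that by (simp add: comp_minus)
    qed (auto simp: comp_add)
    show "g \<otimes>\<^bsub>A\<^esub> f \<in> ?J" if f: "f \<in> ?J" and g: "g \<in> carrier A" for f g
    proof -
      have fA: "f \<in> carrier A" using f by simp
      have "\<forall>i. component i (g \<otimes>\<^bsub>A\<^esub> f) \<in> I"
        using g
      proof (induction g rule: free_alg_induct)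
        case zero
        show ?case using fA I.zero_closed by (simp add: comp_zero)
      next
        case (monomial c w)
        then show ?case
          using comp_mult_left[OF monomial_homog fA] I.I_l_closed f monomial_closed by simp
      next
        case (add g h)
        then show ?case using fA A.l_distr I.a_closed by (simp add: comp_add)
      qed
      then show ?thesis using f g by simp
    qed
    show "f \<otimes>\<^bsub>A\<^esub> g \<in> ?J" if f: "f \<in> ?J" and g: "g \<in> carrier A" for f g
    proof -
      have fA: "f \<in> carrier A" using f by simp
      have "\<forall>i. component i (f \<otimes>\<^bsub>A\<^esub> g) \<in> I"
        using g
      proof (induction g rule: free_alg_induct)
        case zero
        show ?case using fA I.zero_closed by (simp add: comp_zero)
      next
        case (monomial c w)
        then show ?case
          using comp_mult_right[OF fA monomial_homog] I.I_r_closed f monomial_closed by simp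
      next
        case (add g h)
        then show ?case using fA A.r_distr I.a_closed by (simp add: comp_add)
      qed
      then show ?thesis using f g by simp
    qed
  qed
  moreover have "{odd_relator} \<subseteq> ?J"
  proof -
    have "odd_relator \<in> I"
      unfolding odd_ideal_eq using A.genideal_self' homog_carrier[OF odd_relator_homog] by blast
    then show ?thesis
      using homog_carrier[OF odd_relator_homog] I.zero_closed by (simp add: comp_of_homog[OF odd_relator_homog])
  qed
  ultimately have "I \<subseteq> ?J" unfolding odd_ideal_eq by (rule A.genideal_minimal)
  then show ?thesis using assms by blast
qed

abbreviation cls where "cls \<equiv> odd_class K"

lemma R_simps:
  "carrier R = cls ` carrier A" "\<zero>\<^bsub>R\<^esub> = cls \<zero>\<^bsub>A\<^esub>" "\<one>\<^bsub>R\<^esub> = cls \<one>\<^bsub>A\<^esub>"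
  "rgrade R i = cls ` homog i"
  using A.a_rcos_zero[OF I.ideal_axioms I.zero_closed]
  by (auto simp: odd_ring_def Let_def FactRing_def A_RCOSETS_def' odd_class_def homog_def)

lemma cls_add: "f \<in> carrier A \<Longrightarrow> g \<in> carrier A \<Longrightarrow> cls f \<oplus>\<^bsub>R\<^esub> cls g = cls (f \<oplus>\<^bsub>A\<^esub> g)"
  by (simp add: odd_ring_def Let_def FactRing_simps odd_class_def I.a_rcos_sum)

lemma cls_mult: "f \<in> carrier A \<Longrightarrow> g \<in> carrier A \<Longrightarrow> cls f \<otimes>\<^bsub>R\<^esub> cls g = cls (f \<otimes>\<^bsub>A\<^esub> g)"
  by (simp add: odd_ring_def Let_def FactRing_simps odd_class_def I.rcoset_mult_add)

lemma cls_eq_iff: "f \<in> carrier A \<Longrightarrow> g \<in> carrier A \<Longrightarrow> cls f = cls g \<longleftrightarrow> f \<ominus>\<^bsub>A\<^esub> g \<in> I"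
  using A.quotient_eq_iff_same_a_r_cos[OF I.ideal_axioms] by (simp add: odd_class_def)

lemma cls_closed: "f \<in> carrier A \<Longrightarrow> cls f \<in> carrier R"
  by (simp add: R_simps)

lemma ring_R: "ring R"
proof (rule ringI)
  show "abelian_group R"
  proof (rule abelian_groupI)
    show "\<exists>y\<in>carrier R. y \<oplus>\<^bsub>R\<^esub> x = \<zero>\<^bsub>R\<^esub>" if "x \<in> carrier R" for x
      using that by (auto simp: R_simps cls_add A.l_neg intro!: bexI[of _ "\<ominus>\<^bsub>A\<^esub> _"])
  qed (auto simp: R_simps cls_add A.a_ac)
  show "monoid R"
    by (rule monoidI) (auto simp: R_simps cls_mult A.m_assoc)
qed (auto simp: R_simps cls_add cls_mult A.l_distr A.r_distr)

sublocale R: ring "odd_ring K" by (rule ring_R)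

lemma additive_cls: "additive_map A R cls"
  by (rule additive_mapI) (auto simp: cls_closed cls_add)

text \<open>The projection of the quotient to degree \<open>i\<close>. It does not depend on the representative, because
  the ideal contains the components of its elements.\<close>

definition rpart :: "'k odd_poly \<Rightarrow> int \<Rightarrow> 'k odd_poly"
  where "rpart X i = cls (component i (SOME f. f \<in> carrier A \<and> cls f = X))"

lemma rpart_cls:
  assumes "f \<in> carrier A"
  shows "rpart (cls f) i = cls (component i f)"
proof -
  define g where "g = (SOME g. g \<in> carrier A \<and> cls g = cls f)"
  have g: "g \<in> carrier A \<and> cls g = cls f"
    unfolding g_def by (rule someI[of _ f]) (use assms in simp)
  then have "g \<ominus>\<^bsub>A\<^esub> f \<in> I" using cls_eq_iff assms by blast
  then have "component i g \<ominus>\<^bsub>A\<^esub> component i f \<in> I"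
    using comp_odd_ideal[of "g \<ominus>\<^bsub>A\<^esub> f" i] g assms by (simp add: a_minus_def comp_add comp_minus)
  then show ?thesis
    using cls_eq_iff comp_closed g assms unfolding rpart_def g_def by blast
qed

lemma graded_ring_R: "graded_ring R"
proof (intro graded_ring.intro graded_ring_axioms.intro ring_R)
  note grp = R.abelian_group_axioms
  have rpart_add: "additive_map R R (\<lambda>X. rpart X i)" for i
    by (rule additive_mapI) (auto simp: R_simps rpart_cls cls_add comp_closed comp_add)
  have proj: "rpart X i = (if i = j then X else \<zero>\<^bsub>R\<^esub>)" if "X \<in> rgrade R j" for X i j
    using that homog_carrier by (auto simp: R_simps rpart_cls comp_of_homog)
  show "graded_by R (rgrade R)"
  proof (rule graded_byI[OF grp _ rpart_add _ proj])
    show "additive_subgroup (rgrade R i) R" for i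
    proof (rule additive_subgroupI, rule R.add.subgroupI)
      show "rgrade R i \<subseteq> carrier R" using homog_carrier by (auto simp: R_simps)
      show "rgrade R i \<noteq> {}" using A.zero_closed by (auto simp: R_simps homog_def A_simps)
      show "X \<oplus>\<^bsub>R\<^esub> Y \<in> rgrade R i" if "X \<in> rgrade R i" "Y \<in> rgrade R i" for X Y
        using that homog_carrier homog_add by (auto simp: R_simps cls_add)
      show "\<ominus>\<^bsub>R\<^esub> X \<in> rgrade R i" if X: "X \<in> rgrade R i" for X
      proof -
        obtain f where f: "f \<in> homog i" "X = cls f" using X by (auto simp: R_simps)
        have "\<ominus>\<^bsub>A\<^esub> f = component i (\<ominus>\<^bsub>A\<^esub> f)"
          using f comp_minus[OF homog_carrier[OF f(1)]] comp_of_homog[OF f(1)] by simp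
        then have "\<ominus>\<^bsub>A\<^esub> f \<in> homog i" using comp_homog[of "\<ominus>\<^bsub>A\<^esub> f" i] homog_carrier[OF f(1)] by simp
        moreover have "\<ominus>\<^bsub>R\<^esub> X = cls (\<ominus>\<^bsub>A\<^esub> f)"
          using additive_map_minus[OF A.abelian_group_axioms grp additive_cls homog_carrier[OF f(1)]] f by simp
        ultimately show ?thesis by (simp add: R_simps)
      qed
    qed
    show "rpart X i \<in> rgrade R i" if "X \<in> carrier R" for X i
      using that comp_homog by (auto simp: R_simps rpart_cls)
    show "\<exists>B. finite B \<and> (\<forall>i. i \<notin> B \<longrightarrow> rpart X i = \<zero>\<^bsub>R\<^esub>) \<and> X = (\<Oplus>\<^bsub>R\<^esub>i\<in>B. rpart X i)"
      if X: "X \<in> carrier R" for X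
    proof -
      obtain f where f: "f \<in> carrier A" "X = cls f" using X by (auto simp: R_simps)
      from f(1) have "\<exists>B. finite B \<and> (\<forall>i. i \<notin> B \<longrightarrow> rpart (cls f) i = \<zero>\<^bsub>R\<^esub>) \<and>
        cls f = (\<Oplus>\<^bsub>R\<^esub>i\<in>B. rpart (cls f) i)"
      proof (induction f rule: free_alg_induct)
        case zero
        have "rpart (cls \<zero>\<^bsub>A\<^esub>) i = \<zero>\<^bsub>R\<^esub>" for i
          using rpart_cls[OF A.zero_closed] by (simp add: comp_zero R_simps)
        then show ?case by (intro exI[of _ "{}"]) (simp add: R_simps)
      next
        case (monomial c w)
        show ?case
          by (rule sum_of_parts_homog[where \<pi> = rpart and j = "2 * int (length w)", OF grp _ proj])
            (use monomial_homog[OF monomial(1)] homog_carrier in \<open>auto simp: R_simps\<close>)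
      next
        case (add f g)
        then show ?case
          using sum_of_parts_add[where \<pi> = rpart, OF grp rpart_add, of "cls f" "cls g"]
          by (simp add: cls_add cls_closed)
      qed
      then show ?thesis using f by simp
    qed
  qed
  have "\<one>\<^bsub>A\<^esub> \<in> homog 0" using A.one_closed by (auto simp: homog_def A_simps)
  then show "\<one>\<^bsub>R\<^esub> \<in> rgrade R 0" by (simp add: R_simps)
  show "X \<otimes>\<^bsub>R\<^esub> Y \<in> rgrade R (i + j)" if "X \<in> rgrade R i" "Y \<in> rgrade R j" for X Y i j
    using that homog_mult homog_carrier by (auto simp: R_simps cls_mult)
qed

sublocale GR: graded_group "odd_ring K" "rgrade (odd_ring K)"
  by (rule graded_ring.graded_group_ring[OF graded_ring_R])

abbreviation k where "k c \<equiv> cls (free_const K c)"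
abbreviation x where "x v \<equiv> odd_x K v"

lemma k_closed: "c \<in> carrier K \<Longrightarrow> k c \<in> rgrade R 0"
  using monomial_homog[of c "[]"] by (simp add: monomial_Nil R_simps)

lemma x_closed: "x v \<in> rgrade R 2"
  using free_var_homog by (simp add: R_simps)

lemma rgrade_induct [consumes 1, case_names const var add]:
  assumes "X \<in> rgrade R i"
    and const: "\<And>c. c \<in> carrier K \<Longrightarrow> Q 0 (k c)"
    and var: "\<And>v j X. \<lbrakk>X \<in> rgrade R j; Q j X\<rbrakk> \<Longrightarrow> Q (j + 2) (x v \<otimes>\<^bsub>R\<^esub> X)"
    and add: "\<And>j X Y. \<lbrakk>X \<in> rgrade R j; Y \<in> rgrade R j; Q j X; Q j Y\<rbrakk> \<Longrightarrow> Q j (X \<oplus>\<^bsub>R\<^esub> Y)"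
    and zero: "\<And>j. Q j \<zero>\<^bsub>R\<^esub>"
  shows "Q i X"
proof -
  have mono: "Q (2 * int (length w)) (cls (monomial c w))" if c: "c \<in> carrier K" for c and w :: "var list"
  proof (induction w)
    case Nil
    then show ?case using const[OF c] by (simp add: monomial_Nil)
  next
    case (Cons v w)
    have "cls (monomial c w) \<in> rgrade R (2 * int (length w))"
      using monomial_homog[OF c] by (simp add: R_simps)
    from var[OF this Cons, of v] show ?case
      using c by (simp add: cls_mult free_var_closed monomial_closed monomial_Cons add.commute)
  qed
  obtain f where f: "f \<in> homog i" "X = cls f" using assms(1) by (auto simp: R_simps)
  have "cls f \<in> rgrade R i \<and> Q i (cls f)"
  proof (rule free_alg_support_induct[where X = "{w. i = 2 * int (length w)}"])
    show "f \<in> carrier A" using f homog_carrier by blast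
    show "cls \<zero>\<^bsub>A\<^esub> \<in> rgrade R i \<and> Q i (cls \<zero>\<^bsub>A\<^esub>)"
      using zero GR.piece_zero by (simp add: R_simps)
  next
    fix c and w :: "var list" assume "c \<in> carrier K" "w \<in> {w. i = 2 * int (length w)}"
    then show "cls (monomial c w) \<in> rgrade R i \<and> Q i (cls (monomial c w))"
      using mono[of c w] monomial_homog[of c w] by (simp add: R_simps)
  next
    fix f g assume "f \<in> carrier A" "g \<in> carrier A" "cls f \<in> rgrade R i \<and> Q i (cls f)"
      "cls g \<in> rgrade R i \<and> Q i (cls g)"
    then show "cls (f \<oplus>\<^bsub>A\<^esub> g) \<in> rgrade R i \<and> Q i (cls (f \<oplus>\<^bsub>A\<^esub> g))"
      using add[of "cls f" i "cls g"] GR.piece_add[of "cls f" i "cls g"] by (simp add: cls_add)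
  qed (use f in \<open>auto simp: homog_def\<close>)
  then show ?thesis using f by simp
qed

lemma R_induct [consumes 1, case_names const var add]:
  assumes "X \<in> carrier R"
    and const: "\<And>c. c \<in> carrier K \<Longrightarrow> Q (k c)"
    and var: "\<And>v X. \<lbrakk>X \<in> carrier R; Q X\<rbrakk> \<Longrightarrow> Q (x v \<otimes>\<^bsub>R\<^esub> X)"
    and add: "\<And>X Y. \<lbrakk>X \<in> carrier R; Y \<in> carrier R; Q X; Q Y\<rbrakk> \<Longrightarrow> Q (X \<oplus>\<^bsub>R\<^esub> Y)"
  shows "Q X"
  using assms(1)
proof (induction X rule: GR.homogeneous_induct)
  case (homogeneous i X)
  have "k \<zero> = \<zero>\<^bsub>R\<^esub>" by (simp add: R_simps A_simps free_const_def)
  then have "Q \<zero>\<^bsub>R\<^esub>" using const[OF zero_closed] by simp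
  then show ?case
    by (intro rgrade_induct[where Q = "\<lambda>_. Q", OF homogeneous]) (auto intro: const var add GR.piece_carrier)
qed (rule add)

end

text \<open>Each identity for \<open>s\<close> and \<open>\<partial>\<close>, and each statement about their degrees, holds for constants by
  linearity and passes from \<open>f\<close> to \<open>x\<^sub>v f\<close> by multiplicativity of \<open>s\<close> and the Leibniz rule for \<open>\<partial>\<close>.\<close>

lemma odd_ring_Demazure:
  assumes "cring K" "is_odd_swap K s" "is_odd_Demazure K s d"
  shows "odd_Demazure_ring (odd_ring K) s d (odd_x K X1)"
proof -
  interpret free_algebra K by (intro free_algebra.intro assms(1))
  note grp = R.abelian_group_axioms
  have kl: "k_linear K s" and iso: "s \<in> ring_iso R R"
    and sx: "s (x X1) = \<ominus>\<^bsub>R\<^esub> x X2" "s (x X2) = \<ominus>\<^bsub>R\<^esub> x X1"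
    using assms(2) by (auto simp: is_odd_swap_def Let_def)
  have dl: "k_linear K d" and d1: "d \<one>\<^bsub>R\<^esub> = \<zero>\<^bsub>R\<^esub>" and dx: "d (x v) = \<one>\<^bsub>R\<^esub>" for v
    using assms(3) by (cases v; auto simp: is_odd_Demazure_def Let_def)+
  have d_mult: "d (f \<otimes>\<^bsub>R\<^esub> g) = d f \<otimes>\<^bsub>R\<^esub> g \<oplus>\<^bsub>R\<^esub> s f \<otimes>\<^bsub>R\<^esub> d g" if "f \<in> carrier R" "g \<in> carrier R" for f g
    using assms(3) that by (simp add: is_odd_Demazure_def Let_def)
  have hom: "s \<in> ring_hom R R" using iso by (simp add: ring_iso_def)
  have s_add: "additive_map R R s" and d_add: "additive_map R R d"
    using kl dl by (auto simp: k_linear_def Let_def additive_map_def)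
  note [simp] = additive_map_closed[OF s_add] additive_map_closed[OF d_add]
  note sa = additive_map_add[OF s_add] and da = additive_map_add[OF d_add]
    and sm = additive_map_minus[OF grp grp s_add] and dm = additive_map_minus[OF grp grp d_add]
    and s0 = additive_map_zero[OF grp grp s_add] and d0 = additive_map_zero[OF grp grp d_add]
  have s_one: "s \<one>\<^bsub>R\<^esub> = \<one>\<^bsub>R\<^esub>" using ring_hom_one[OF hom] .
  have s_mult: "s (f \<otimes>\<^bsub>R\<^esub> g) = s f \<otimes>\<^bsub>R\<^esub> s g" if "f \<in> carrier R" "g \<in> carrier R" for f g
    using ring_hom_mult[OF hom that] .
  have xc [simp]: "x v \<in> carrier R" for v using GR.piece_carrier[OF x_closed] .
  have kc [simp]: "k c \<in> carrier R" if "c \<in> carrier K" for c using GR.piece_carrier[OF k_closed[OF that]] .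
  have sk: "s (k c) = k c" if "c \<in> carrier K" for c
  proof -
    have "s (k c \<otimes>\<^bsub>R\<^esub> \<one>\<^bsub>R\<^esub>) = k c \<otimes>\<^bsub>R\<^esub> s \<one>\<^bsub>R\<^esub>"
      using kl that R.one_closed unfolding k_linear_def Let_def by blast
    then show ?thesis using that by (simp add: s_one)
  qed
  have dk: "d (k c) = \<zero>\<^bsub>R\<^esub>" if "c \<in> carrier K" for c
  proof -
    have "d (k c \<otimes>\<^bsub>R\<^esub> \<one>\<^bsub>R\<^esub>) = k c \<otimes>\<^bsub>R\<^esub> d \<one>\<^bsub>R\<^esub>"
      using dl that R.one_closed unfolding k_linear_def Let_def by blast
    then show ?thesis using that by (simp add: d1)
  qed
  have ssx: "s (s (x v)) = x v" for v by (cases v) (simp_all add: sx sm)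
  have dsx: "d (s (x v)) = \<ominus>\<^bsub>R\<^esub> \<one>\<^bsub>R\<^esub>" for v by (cases v) (simp_all add: sx dm dx)
  have s_s: "s (s f) = f" if "f \<in> carrier R" for f
    using that by (induction f rule: R_induct) (simp_all add: sk s_mult ssx sa)
  have d_s: "d (s f) = \<ominus>\<^bsub>R\<^esub> s (d f)" if "f \<in> carrier R" for f
    using that
  proof (induction f rule: R_induct)
    case (const c)
    then show ?case by (simp add: sk dk s0)
  next
    case (var v f)
    then show ?case
      by (simp add: s_mult d_mult dsx ssx dx sa R.l_minus R.r_minus R.minus_add)
  next
    case (add f g)
    then show ?case by (simp add: sa da R.minus_add)
  qed
  have d_d: "d (d f) = \<zero>\<^bsub>R\<^esub>" if "f \<in> carrier R" for f
    using that
  proof (induction f rule: R_induct)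
    case (const c)
    then show ?case by (simp add: dk d0)
  next
    case (var v f)
    then show ?case by (simp add: d_mult da dx dsx ssx R.l_minus R.r_neg)
  next
    case (add f g)
    then show ?case by (simp add: da)
  qed
  have mult: "f \<otimes>\<^bsub>R\<^esub> g \<in> rgrade R (i + j)" if "f \<in> rgrade R i" "g \<in> rgrade R j" for f g i j
    using graded_ring.rgrade_mult[OF graded_ring_R that] .
  have sxg: "s (x v) \<in> rgrade R 2" for v
    by (cases v) (simp_all add: sx GR.piece_minus x_closed)
  have s_grade: "s f \<in> rgrade R i" if "f \<in> rgrade R i" for f i
    using that
  proof (induction rule: rgrade_induct[where Q = "\<lambda>i f. s f \<in> rgrade R i"])
    case (var v j f)
    then show ?case using mult[OF sxg var(2), of v] GR.piece_carrier[OF var(1)]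
      by (simp add: s_mult add.commute)
  qed (auto simp: sk k_closed sa s0 GR.piece_carrier GR.piece_add GR.piece_zero)
  have d_grade: "d f \<in> rgrade R (i - 2)" if "f \<in> rgrade R i" for f i
    using that
  proof (induction rule: rgrade_induct[where Q = "\<lambda>i f. d f \<in> rgrade R (i - 2)"])
    case (var v j f)
    have "s (x v) \<otimes>\<^bsub>R\<^esub> d f \<in> rgrade R j" using mult[OF sxg var(2), of v] by simp
    then show ?case using var(1) GR.piece_carrier[OF var(1)] by (simp add: d_mult dx GR.piece_add)
  qed (auto simp: dk da d0 GR.piece_carrier GR.piece_add GR.piece_zero)
  show ?thesis
    by (intro odd_Demazure_ring.intro odd_Demazure_ring_axioms.intro graded_ring_R s_add s_mult s_one
        s_s s_grade d_add d_mult d_d d_s d_grade x_closed dx)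
qed


section \<open>Induction from the kernel of the Demazure operator\<close>

context odd_Demazure_ring
begin

lemma S_simps [simp]:
  "carrier S = kern" "\<zero>\<^bsub>S\<^esub> = \<zero>" "\<one>\<^bsub>S\<^esub> = \<one>" "f \<oplus>\<^bsub>S\<^esub> g = f \<oplus> g" "f \<otimes>\<^bsub>S\<^esub> g = f \<otimes> g"
  "rgrade S i = rgrade R i \<inter> kern"
  by (simp_all add: S_def)

text \<open>As \<open>\<partial>\<close> is homogeneous, its kernel is a graded subring.\<close>

lemma part_kern:
  assumes "f \<in> kern"
  shows "gr.part f i \<in> kern"
proof -
  have "d (gr.part f i) = gr.part (d f) (i + - 2)"
    by (rule gr.part_commute[OF gr.graded_group_axioms d_additive]) (use assms d_rgrade in auto)
  moreover have "d f = \<zero>" using assms by (simp add: kern_def del: kern_carrier)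
  ultimately have "d (gr.part f i) = \<zero>" using gr.part_homog[OF gr.piece_zero] by simp
  then show ?thesis using gr.part_carrier assms unfolding kern_def by blast
qed

lemma graded_ring_S: "graded_ring S"
proof -
  have grp: "abelian_group S"
  proof (rule abelian_groupI)
    show "\<exists>g\<in>carrier S. g \<oplus>\<^bsub>S\<^esub> f = \<zero>\<^bsub>S\<^esub>" if "f \<in> carrier S" for f
      using that by (intro bexI[of _ "\<ominus> f"]) (auto simp: kern_closed l_neg)
  qed (auto simp: kern_closed a_ac)
  have "monoid S" by (rule monoidI) (auto simp: kern_closed m_assoc)
  then have ring: "ring S" by (intro ringI grp) (auto simp: l_distr r_distr)
  interpret S: abelian_group S by (rule grp)
  have incl: "additive_map S R (\<lambda>f. f)" by (rule additive_mapI) auto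
  have "graded_by S (\<lambda>i. rgrade R i \<inter> kern)"
  proof (rule graded_byI[OF grp, of _ gr.part])
    show "additive_subgroup (rgrade R i \<inter> kern) S" for i
    proof (rule additive_subgroupI, rule S.add.subgroupI)
      show "rgrade R i \<inter> kern \<noteq> {}" using gr.piece_zero kern_closed(1) by blast
      show "\<ominus>\<^bsub>S\<^esub> f \<in> rgrade R i \<inter> kern" if f: "f \<in> rgrade R i \<inter> kern" for f
        using additive_map_minus[OF grp abelian_group_axioms incl, of f] f kern_closed(4) gr.piece_minus
        by simp
    qed (auto simp: gr.piece_add kern_closed)
    show "additive_map S S (\<lambda>f. gr.part f i)" for i
      by (rule additive_mapI) (auto simp: part_kern gr.part_add)
    show "\<exists>A. finite A \<and> (\<forall>i. i \<notin> A \<longrightarrow> gr.part f i = \<zero>\<^bsub>S\<^esub>) \<and> f = (\<Oplus>\<^bsub>S\<^esub>i\<in>A. gr.part f i)"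
      if "f \<in> carrier S" for f
    proof -
      have f: "f \<in> kern" using that by simp
      obtain A where A: "finite A" "\<forall>i. i \<notin> A \<longrightarrow> gr.part f i = \<zero>" "f = (\<Oplus>i\<in>A. gr.part f i)"
        using gr.sum_of_parts[OF kern_carrier[OF f]] by blast
      have "(\<Oplus>\<^bsub>S\<^esub>i\<in>A. gr.part f i) = (\<Oplus>i\<in>A. gr.part f i)"
        using additive_map_finsum[OF grp abelian_group_axioms incl A(1), of "gr.part f"] part_kern[OF f]
        by simp
      then show ?thesis using A by (intro exI[of _ A]) auto
    qed
  qed (auto simp: gr.part_props(1) part_kern gr.part_homog)
  then show ?thesis
    by (intro graded_ring.intro graded_ring_axioms.intro ring)
      (auto simp: rgrade_one kern_closed rgrade_mult S_def)
qed

lemma restrict_module: "graded_module R M \<Longrightarrow> graded_module S M"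
proof -
  assume "graded_module R M"
  then interpret M: graded_module R M .
  show ?thesis
    by (intro graded_module.intro graded_module_axioms.intro graded_ring_S M.M.abelian_group_axioms)
      (auto simp: M.smult_closed M.smult_l_distr M.smult_r_distr M.smult_assoc M.smult_one M.mgrade_sum
        M.mgrade_smult)
qed

definition restriction :: "(('a, 'b) gmodule, 'b \<Rightarrow> 'b, ('a, 'b) gmodule, 'b \<Rightarrow> 'b) func"
  where "restriction = \<lparr>omap = \<lambda>M. M, amap = \<lambda>M N f. f\<rparr>"

lemma is_functor_restriction: "is_functor (gmod R) (gmod S) restriction"
  by (rule is_functorI) (auto simp: restriction_def restrict_module gmod_hom_def)

definition ind :: "('a, 'a, 'a) gbimodule"
  where "ind = \<lparr>carrier = carrier R, mult = mult R, one = one R, zero = zero R, add = add R,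
    smult = mult R, mgrade = rgrade R, rsmult = mult R\<rparr>"

definition twist :: "('a, 'a, 'a) gbimodule"
  where "twist = \<lparr>carrier = carrier S, mult = mult S, one = one S, zero = zero S, add = add S,
    smult = \<lambda>f g. s f \<otimes>\<^bsub>S\<^esub> g, mgrade = rgrade S, rsmult = mult S\<rparr>"

lemma ind_simps [simp]:
  "carrier ind = carrier R" "\<zero>\<^bsub>ind\<^esub> = \<zero>" "p \<oplus>\<^bsub>ind\<^esub> q = p \<oplus> q" "a \<odot>\<^bsub>ind\<^esub> p = a \<otimes> p"
  "mgrade ind = rgrade R" "rsmult ind p b = p \<otimes> b"
  by (simp_all add: ind_def)

lemma twist_simps [simp]:
  "carrier twist = kern" "\<zero>\<^bsub>twist\<^esub> = \<zero>" "p \<oplus>\<^bsub>twist\<^esub> q = p \<oplus> q" "a \<odot>\<^bsub>twist\<^esub> p = s a \<otimes> p"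
  "mgrade twist i = rgrade R i \<inter> kern" "rsmult twist p b = p \<otimes> b"
  by (simp_all add: twist_def)

lemma graded_bimodule_ind: "graded_bimodule R S ind"
proof (intro graded_bimodule.intro graded_bimodule_axioms.intro graded_ring_S graded_ring_axioms)
  have "graded_group ind (rgrade R)"
    by (rule graded_group_cong[OF gr.graded_group_axioms]) (simp_all add: ind_def)
  then show "graded_group ind (mgrade ind)" by simp
qed (auto simp: l_distr r_distr m_assoc rgrade_mult)

lemma graded_bimodule_twist: "graded_bimodule S S twist"
proof (intro graded_bimodule.intro graded_bimodule_axioms.intro graded_ring_S)
  have "graded_group twist (rgrade S)"
    by (rule graded_group_cong[OF graded_ring.graded_group_ring[OF graded_ring_S]])
      (simp_all add: fun_eq_iff)
  moreover have "mgrade twist = rgrade S" by (simp add: fun_eq_iff)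
  ultimately show "graded_group twist (mgrade twist)" by (simp only:)
qed (simp_all add: l_distr r_distr m_assoc rgrade_mult kern_closed kern_s s_add s_mult s_one s_rgrade)

text \<open>Inducing a functor \<open>D\<close> to modules over the kernel gives a twisted induction whenever \<open>D\<close> is
  restriction up to a natural \<open>\<sigma>\<close>-semilinear isomorphism \<open>v\<close>, with inverse \<open>w\<close>. The shift
  accounts for the degree \<open>-2\<close> of \<open>\<partial>\<close>, which is split evenly between \<open>u\<close> and the trace.\<close>

lemma twisted_induction_ind:
  fixes D :: "(('a, ('a, 'u) univ) gmodule, ('a, 'u) univ \<Rightarrow> ('a, 'u) univ,
      ('a, ('a, 'u) univ) gmodule, ('a, 'u) univ \<Rightarrow> ('a, 'u) univ) func"
  assumes \<sigma>: "\<sigma> = id \<or> \<sigma> = s"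
    and D: "is_functor (gmod R) (gmod S) D"
    and v: "\<And>M. graded_module R M \<Longrightarrow> additive_map M (omap D M) (v M)"
    and w: "\<And>M. graded_module R M \<Longrightarrow> additive_map (omap D M) M (w M)"
    and wv: "\<And>M m. graded_module R M \<Longrightarrow> m \<in> carrier M \<Longrightarrow> w M (v M m) = m"
    and vw: "\<And>M t. graded_module R M \<Longrightarrow> t \<in> carrier (omap D M) \<Longrightarrow> v M (w M t) = t"
    and v_smult: "\<And>M f m. \<lbrakk>graded_module R M; f \<in> kern; m \<in> carrier M\<rbrakk>
      \<Longrightarrow> v M (f \<odot>\<^bsub>M\<^esub> m) = \<sigma> f \<odot>\<^bsub>omap D M\<^esub> v M m"
    and v_mgrade: "\<And>M i m. graded_module R M \<Longrightarrow> m \<in> mgrade M i \<Longrightarrow> v M m \<in> mgrade (omap D M) i"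
    and w_mgrade: "\<And>M i t. graded_module R M \<Longrightarrow> t \<in> mgrade (omap D M) i \<Longrightarrow> w M t \<in> mgrade M i"
    and v_natural: "\<And>M N f m. \<lbrakk>graded_module R M; graded_module R N; f \<in> gmod_hom R M N; m \<in> carrier M\<rbrakk>
      \<Longrightarrow> amap D M N f (v M m) = v N (f m)"
  shows "twisted_induction R s d x \<sigma> (shift_func 1 \<circ>\<^sub>F tensor_func S ind \<circ>\<^sub>F D)
    (\<lambda>M m. pure_tensor S ind (omap D M) \<one> (v M m))
    (\<lambda>M t. w M (graded_tensor.lift (omap D M) (\<lambda>r n. d r \<odot>\<^bsub>omap D M\<^esub> n) t))"
    (is "twisted_induction R s d x \<sigma> ?F ?u ?c")
proof -
  interpret P: graded_bimodule R S ind by (rule graded_bimodule_ind)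
  have DS: "graded_module S (omap D M)" if "graded_module R M" for M
    using is_functor.omap_Obj[OF D] that by (simp add: Obj_gmod)
  have gt: "graded_tensor R S ind (omap D M)" if "graded_module R M" for M
    using DS[OF that] by (intro graded_tensor.intro graded_bimodule_ind)
  have F: "omap ?F M = tensor S ind (omap D M)\<lparr>mgrade := \<lambda>i. mgrade (tensor S ind (omap D M)) (i + 1)\<rparr>" for M
    by (simp add: comp_func_def shift_func_def tensor_func_def)
  have Fm: "amap ?F M N f = amap (tensor_func S ind) (omap D M) (omap D N) (amap D M N f)" for M N f
    by (simp add: comp_func_def shift_func_def)
  have \<sigma>k: "\<sigma> f \<in> kern" "\<sigma> (\<sigma> f) = f" if "f \<in> kern" for f
    using \<sigma> kern_s s_s that by auto
  have add_F: "additive_map (omap ?F M) N h \<longleftrightarrow> additive_map (tensor S ind (omap D M)) N h"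
    "additive_map N (omap ?F M) h' \<longleftrightarrow> additive_map N (tensor S ind (omap D M)) h'"
    for M :: "('a, ('a, 'u) univ) gmodule" and N :: "('a, ('a, 'u) univ) gmodule" and h h'
    by (simp_all add: additive_map_def F)
  show ?thesis
  proof (intro twisted_induction.intro twisted_induction_axioms.intro odd_Demazure_ring_axioms)
    show "is_functor (gmod R) (gmod R) ?F"
      by (intro is_functor_comp[OF is_functor_comp[OF D P.is_functor_tensor] is_functor_shift])
    show "semilinear \<sigma> (- 1) M (omap ?F M) (?u M)" if M: "graded_module R M" for M
      unfolding semilinear_def add_F
    proof (intro conjI allI ballI)
      interpret T: graded_tensor R S ind "omap D M" using gt[OF M] .
      note vc = additive_map_closed[OF v[OF M]]
      show "additive_map M T.T (?u M)"
      proof (rule additive_mapI)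
        show "?u M m \<in> carrier T.T" if "m \<in> carrier M" for m
          using T.pure_closed vc[OF that] by simp
        show "?u M (m \<oplus>\<^bsub>M\<^esub> n) = ?u M m \<oplus>\<^bsub>T.T\<^esub> ?u M n" if "m \<in> carrier M" "n \<in> carrier M" for m n
          using T.pure_add_right[of \<one> "v M m" "v M n"] additive_map_add[OF v[OF M] that] vc that by simp
      qed
      show "?u M (f \<odot>\<^bsub>M\<^esub> m) = \<sigma> f \<odot>\<^bsub>omap ?F M\<^esub> ?u M m" if f: "f \<in> kern" and m: "m \<in> carrier M" for f m
        using v_smult[OF M f m] T.pure_balance[of \<one> "\<sigma> f" "v M m"] \<sigma>k[OF f] vc[OF m]
        by (simp add: F T.smult_pure)
      show "?u M m \<in> mgrade (omap ?F M) (i + - 1)" if m: "m \<in> mgrade M i" for i m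
        using T.pure_mgrade[of \<one> 0, OF _ v_mgrade[OF M m]] rgrade_one by (simp add: F)
    qed
    show "amap ?F M N f (?u M m) = ?u N (f m)"
      if M: "graded_module R M" and N: "graded_module R N" and f: "f \<in> gmod_hom R M N"
        and m: "m \<in> carrier M" for M N f m
    proof -
      have Df: "amap D M N f \<in> gmod_hom S (omap D M) (omap D N)"
        using is_functor.amap_Hom[OF D, of M N f] M N f by (simp add: Obj_gmod Hom_gmod)
      show ?thesis
        using P.amap_tensor_pure[OF DS[OF M] DS[OF N] Df, of \<one> "v M m"] additive_map_closed[OF v[OF M] m]
          v_natural[OF M N f m] by (simp add: Fm)
    qed
    have ru: "r \<odot>\<^bsub>omap ?F M\<^esub> ?u M m = pure_tensor S ind (omap D M) r (v M m)"
      if M: "graded_module R M" and r: "r \<in> carrier R" and m: "m \<in> carrier M" for M r m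
    proof -
      interpret T: graded_tensor R S ind "omap D M" using gt[OF M] .
      show ?thesis using r by (simp add: F T.smult_pure)
    qed
    show "Q t"
      if M: "graded_module R M" and t: "t \<in> carrier (omap ?F M)" and "Q \<zero>\<^bsub>omap ?F M\<^esub>"
        and Q: "\<And>r m. \<lbrakk>r \<in> carrier R; m \<in> carrier M\<rbrakk> \<Longrightarrow> Q (r \<odot>\<^bsub>omap ?F M\<^esub> ?u M m)"
        and "\<And>t t'. \<lbrakk>t \<in> carrier (omap ?F M); t' \<in> carrier (omap ?F M); Q t; Q t'\<rbrakk> \<Longrightarrow> Q (t \<oplus>\<^bsub>omap ?F M\<^esub> t')"
      for M t Q
    proof -
      have "t \<in> carrier (tensor S ind (omap D M))" using t by (simp add: F)
      then show ?thesis
      proof (induction t rule: tensor_induct)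
        case (pure r n)
        then have "w M n \<in> carrier M" using additive_map_closed[OF w[OF M]] by blast
        then show ?case using Q[of r "w M n"] ru[OF M, of r "w M n"] vw[OF M] pure by simp
      qed (use that in \<open>auto simp: F\<close>)
    qed
    show "\<exists>h\<in>gmod_hom R (omap ?F M) N. \<forall>m\<in>carrier M. h (?u M m) = \<phi> m"
      if M: "graded_module R M" and N: "graded_module R N" and \<phi>: "semilinear \<sigma> (- 1) M N \<phi>" for M N \<phi>
    proof -
      interpret T: graded_tensor R S ind "omap D M" using gt[OF M] .
      interpret M: graded_module R M by (rule M)
      interpret N: graded_module R N by (rule N)
      note p = semilinearD[OF \<phi>]
      note pc = additive_map_closed[OF p(1)] and wc = additive_map_closed[OF w[OF M]]
      let ?g = "\<lambda>r n. r \<odot>\<^bsub>N\<^esub> \<phi> (w M n)"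
      have w_smult: "w M (f \<odot>\<^bsub>omap D M\<^esub> n) = \<sigma> f \<odot>\<^bsub>M\<^esub> w M n" if f: "f \<in> kern" and n: "n \<in> carrier (omap D M)" for f n
        using v_smult[OF M \<sigma>k(1)[OF f] wc[OF n]] \<sigma>k[OF f] vw[OF M n]
          wv[OF M M.smult_closed[OF kern_carrier[OF \<sigma>k(1)[OF f]] wc[OF n]]] by simp
      have bal: "T.balanced N ?g"
        unfolding T.balanced_def
      proof (intro conjI ballI)
        show "additive_map (omap D M) N (?g r)" if "r \<in> carrier ind" for r
          by (rule additive_mapI)
            (use that pc wc additive_map_add[OF p(1)] additive_map_add[OF w[OF M]]
              in \<open>auto simp: N.smult_closed N.smult_r_distr\<close>)
        show "additive_map ind N (\<lambda>r. ?g r n)" if "n \<in> carrier (omap D M)" for n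
          by (rule additive_mapI) (use that pc wc in \<open>auto simp: N.smult_closed N.smult_l_distr\<close>)
        show "?g (rsmult ind r f) n = ?g r (f \<odot>\<^bsub>omap D M\<^esub> n)"
          if "r \<in> carrier ind" "f \<in> carrier S" "n \<in> carrier (omap D M)" for r f n
          using that w_smult[of f n] p(2)[OF \<sigma>k(1), of f "w M n"] wc[of n] pc[of "w M n"] \<sigma>k(2)[of f]
          by (simp add: N.smult_assoc)
      qed
      note L = T.lift[OF N.M.abelian_group_axioms bal]
      let ?h = "\<lambda>t\<in>carrier T.T. T.lift N ?g t"
      have "?h \<in> gmod_hom R (omap ?F M) N"
      proof (rule gmod_homI)
        show "additive_map (omap ?F M) N ?h"
          unfolding add_F
          by (rule additive_mapI)
            (use additive_map_closed[OF L(1)] additive_map_add[OF L(1)]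
              abelian_group.axioms(1)[OF T.tensor_abelian_group, THEN abelian_monoidE(1)] in auto)
        show "?h \<in> extensional (carrier (omap ?F M))" by (simp add: F)
        show "?h (a \<odot>\<^bsub>omap ?F M\<^esub> t) = a \<odot>\<^bsub>N\<^esub> ?h t" if a: "a \<in> carrier R" and t: "t \<in> carrier (omap ?F M)" for a t
        proof -
          have t: "t \<in> carrier T.T" using t by (simp add: F)
          have "T.lift N ?g (a \<odot>\<^bsub>T.T\<^esub> t) = a \<odot>\<^bsub>N\<^esub> T.lift N ?g t"
          proof (rule T.additive_map_eq_on_pure[OF N.M.abelian_group_axioms _ _ _ t])
            show "additive_map T.T N (\<lambda>t. T.lift N ?g (a \<odot>\<^bsub>T.T\<^esub> t))"
              by (rule additive_mapI) (use a additive_map_closed[OF L(1)] additive_map_add[OF L(1)]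
                  in \<open>auto simp: T.smult_tensor_closed T.smult_tensor_add\<close>)
            show "additive_map T.T N (\<lambda>t. a \<odot>\<^bsub>N\<^esub> T.lift N ?g t)"
              by (rule additive_mapI) (use a additive_map_closed[OF L(1)] additive_map_add[OF L(1)]
                  in \<open>auto simp: N.smult_closed N.smult_r_distr\<close>)
          qed (use a L(2) pc wc in \<open>auto simp: T.smult_pure N.smult_assoc\<close>)
          then show ?thesis using t a T.smult_tensor_closed by (simp add: F)
        qed
        show "?h t \<in> mgrade N i" if "t \<in> mgrade (omap ?F M) i" for t i
        proof -
          have t: "t \<in> mgrade T.T (i + 1)" using that by (simp add: F)
          have "T.lift N ?g t \<in> mgrade N (i + 1 + - 1)"
          proof (rule T.lift_mgrade[OF N.graded_group_module bal _ t])
            show "r \<odot>\<^bsub>N\<^esub> \<phi> (w M n) \<in> mgrade N (j + k + - 1)"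
              if "r \<in> mgrade ind j" "n \<in> mgrade (omap D M) k" for r n j k
              using N.mgrade_smult[OF _ p(3)[OF w_mgrade[OF M that(2)]], of r j] that(1) by (simp add: add_diff_eq)
          qed
          then show ?thesis using t T.mgrade_carrier by auto
        qed
      qed
      moreover have "?h (?u M m) = \<phi> m" if m: "m \<in> carrier M" for m
        using L(2)[of \<one> "v M m"] additive_map_closed[OF v[OF M] m] wv[OF M m] pc[OF m]
          T.pure_closed[of \<one> "v M m"] by (simp add: N.smult_one)
      ultimately show ?thesis by blast
    qed
    fix M :: "('a, ('a, 'u) univ) gmodule" assume M: "graded_module R M"
    interpret T: graded_tensor R S ind "omap D M" using gt[OF M] .
    interpret M: graded_module R M by (rule M)
    let ?g = "\<lambda>r n. d r \<odot>\<^bsub>omap D M\<^esub> n"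
    have bal: "T.balanced (omap D M) ?g"
      unfolding T.balanced_def
    proof (intro conjI ballI)
      show "additive_map (omap D M) (omap D M) (?g r)" if "r \<in> carrier ind" for r
        by (rule additive_mapI) (use that kern_d T.M.smult_closed T.M.smult_r_distr in auto)
      show "additive_map ind (omap D M) (\<lambda>r. ?g r n)" if "n \<in> carrier (omap D M)" for n
        by (rule additive_mapI) (use that kern_d T.M.smult_closed T.M.smult_l_distr in \<open>auto simp: d_add\<close>)
      show "?g (rsmult ind r f) n = ?g r (f \<odot>\<^bsub>omap D M\<^esub> n)"
        if "r \<in> carrier ind" "f \<in> carrier S" "n \<in> carrier (omap D M)" for r f n
        using that T.M.smult_assoc[of "d r" f n] kern_d[of r] by (simp add: d_kern_right)
    qed
    note L = T.lift[OF T.M.M.abelian_group_axioms bal]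
    show "additive_map (omap ?F M) M (?c M)"
      unfolding add_F
      by (rule additive_mapI)
        (use additive_map_closed[OF L(1)] additive_map_add[OF L(1)] additive_map_closed[OF w[OF M]]
          additive_map_add[OF w[OF M]] in auto)
    show "?c M t \<in> mgrade M (i - 1)" if "t \<in> mgrade (omap ?F M) i" for t i
    proof (rule w_mgrade[OF M])
      have t: "t \<in> mgrade T.T (i + 1)" using that by (simp add: F)
      have "T.lift (omap D M) ?g t \<in> mgrade (omap D M) (i + 1 + - 2)"
      proof (rule T.lift_mgrade[OF T.M.graded_group_module bal _ t])
        show "d r \<odot>\<^bsub>omap D M\<^esub> n \<in> mgrade (omap D M) (j + k + - 2)"
          if "r \<in> mgrade ind j" "n \<in> mgrade (omap D M) k" for r n j k
          using T.M.mgrade_smult[of "d r" "j - 2" n k] that d_rgrade kern_d gr.piece_carrier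
          by (simp add: algebra_simps)
      qed
      then show "T.lift (omap D M) ?g t \<in> mgrade (omap D M) (i - 1)" by simp
    qed
    show "?c M (r \<odot>\<^bsub>omap ?F M\<^esub> ?u M m) = \<sigma> (d r) \<odot>\<^bsub>M\<^esub> m" if r: "r \<in> carrier R" and m: "m \<in> carrier M" for r m
    proof -
      have "?c M (r \<odot>\<^bsub>omap ?F M\<^esub> ?u M m) = w M (d r \<odot>\<^bsub>omap D M\<^esub> v M m)"
        using ru[OF M r m] L(2)[of r "v M m"] r additive_map_closed[OF v[OF M] m] by simp
      also have "d r \<odot>\<^bsub>omap D M\<^esub> v M m = v M (\<sigma> (d r) \<odot>\<^bsub>M\<^esub> m)"
        using v_smult[OF M \<sigma>k(1)[OF kern_d[OF r]] m] \<sigma>k(2)[OF kern_d[OF r]] by simp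
      also have "w M \<dots> = \<sigma> (d r) \<odot>\<^bsub>M\<^esub> m"
        using wv[OF M] M.smult_closed \<sigma>k(1)[OF kern_d[OF r]] m by simp
      finally show ?thesis .
    qed
  qed
qed

text \<open>Tensoring with the twisted bimodule is restriction along \<open>s\<close>: the map \<open>m \<mapsto> 1\<^sup>s \<otimes> m\<close> is an
  \<open>s\<close>-semilinear isomorphism, with inverse \<open>1\<^sup>s g \<otimes> m \<mapsto> g m\<close>.\<close>

lemma twist_iso:
  fixes M :: "('a, ('a, 'u) univ) gmodule"
  assumes M: "graded_module R M"
  defines "v \<equiv> pure_tensor S twist M \<one>" and "w \<equiv> graded_tensor.lift M (\<lambda>g m. g \<odot>\<^bsub>M\<^esub> m)"
  shows "additive_map M (tensor S twist M) v"
    and "additive_map (tensor S twist M) M w"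
    and "\<And>m. m \<in> carrier M \<Longrightarrow> w (v m) = m"
    and "\<And>t. t \<in> carrier (tensor S twist M) \<Longrightarrow> v (w t) = t"
    and "\<And>f m. f \<in> kern \<Longrightarrow> m \<in> carrier M \<Longrightarrow> v (f \<odot>\<^bsub>M\<^esub> m) = s f \<odot>\<^bsub>tensor S twist M\<^esub> v m"
    and "\<And>i m. m \<in> mgrade M i \<Longrightarrow> v m \<in> mgrade (tensor S twist M) i"
    and "\<And>i t. t \<in> mgrade (tensor S twist M) i \<Longrightarrow> w t \<in> mgrade M i"
proof -
  interpret M: graded_module R M by (rule M)
  interpret T: graded_tensor S S twist M
    by (intro graded_tensor.intro graded_bimodule_twist restrict_module M)
  have bal: "T.balanced M (\<lambda>g m. g \<odot>\<^bsub>M\<^esub> m)"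
    unfolding T.balanced_def
    by (auto intro!: additive_mapI simp: M.smult_closed M.smult_l_distr M.smult_r_distr M.smult_assoc)
  note L = T.lift[OF M.M.abelian_group_axioms bal, folded w_def]
  have bal1: "v (g \<odot>\<^bsub>M\<^esub> m) = T.pure g m" if "g \<in> kern" "m \<in> carrier M" for g m
    using T.pure_balance[of \<one> g m] that by (simp add: v_def kern_closed)
  show v: "additive_map M T.T v"
    by (rule additive_mapI) (auto simp: v_def T.pure_closed T.pure_add_right kern_closed)
  show w: "additive_map T.T M w" by (rule L(1))
  show "w (v m) = m" if "m \<in> carrier M" for m
    using that L(2)[of \<one> m] by (simp add: v_def kern_closed M.smult_one)
  show "v (w t) = t" if t: "t \<in> carrier T.T" for t
  proof (rule T.additive_map_eq_on_pure[OF T.tensor_abelian_group _ _ _ t])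
    show "additive_map T.T T.T (\<lambda>t. v (w t))"
      by (rule additive_mapI)
        (use additive_map_closed[OF v] additive_map_add[OF v] additive_map_closed[OF w] additive_map_add[OF w]
          in auto)
    show "additive_map T.T T.T (\<lambda>t. t)" by (rule additive_mapI) auto
  qed (simp add: L(2) bal1)
  show "v (f \<odot>\<^bsub>M\<^esub> m) = s f \<odot>\<^bsub>T.T\<^esub> v m" if "f \<in> kern" "m \<in> carrier M" for f m
    using bal1[OF that] that by (simp add: v_def T.smult_pure kern_s s_s)
  show "v m \<in> mgrade T.T i" if "m \<in> mgrade M i" for i m
    using T.pure_mgrade[of \<one> 0, OF _ that] rgrade_one by (simp add: v_def kern_closed)
  show "w t \<in> mgrade M i" if "t \<in> mgrade T.T i" for i t
  proof -
    have "g \<odot>\<^bsub>M\<^esub> m \<in> mgrade M (j + k + 0)" if "g \<in> mgrade twist j" "m \<in> mgrade M k" for g m j k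
      using M.mgrade_smult[of g j m k] that by simp
    from T.lift_mgrade[OF M.graded_group_module bal this that] show ?thesis by (simp add: w_def)
  qed
qed

text \<open>Plain restriction has the twist \<open>id\<close>, and restriction followed by the twisting bimodule has the
  twist \<open>s\<close>. Each is complementary to the other, which gives both adjunctions.\<close>

theorem biadjoint_ind_twist:
  "biadjoint (gmod R :: (('a, ('a, 'u) univ) gmodule, _) cat) (gmod R)
    (shift_func 1 \<circ>\<^sub>F tensor_func S ind \<circ>\<^sub>F restriction)
    (shift_func 1 \<circ>\<^sub>F tensor_func S ind \<circ>\<^sub>F tensor_func S twist \<circ>\<^sub>F restriction)"
proof -
  define D :: "(('a, ('a, 'u) univ) gmodule, ('a, 'u) univ \<Rightarrow> ('a, 'u) univ,
      ('a, ('a, 'u) univ) gmodule, ('a, 'u) univ \<Rightarrow> ('a, 'u) univ) func"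
    where "D = tensor_func S twist \<circ>\<^sub>F restriction"
  have oD: "omap D = tensor S twist"
    unfolding D_def comp_func_def restriction_def tensor_func_def func.simps ..
  have aD: "amap D = amap (tensor_func S twist)"
    unfolding D_def comp_func_def restriction_def func.simps ..
  note straight = twisted_induction_ind[where \<sigma> = id and v = "\<lambda>M m. m" and w = "\<lambda>M m. m",
      OF disjI1[OF HOL.refl] is_functor_restriction]
  have 1: "\<exists>u c. twisted_induction R s d x id
      (shift_func 1 \<circ>\<^sub>F tensor_func S ind \<circ>\<^sub>F (restriction ::
        (('a, ('a, 'u) univ) gmodule, _, ('a, ('a, 'u) univ) gmodule, _) func)) u c"
    by (intro exI, rule straight) (auto simp: restriction_def additive_map_def)
  have Dfun: "is_functor (gmod R) (gmod S) D"
    unfolding D_def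
    by (rule is_functor_comp[OF is_functor_restriction
          graded_bimodule.is_functor_tensor[OF graded_bimodule_twist]])
  have 2: "\<exists>u c. twisted_induction R s d x s (shift_func 1 \<circ>\<^sub>F tensor_func S ind \<circ>\<^sub>F D) u c"
  proof (intro exI, rule twisted_induction_ind[where v = "\<lambda>M. pure_tensor S twist M \<one>"
        and w = "\<lambda>M. graded_tensor.lift M (\<lambda>g m. g \<odot>\<^bsub>M\<^esub> m)", OF disjI2[OF HOL.refl] Dfun], unfold oD aD)
    fix M N :: "('a, ('a, 'u) univ) gmodule" and f m
    assume M: "graded_module R M" and N: "graded_module R N" and f: "f \<in> gmod_hom R M N"
      and m: "m \<in> carrier M"
    have "f \<in> gmod_hom S M N" using f by (auto simp: gmod_hom_def)
    then show "amap (tensor_func S twist) M N f (pure_tensor S twist M \<one> m) = pure_tensor S twist N \<one> (f m)"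
      using graded_bimodule.amap_tensor_pure[OF graded_bimodule_twist restrict_module[OF M] restrict_module[OF N]]
        m kern_closed(2) by simp
  qed (rule twist_iso; assumption)+
  obtain u c v e where 3: "twisted_induction R s d x id
      (shift_func 1 \<circ>\<^sub>F tensor_func S ind \<circ>\<^sub>F (restriction ::
        (('a, ('a, 'u) univ) gmodule, _, ('a, ('a, 'u) univ) gmodule, _) func)) u c"
    "twisted_induction R s d x s (shift_func 1 \<circ>\<^sub>F tensor_func S ind \<circ>\<^sub>F D) v e"
    using 1 2 by blast
  have "complementary id s" "complementary s id" by (simp_all add: complementary_def)
  then show ?thesis
    unfolding biadjoint_def D_def[symmetric]
    by (intro conjI twisted_induction_adjoint[OF 3] twisted_induction_adjoint[OF 3(2,1)])
qed

end

theorem proposition2p2: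
  fixes K :: "('k, 'z) ring_scheme"
    and s d :: "'k odd_poly \<Rightarrow> 'k odd_poly"
  assumes "cring K"
    and "is_odd_swap K s"
    and "is_odd_Demazure K s d"
  shows "biadjoint (gmod (odd_ring K) :: ('k, 'a) odd_cat) (gmod (odd_ring K))
           (shift_func 1 \<circ>\<^sub>F F_up_down K d)
           (shift_func 1 \<circ>\<^sub>F F_up_twist_down K s d)"
proof -
  interpret D: odd_Demazure_ring "odd_ring K" s d "odd_x K X1"
    by (rule odd_ring_Demazure[OF assms])
  have S: "odd_sym_ring K d = D.S"
    unfolding odd_sym_ring_def D.S_def D.kern_def Let_def ..
  have ind: "ind_bimodule K = D.ind" and twist: "twist_bimodule K s d = D.twist"
    unfolding ind_bimodule_def twist_bimodule_def D.ind_def D.twist_def S Let_def by (rule HOL.refl)+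
  have down: "F_down = D.restriction"
    unfolding F_down_def D.restriction_def ..
  show ?thesis
    unfolding F_up_down_def F_up_twist_down_def F_up_def F_twist_def S ind twist down
    by (rule D.biadjoint_ind_twist)
qed

end
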